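(* Let $\mathcal{R}_{a,b,c}$ be the lattice of congruent triangles with sides $a,b,c$ and opposite angles $\alpha,\beta,\gamma$ (as defined in the context). Let $\mathcal{C}$ be an ellipse (with its interior) whose major axis has length $g$ and whose minor axis has length $h$, and put $\mu^2=1-(h/g)^2$ and $s(\phi)=\frac{g}{2}\sqrt{1-\mu^2\sin^2\phi}$. Assume that $\max_{0\le\phi<2\pi}c^*(\phi)\le c$, where $$c^*(\phi)=s(\phi)\csc\alpha+s(\phi+\alpha+\beta)\csc\beta+s(\phi+\alpha+\pi)(\cot\alpha+\cot\beta).$$ Put $Q=ab\sin\gamma$, $$F=\frac{\pi gh}{4},\qquad u=2g\int_0^{\pi/2}\sqrt{1-\mu^2\sin^2\phi}\;d\phi,\qquad I(x)=g^2\int_0^{\pi}\sqrt{(1-\mu^2\sin^2\phi)(1-\mu^2\sin^2(\phi+x))}\;d\phi .$$ Then the probabilities $p(i)$ that the randomly thrown ellipse $\mathcal{C}$ hits exactly $i$ triangles of $\mathcal{R}_{a,b,c}$ are $$p(1)=1-\frac{(a+b+c)u}{\pi Q}+\frac{(a^2+b^2+c^2)I(0)}{4\pi Q^2}+\frac{bcI(\alpha)+caI(\beta)+abI(\gamma)}{2\pi Q^2},$$ $$p(2)=\frac{(a+b+c)u}{\pi Q}-\frac{3(a^2+b^2+c^2)I(0)}{4\pi Q^2}-\frac{bcI(\alpha)+caI(\beta)+abI(\gamma)}{2\pi Q^2},$$ $$p(3)=\frac{3(a^2+b^2+c^2)I(0)}{4\pi Q^2}-\frac{bcI(\alpha)+caI(\beta)+abI(\gamma)}{2\pi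 Q^2},$$ $$p(4)=\frac{bcI(\alpha)+caI(\beta)+abI(\gamma)}{2\pi Q^2}-\frac{(a^2+b^2+c^2)I(0)}{4\pi Q^2}-\frac{F}{Q},$$ $$p(5)=0,\qquad p(6)=\frac{F}{Q}.$$
   Context: Lattice. Fix a triangle with sides $a,b,c$ and opposite angles $\alpha,\beta,\gamma$, and altitudes $h_a=b\sin\gamma=c\sin\beta$, $h_b=a\sin\gamma=c\sin\alpha$, $h_c=a\sin\beta=b\sin\alpha$. The lattice $\mathcal{R}_{a,b,c}$ is the union of the three families of parallel lines $\{x\sin\beta+y\cos\beta=kh_a\}$, $\{x\sin\alpha-y\cos\alpha=kh_b\}$, $\{y=kh_c\}$, $k\in\mathbb{Z}$, in $\mathbb{R}^2$. These lines cut the plane into triangles ("the triangles of $\mathcal{R}_{a,b,c}$"), all congruent to $\mathcal{T}=\{(x,y): 0\le y\le h_c,\ y\cot\alpha\le x\le c-y\cot\beta\}$. Two triangles form a parallelogram congruent to $\mathcal{Q}=\{(x,y): 0\le y\le h_c,\ y\cot\alpha\le x\le c+y\cot\alpha\}$, whose area is $Q=ab\sin\gamma=ac\sin\beta=bc\sin\alpha$. Body. The reference point $O$ of the ellipse $\mathcal{C}$ is its centre, and $\sigma$ is an oriented line segment starting in $O$ along the major axis; both move rigidly with $\mathcal{C}$. The function $s$ is the support function of $\mathcal{C}$: if $\mathcal{C}$ is placed with $O$ at the origin and rotated so that the angle from the positive $x$-axis to $\sigma$ is $\phi$, then $s(\phi)$ is the maximal $x$-coordinate of the points of $\mathcal{C}$.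 $F$ is the area and $u$ the perimeter of $\mathcal{C}$. Random throw of $\mathcal{C}$ onto $\mathcal{R}_{a,b,c}$: only rotations and translations of $\mathcal{C}$ are used; the position $(x,y)$ of $O$ is uniformly distributed in $\mathcal{Q}$ (so $y$ is uniform in $[0,h_c]$ and, given $y$, $x$ is uniform in $[y\cot\alpha,\,h_b\csc\alpha+y\cot\alpha]$, where $h_b\csc\alpha=c$), and the angle $\phi$ from a fixed direction perpendicular to the sides $b$ to the segment $\sigma$ is uniformly distributed in $[0,2\pi]$ and independent of $(x,y)$. The body hits a triangle if it has nonempty intersection with it; $p(i)$ is the probability that exactly $i$ triangles of $\mathcal{R}_{a,b,c}$ are hit. The quantity $c^*(\phi)$ is the length of the side corresponding to $c$ of the triangle similar to $\mathcal{T}$ (with parallel sides) all of whose sides touch $\mathcal{C}$ in direction $\phi$; the condition $\max c^*\le c$ expresses that in every direction $\mathcal{C}$ fits into a single triangle of the lattice. *)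

theory Defs
  imports "HOL-Probability.Probability"
begin

definition angle_at :: "real \<times> real \<Rightarrow> real \<times> real \<Rightarrow> real \<times> real \<Rightarrow> real" where
  "angle_at P X Y = arccos (((X - P) \<bullet> (Y - P)) / (norm (X - P) * norm (Y - P)))"

definition is_triangle :: "real \<Rightarrow> real \<Rightarrow> real \<Rightarrow> real \<Rightarrow> real \<Rightarrow> real \<Rightarrow> bool" where
  "is_triangle a b c \<alpha> \<beta> \<gamma> \<longleftrightarrow>
     (\<exists>A B C :: real \<times> real. \<not> collinear {A, B, C} \<and>
        dist B C = a \<and> dist C A = b \<and> dist A B = c \<and>
        angle_at A B C = \<alpha> \<and> angle_at B C A = \<beta> \<and> angle_at C A B = \<gamma>)"

text \<open>The altitudes onto the sides \<open>a\<close>, \<open>b\<close>, \<open>c\<close> are \<open>b sin \<gamma>\<close>, \<open>a sin \<gamma>\<close>, \<open>a sin \<beta>\<close>.\<close>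

definition lattice_lines :: "real \<Rightarrow> real \<Rightarrow> real \<Rightarrow> real \<Rightarrow> real \<Rightarrow> real \<Rightarrow> (real \<times> real) set" where
  "lattice_lines a b c \<alpha> \<beta> \<gamma> =
     (\<Union>k::int. {(x, y). x * sin \<beta> + y * cos \<beta> = of_int k * (b * sin \<gamma>)}) \<union>
     (\<Union>k::int. {(x, y). x * sin \<alpha> - y * cos \<alpha> = of_int k * (a * sin \<gamma>)}) \<union>
     (\<Union>k::int. {(x, y). y = of_int k * (a * sin \<beta>)})"

definition lattice_triangles :: "real \<Rightarrow> real \<Rightarrow> real \<Rightarrow> real \<Rightarrow> real \<Rightarrow> real \<Rightarrow> (real \<times> real) set set" where
  "lattice_triangles a b c \<alpha> \<beta> \<gamma> = closure ` components (- lattice_lines a b c \<alpha> \<beta> \<gamma>)"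

definition fund_parallelogram :: "real \<Rightarrow> real \<Rightarrow> real \<Rightarrow> real \<Rightarrow> real \<Rightarrow> real \<Rightarrow> (real \<times> real) set" where
  "fund_parallelogram a b c \<alpha> \<beta> \<gamma> =
     {(x, y). 0 \<le> y \<and> y \<le> a * sin \<beta> \<and> y * cot \<alpha> \<le> x \<and> x \<le> c + y * cot \<alpha>}"

text \<open>The body in its reference position: centre \<open>O\<close> at the origin, major axis (and the
  segment \<open>\<sigma>\<close>) along the positive first coordinate axis.\<close>

definition ellipse :: "real \<Rightarrow> real \<Rightarrow> (real \<times> real) set" where
  "ellipse g h = {(x, y). (x / (g / 2))\<^sup>2 + (y / (h / 2))\<^sup>2 \<le> 1}"

definition moved :: "(real \<times> real) set \<Rightarrow> real \<times> real \<Rightarrow> real \<Rightarrow> (real \<times> real) set" where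
  "moved K O' \<theta> =
     (\<lambda>(x, y). (fst O' + x * cos \<theta> - y * sin \<theta>, snd O' + x * sin \<theta> + y * cos \<theta>)) ` K"

text \<open>A random throw is a pair of the position of \<open>O\<close> and the angle \<open>\<phi>\<close>; the product measure
  expresses their independence.\<close>

definition throw_space :: "real \<Rightarrow> real \<Rightarrow> real \<Rightarrow> real \<Rightarrow> real \<Rightarrow> real \<Rightarrow> ((real \<times> real) \<times> real) measure" where
  "throw_space a b c \<alpha> \<beta> \<gamma> =
     uniform_measure lborel (fund_parallelogram a b c \<alpha> \<beta> \<gamma>) \<Otimes>\<^sub>M uniform_measure lborel {0..2 * pi}"

text \<open>The angle \<open>\<phi>\<close> is measured from the direction \<open>(sin \<alpha>, - cos \<alpha>)\<close>, which is perpendicular to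
  the sides \<open>b\<close>. As this direction has polar angle \<open>\<alpha> - \<pi>/2\<close>, the segment \<open>\<sigma>\<close> of the thrown
  body has polar angle \<open>\<alpha> - \<pi>/2 + \<phi>\<close>.\<close>

definition hit_triangles ::
  "real \<Rightarrow> real \<Rightarrow> real \<Rightarrow> real \<Rightarrow> real \<Rightarrow> real \<Rightarrow> (real \<times> real) set \<Rightarrow> (real \<times> real) \<times> real \<Rightarrow> (real \<times> real) set set" where
  "hit_triangles a b c \<alpha> \<beta> \<gamma> K \<omega> =
     {T \<in> lattice_triangles a b c \<alpha> \<beta> \<gamma>. moved K (fst \<omega>) (\<alpha> - pi / 2 + snd \<omega>) \<inter> T \<noteq> {}}"

definition hit_prob ::
  "real \<Rightarrow> real \<Rightarrow> real \<Rightarrow> real \<Rightarrow> real \<Rightarrow> real \<Rightarrow> (real \<times> real) set \<Rightarrow> nat \<Rightarrow> real" where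
  "hit_prob a b c \<alpha> \<beta> \<gamma> K i =
     measure (throw_space a b c \<alpha> \<beta> \<gamma>)
       {\<omega> \<in> space (throw_space a b c \<alpha> \<beta> \<gamma>).
          finite (hit_triangles a b c \<alpha> \<beta> \<gamma> K \<omega>) \<and> card (hit_triangles a b c \<alpha> \<beta> \<gamma> K \<omega>) = i}"

end

theory Submission
  imports Defs
begin

text \<open>Write the plane in three coordinates with sum zero that take integer values exactly on the three
families of lattice lines. The triangles are then the cells \<open>[i, i+1] \<times> [j, j+1] \<times> [l, l+1]\<close> with
\<open>i + j + l \<in> {-1, -2}\<close>, and the fundamental parallelogram is the unit square of the first two
coordinates. For a fixed direction \<open>\<phi>\<close> the ellipse is an affine image of the unit disc, and its
coordinates range over intervals around those of the centre with half-lengths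
\<open>A = b s(\<phi>) / Q\<close>, \<open>B = c s(\<phi> + \<alpha>) / Q\<close> and \<open>C = a s(\<phi> + \<alpha> + \<beta>) / Q\<close>. The condition
\<open>c\<^sup>* \<le> c\<close> says \<open>A + B + C \<le> 1\<close>. These half-lengths are norms of three vectors with sum zero, no two
of them parallel, so the triangle inequality between them is strict and each is less than \<open>1/2\<close>: at
most one line of each family is met.

Lattice lines cross only in lattice vertices, where three of them meet. Hence, apart from tangent
positions and positions with a vertex on the boundary, the number of triangles hit is one plus the
number of lines met, except that it is six if the ellipse contains a vertex
(\<open>card_hit_cells_no_vertex\<close>, \<open>card_hit_cells_vertex_inside\<close>).

For a uniform centre any two of its three coordinates are independent and uniform modulo 1. So lines
of given families are met with probability \<open>2A\<close>, \<open>2B\<close>, \<open>2C\<close>, and with probability \<open>4AB\<close>, \<open>4AC\<close>,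
\<open>4BC\<close> for two families. The centres for which no line is met form two triangles that fit together
into a square of side \<open>1 - A - B - C\<close>, and the ellipse contains a vertex with probability \<open>F / Q\<close>, since
its translates by lattice vectors are disjoint. Inclusion and exclusion determine the conditional
distribution given \<open>\<phi>\<close> (\<open>measure_square_cell_count\<close>); it is quadratic in \<open>A\<close>, \<open>B\<close>, \<open>C\<close>. Averaging over
\<open>\<phi>\<close> turns the linear terms into the perimeter and the products into the values of \<open>I\<close>
(\<open>support_integrals\<close>), because \<open>s\<close> is even and has period \<open>\<pi>\<close>.\<close>

section \<open>Relations between the sides and angles of a triangle\<close>

lemma gram_identity_plane:
  fixes X Y :: "real \<times> real"
  shows "(norm X * norm Y)\<^sup>2 = (X \<bullet> Y)\<^sup>2 + (fst X * snd Y - snd X * fst Y)\<^sup>2"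
  unfolding power_mult_distrib power2_norm_eq_inner
  by (cases X, cases Y) (simp add: power2_eq_square algebra_simps)

text \<open>The dot product and the cross product of the two sides at a vertex determine the cosine and the
sine of the angle there. The cross product is the same at all three vertices up to sign, being twice
the area, which is what makes the sine rule work.\<close>

lemma angle_at_trig:
  fixes A B C :: "real \<times> real"
  defines "D \<equiv> fst (B - A) * snd (C - A) - snd (B - A) * fst (C - A)"
  assumes D: "D \<noteq> 0"
  shows "dist A B * dist A C * cos (angle_at A B C) = (B - A) \<bullet> (C - A)"
    and "dist A B * dist A C * sin (angle_at A B C) = \<bar>D\<bar>"
proof -
  let ?d = "dist A B * dist A C" and ?i = "(B - A) \<bullet> (C - A)"
  have gram: "?d\<^sup>2 = ?i\<^sup>2 + D\<^sup>2"
    using gram_identity_plane[of "B - A" "C - A"] by (simp add: D_def dist_norm norm_minus_commute)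
  have "?d \<noteq> 0"
    using gram D by (metis add_nonneg_eq_0_iff power_zero_numeral zero_eq_power2 zero_le_power2)
  then have d: "?d > 0"
    by (simp add: less_le)
  have dn: "norm (B - A) * norm (C - A) = ?d"
    by (simp add: dist_norm norm_minus_commute)
  have bnd: "\<bar>?i\<bar> \<le> ?d"
    using Cauchy_Schwarz_ineq2[of "B - A" "C - A"] dn by simp
  have cosd: "cos (angle_at A B C) = ?i / ?d"
    unfolding angle_at_def dn using bnd d
    by (intro cos_arccos) (auto simp: field_simps abs_le_iff)
  then show "dist A B * dist A C * cos (angle_at A B C) = (B - A) \<bullet> (C - A)"
    using d by simp
  have "sin (angle_at A B C) \<ge> 0"
    unfolding angle_at_def dn using bnd d
    by (intro sin_ge_zero arccos_lbound arccos_ubound) (auto simp: field_simps abs_le_iff)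
  then have "?d * sin (angle_at A B C) \<ge> 0"
    using d by simp
  moreover have "(?d * sin (angle_at A B C))\<^sup>2 = D\<^sup>2"
  proof -
    have "(?d * sin (angle_at A B C))\<^sup>2 = ?d\<^sup>2 - (?d * cos (angle_at A B C))\<^sup>2"
      by (simp add: power_mult_distrib sin_squared_eq algebra_simps)
    also have "?d * cos (angle_at A B C) = ?i"
      using cosd d by simp
    finally show ?thesis
      using gram by simp
  qed
  ultimately show "dist A B * dist A C * sin (angle_at A B C) = \<bar>D\<bar>"
    by - (rule power2_eq_imp_eq, simp_all)
qed

text \<open>Each of \<open>b c sin \<alpha>\<close>, \<open>c a sin \<beta>\<close> and \<open>a b sin \<gamma>\<close> is twice the area, which gives the sine rule; with the dot
products at the vertices the other relations become polynomial identities in the coordinates.\<close>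

lemma triangle_trig:
  assumes "is_triangle a b c \<alpha> \<beta> \<gamma>"
  shows "a > 0" "b > 0" "c > 0" "sin \<alpha> > 0" "sin \<beta> > 0" "sin \<gamma> > 0"
    and "a * sin \<beta> = b * sin \<alpha>" "a * sin \<gamma> = c * sin \<alpha>" "b * sin \<gamma> = c * sin \<beta>"
    and "a * cos \<beta> + b * cos \<alpha> = c"
    and "sin (\<alpha> + \<beta>) = sin \<gamma>" "cos (\<alpha> + \<beta>) = - cos \<gamma>"
proof -
  obtain A B C :: "real \<times> real" where nc: "\<not> collinear {A, B, C}"
    and len: "dist B C = a" "dist C A = b" "dist A B = c"
    and ang: "angle_at A B C = \<alpha>" "angle_at B C A = \<beta>" "angle_at C A B = \<gamma>"
    using assms unfolding is_triangle_def by blast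
  define D where "D = fst (B - A) * snd (C - A) - snd (B - A) * fst (C - A)"
  have "D \<noteq> 0"
  proof
    assume "D = 0"
    then have "((B - A) \<bullet> (C - A))\<^sup>2 = (norm (B - A) * norm (C - A))\<^sup>2"
      using gram_identity_plane[of "B - A" "C - A"] by (simp add: D_def)
    then have "\<bar>(B - A) \<bullet> (C - A)\<bar> = norm (B - A) * norm (C - A)"
      by - (rule power2_eq_imp_eq, simp_all)
    then have "collinear {0, B - A, C - A}"
      using norm_cauchy_schwarz_equal by blast
    then have "collinear {B, A, C}"
      by (simp add: collinear_3)
    then show False
      using nc by (simp add: insert_commute)
  qed
  have D1: "fst (C - B) * snd (A - B) - snd (C - B) * fst (A - B) = D"
    and D2: "fst (A - C) * snd (B - C) - snd (A - C) * fst (B - C) = D"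
    by (simp_all add: D_def algebra_simps)
  have cs: "b * c * cos \<alpha> = (B - A) \<bullet> (C - A)" "b * c * sin \<alpha> = \<bar>D\<bar>"
     "c * a * cos \<beta> = (C - B) \<bullet> (A - B)" "c * a * sin \<beta> = \<bar>D\<bar>"
     "a * b * cos \<gamma> = (A - C) \<bullet> (B - C)" "a * b * sin \<gamma> = \<bar>D\<bar>"
    using angle_at_trig[of B A C] angle_at_trig[of C B A] angle_at_trig[of A C B] \<open>D \<noteq> 0\<close>
    unfolding D1 D2 D_def[symmetric] len ang
    by (simp_all add: len ang dist_commute[of A C] dist_commute[of B A] dist_commute[of C B] mult_ac)
  show pos: "a > 0" "b > 0" "c > 0"
    using len nc by (auto simp: collinear_2 insert_commute)
  have D0: "\<bar>D\<bar> > 0" using \<open>D \<noteq> 0\<close> by simp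
  show "sin \<alpha> > 0"
    by (rule zero_less_mult_pos[of "b * c"]) (simp_all only: cs D0 mult_pos_pos pos)
  show "sin \<beta> > 0"
    by (rule zero_less_mult_pos[of "c * a"]) (simp_all only: cs D0 mult_pos_pos pos)
  show "sin \<gamma> > 0"
    by (rule zero_less_mult_pos[of "a * b"]) (simp_all only: cs D0 mult_pos_pos pos)
  have "c * (a * sin \<beta>) = c * (b * sin \<alpha>)" "b * (a * sin \<gamma>) = b * (c * sin \<alpha>)"
    "a * (b * sin \<gamma>) = a * (c * sin \<beta>)"
    using cs(2,4,6) by (metis mult.assoc mult.commute)+
  then show eqs: "a * sin \<beta> = b * sin \<alpha>" "a * sin \<gamma> = c * sin \<alpha>" "b * sin \<gamma> = c * sin \<beta>"
    using pos by simp_all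
  have c2: "c\<^sup>2 = (B - A) \<bullet> (B - A)"
    unfolding len(3)[symmetric] by (simp add: dist_norm power2_norm_eq_inner[symmetric] norm_minus_commute)
  have "c * (a * cos \<beta> + b * cos \<alpha>) = c * c"
    using cs(1,3) c2
    by (simp add: algebra_simps power2_eq_square inner_commute)
  then show cc: "a * cos \<beta> + b * cos \<alpha> = c"
    using pos by simp
  have "a * b * c * c * sin (\<alpha> + \<beta>) = \<bar>D\<bar> * (c * (a * cos \<beta> + b * cos \<alpha>))"
  proof -
    have "a * b * c * c * sin (\<alpha> + \<beta>) =
        (b * c * sin \<alpha>) * (c * (a * cos \<beta>)) + (c * a * sin \<beta>) * (c * (b * cos \<alpha>))"
      unfolding sin_add by (simp add: algebra_simps)
    then show ?thesis
      unfolding cs by (simp add: algebra_simps)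
  qed
  also have "\<dots> = a * b * c * c * sin \<gamma>"
    unfolding cc cs(6)[symmetric] by (simp add: algebra_simps)
  finally show "sin (\<alpha> + \<beta>) = sin \<gamma>"
    using pos by simp
  have "a * b * c * c * cos (\<alpha> + \<beta>) = (b * c * cos \<alpha>) * (c * a * cos \<beta>) - (b * c * sin \<alpha>) * (c * a * sin \<beta>)"
    unfolding cos_add by (simp add: algebra_simps)
  also have "\<dots> = ((B - A) \<bullet> (C - A)) * ((C - B) \<bullet> (A - B)) - D\<^sup>2"
    unfolding cs by (simp add: power2_eq_square)
  also have "\<dots> = - (c\<^sup>2 * (a * b * cos \<gamma>))"
    unfolding cs c2 D_def by (cases A, cases B, cases C) (simp add: power2_eq_square algebra_simps)
  also have "\<dots> = a * b * c * c * (- cos \<gamma>)"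
    by (simp add: power2_eq_square algebra_simps)
  finally have "a * b * c * c * cos (\<alpha> + \<beta>) = a * b * c * c * (- cos \<gamma>)" .
  moreover have "a * b * c * c \<noteq> 0" using pos by simp
  ultimately show "cos (\<alpha> + \<beta>) = - cos \<gamma>"
    using mult_left_cancel by blast
qed

section \<open>Counting the triangles met by a convex set\<close>

text \<open>The two generic positions of a bounded interval of coordinates relative to the integers: between two
consecutive ones, or reaching strictly to both sides of exactly one. Tangency belongs to neither.\<close>

definition misses :: "real set \<Rightarrow> int \<Rightarrow> bool" where
  "misses R i \<longleftrightarrow> (\<forall>x\<in>R. of_int i < x \<and> x < of_int i + 1)"

definition crosses :: "real set \<Rightarrow> int \<Rightarrow> bool" where
  "crosses R i \<longleftrightarrow> (\<forall>x\<in>R. of_int i - 1 < x \<and> x < of_int i + 1)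
     \<and> (\<exists>x\<in>R. x < of_int i) \<and> (\<exists>x\<in>R. of_int i < x)"

abbreviation coord1 :: "real \<times> real \<times> real \<Rightarrow> real" where "coord1 \<equiv> fst"
abbreviation coord2 :: "real \<times> real \<times> real \<Rightarrow> real" where "coord2 \<equiv> \<lambda>p. fst (snd p)"
abbreviation coord3 :: "real \<times> real \<times> real \<Rightarrow> real" where "coord3 \<equiv> \<lambda>p. snd (snd p)"

definition in_cell :: "int \<times> int \<times> int \<Rightarrow> real \<times> real \<times> real \<Rightarrow> bool" where
  "in_cell = (\<lambda>(i, j, l) (x, y, z).
     of_int i \<le> x \<and> x \<le> of_int i + 1 \<and> of_int j \<le> y \<and> y \<le> of_int j + 1
     \<and> of_int l \<le> z \<and> z \<le> of_int l + 1)"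

text \<open>The fractional parts of three nonintegral numbers with sum zero add up to 1 or 2, hence their floors to
-1 or -2. The two values belong to the two orientations of the triangles.\<close>

definition cell_indices :: "(int \<times> int \<times> int) set" where
  "cell_indices = {(i, j, l). i + j + l = -1 \<or> i + j + l = -2}"

definition hit_cells :: "(real \<times> real \<times> real) set \<Rightarrow> (int \<times> int \<times> int) set" where
  "hit_cells S = {t \<in> cell_indices. \<exists>p\<in>S. in_cell t p}"

definition zero_sum :: "(real \<times> real \<times> real) set \<Rightarrow> bool" where
  "zero_sum S \<longleftrightarrow> (\<forall>(x, y, z)\<in>S. x + y + z = 0)"

text \<open>Cyclic permutation of the coordinates, and below the effect of the point reflection on cell indices.
These two symmetries of the lattice reduce all configurations of the counting to a few.\<close>

definition rot :: "'a \<times> 'a \<times> 'a \<Rightarrow> 'a \<times> 'a \<times> 'a" where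
  "rot = (\<lambda>(x, y, z). (y, z, x))"

definition flip :: "int \<times> int \<times> int \<Rightarrow> int \<times> int \<times> int" where
  "flip = (\<lambda>(i, j, l). (- i - 1, - j - 1, - l - 1))"

lemma mem_rot_image: "(x, y, z) \<in> rot ` S \<longleftrightarrow> (z, x, y) \<in> S"
  by (force simp: rot_def)

lemma mem_uminus_image: "(x, y, z) \<in> uminus ` S \<longleftrightarrow> (- x, - y, - z) \<in> (S :: (real \<times> real \<times> real) set)"
  by force

lemma convex_rot: "convex S \<Longrightarrow> convex (rot ` S)" for S :: "(real \<times> real \<times> real) set"
  by (rule convex_linear_image[rotated]) (auto simp: rot_def intro!: linearI)

lemma zero_sum_rot: "zero_sum S \<Longrightarrow> zero_sum (rot ` S)"
  by (auto simp: zero_sum_def rot_def algebra_simps)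

lemma zero_sum_uminus: "zero_sum S \<Longrightarrow> zero_sum (uminus ` S)"
  by (force simp: zero_sum_def)

lemma card_hit_cells_rot: "card (hit_cells (rot ` S)) = card (hit_cells S)"
proof -
  have "hit_cells (rot ` S) = rot ` hit_cells S"
    unfolding hit_cells_def
    by (force simp: rot_def in_cell_def cell_indices_def image_iff)
  moreover have "inj rot" by (auto simp: inj_def rot_def)
  ultimately show ?thesis by (metis card_image inj_on_subset subset_UNIV)
qed

lemma card_hit_cells_uminus: "card (hit_cells (uminus ` S)) = card (hit_cells S)"
proof -
  have *: "flip (flip t) = t" for t by (auto simp: flip_def split: prod.splits)
  have in_flip: "in_cell (flip t) (- p) \<longleftrightarrow> in_cell t p" for t p
    by (auto simp: flip_def in_cell_def split: prod.splits)
  have ind_flip: "flip t \<in> cell_indices \<longleftrightarrow> t \<in> cell_indices" for t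
    by (auto simp: flip_def cell_indices_def split: prod.splits)
  have "hit_cells (uminus ` S) = flip ` hit_cells S"
  proof (intro set_eqI iffI)
    fix t assume "t \<in> hit_cells (uminus ` S)"
    then have "flip t \<in> hit_cells S"
      using ind_flip[of t] in_flip[of t] by (auto simp: hit_cells_def)
        (metis add.inverse_inverse in_flip *)
    then show "t \<in> flip ` hit_cells S" using * by (metis image_eqI)
  next
    fix t assume "t \<in> flip ` hit_cells S"
    then obtain t' p where t': "t = flip t'" "t' \<in> cell_indices" "p \<in> S" "in_cell t' p"
      by (auto simp: hit_cells_def)
    then have "t \<in> cell_indices" "in_cell t (- p)"
      using ind_flip in_flip by simp_all
    then show "t \<in> hit_cells (uminus ` S)"
      using t'(3) by (force simp: hit_cells_def)
  qed
  moreover have "inj flip" by (metis * injI)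
  ultimately show ?thesis by (metis card_image inj_on_subset subset_UNIV)
qed

lemma misses_uminus: "misses (uminus ` R) (- i - 1) \<longleftrightarrow> misses R i"
  by (auto simp: misses_def)

lemma crosses_uminus: "crosses (uminus ` R) (- i) \<longleftrightarrow> crosses R i"
  by (auto simp: crosses_def)

lemma coords_rot:
  "coord1 ` rot ` S = coord2 ` S" "coord2 ` rot ` S = coord3 ` S" "coord3 ` rot ` S = coord1 ` S"
  by (auto simp: image_image rot_def case_prod_beta)

lemma coords_uminus:
  "coord1 ` uminus ` S = uminus ` coord1 ` S" "coord2 ` uminus ` S = uminus ` coord2 ` S"
  "coord3 ` uminus ` S = uminus ` coord3 ` S"
  by (auto simp: image_image)

lemma coord_bounds:
  assumes "zero_sum S" "(x, y, z) \<in> S"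
  shows "x + y + z = 0"
    and "misses (coord1 ` S) i \<Longrightarrow> of_int i < x \<and> x < of_int i + 1"
    and "misses (coord2 ` S) j \<Longrightarrow> of_int j < y \<and> y < of_int j + 1"
    and "misses (coord3 ` S) l \<Longrightarrow> of_int l < z \<and> z < of_int l + 1"
    and "crosses (coord1 ` S) i \<Longrightarrow> of_int i - 1 < x \<and> x < of_int i + 1"
    and "crosses (coord2 ` S) j \<Longrightarrow> of_int j - 1 < y \<and> y < of_int j + 1"
    and "crosses (coord3 ` S) l \<Longrightarrow> of_int l - 1 < z \<and> z < of_int l + 1"
  using assms by (force simp: zero_sum_def misses_def crosses_def)+

lemma midpoint_mem:
  assumes "convex S" "(x, y, z) \<in> S" "(x', y', z') \<in> S"
  shows "((x + x') / 2, (y + y') / 2, (z + z') / 2) \<in> (S :: (real \<times> real \<times> real) set)"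
  using convexD[OF assms, of "1/2" "1/2"] by (simp add: add_divide_distrib)

lemma crosses_sides:
  shows "crosses (coord1 ` S) i \<Longrightarrow> \<exists>x y z. (x, y, z) \<in> S \<and> x < of_int i"
    and "crosses (coord1 ` S) i \<Longrightarrow> \<exists>x y z. (x, y, z) \<in> S \<and> of_int i < x"
    and "crosses (coord2 ` S) j \<Longrightarrow> \<exists>x y z. (x, y, z) \<in> S \<and> y < of_int j"
    and "crosses (coord3 ` S) l \<Longrightarrow> \<exists>x y z. (x, y, z) \<in> S \<and> z < of_int l"
    and "crosses (coord3 ` S) l \<Longrightarrow> \<exists>x y z. (x, y, z) \<in> S \<and> of_int l < z"
  by (force simp: crosses_def)+

lemma crosses_point:
  assumes "convex S" "crosses (coord1 ` S) i"
  shows "\<exists>y z. (of_int i, y, z) \<in> S"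
proof -
  obtain x y z x' y' z' where p: "(x, y, z) \<in> S" "x < of_int i" "(x', y', z') \<in> S" "of_int i < x'"
    using crosses_sides assms(2) by meson
  define s t where "s = (x' - of_int i) / (x' - x)" and "t = (of_int i - x) / (x' - x)"
  have st: "0 \<le> s" "0 \<le> t" "s + t = 1"
    using p by (simp_all add: s_def t_def add_divide_distrib[symmetric])
  have "s * x + t * x' = of_int i"
  proof -
    have "(x' - of_int i) * x + (of_int i - x) * x' = of_int i * (x' - x)"
      by (simp add: algebra_simps)
    moreover have "s * x + t * x' = ((x' - of_int i) * x + (of_int i - x) * x') / (x' - x)"
      by (simp only: s_def t_def add_divide_distrib times_divide_eq_left)
    ultimately have "s * x + t * x' = of_int i * (x' - x) / (x' - x)"
      by (simp only:)
    then show ?thesis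
      using p by simp
  qed
  then show ?thesis
    using convexD[OF assms(1) p(1,3) st] by auto
qed

lemma crosses_points:
  assumes "convex S"
  shows "crosses (coord1 ` S) i \<Longrightarrow> \<exists>y z. (of_int i, y, z) \<in> S"
    and "crosses (coord2 ` S) j \<Longrightarrow> \<exists>x z. (x, of_int j, z) \<in> S"
    and "crosses (coord3 ` S) l \<Longrightarrow> \<exists>x y. (x, y, of_int l) \<in> S"
  using crosses_point[OF assms] crosses_point[OF convex_rot[OF assms], unfolded coords_rot mem_rot_image]
    crosses_point[OF convex_rot[OF convex_rot[OF assms]], unfolded coords_rot mem_rot_image]
  by blast+

text \<open>This bounds the hit cells from above. Together with the restriction on the index sum it leaves one, two
or three cells for zero, one or two lines, four for three lines without a common point, and six for
three concurrent lines.\<close>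

lemma hit_cells_near:
  assumes "zero_sum S" "(i', j', l') \<in> hit_cells S"
  shows "misses (coord1 ` S) i \<Longrightarrow> i' = i" "misses (coord2 ` S) j \<Longrightarrow> j' = j" "misses (coord3 ` S) l \<Longrightarrow> l' = l"
    and "crosses (coord1 ` S) i \<Longrightarrow> i' = i \<or> i' = i - 1" "crosses (coord2 ` S) j \<Longrightarrow> j' = j \<or> j' = j - 1"
      "crosses (coord3 ` S) l \<Longrightarrow> l' = l \<or> l' = l - 1"
proof -
  obtain x y z where p: "(x, y, z) \<in> S" and c: "in_cell (i', j', l') (x, y, z)"
    using assms(2) unfolding hit_cells_def by auto
  note c = c[unfolded in_cell_def, simplified] and d = coord_bounds[OF assms(1) p]
  show "misses (coord1 ` S) i \<Longrightarrow> i' = i"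
    using c d(2)[of i] by linarith
  show "misses (coord2 ` S) j \<Longrightarrow> j' = j"
    using c d(3)[of j] by linarith
  show "misses (coord3 ` S) l \<Longrightarrow> l' = l"
    using c d(4)[of l] by linarith
  show "crosses (coord1 ` S) i \<Longrightarrow> i' = i \<or> i' = i - 1"
    using c d(5)[of i] by linarith
  show "crosses (coord2 ` S) j \<Longrightarrow> j' = j \<or> j' = j - 1"
    using c d(6)[of j] by linarith
  show "crosses (coord3 ` S) l \<Longrightarrow> l' = l \<or> l' = l - 1"
    using c d(7)[of l] by linarith
qed

lemma hit_cellsI:
  assumes "(x, y, z) \<in> S" "i + j + l = -1 \<or> i + j + l = -2"
    "of_int i \<le> x" "x \<le> of_int i + 1" "of_int j \<le> y" "y \<le> of_int j + 1"
    "of_int l \<le> z" "z \<le> of_int l + 1"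
  shows "(i, j, l) \<in> hit_cells S"
  using assms by (force simp: hit_cells_def in_cell_def cell_indices_def)

lemma hit_cells_midpointI:
  assumes "convex S" "(x, y, z) \<in> S" "(x', y', z') \<in> S" "i + j + l = -1 \<or> i + j + l = -2"
    "2 * of_int i \<le> x + x'" "x + x' \<le> 2 * of_int i + 2" "2 * of_int j \<le> y + y'" "y + y' \<le> 2 * of_int j + 2"
    "2 * of_int l \<le> z + z'" "z + z' \<le> 2 * of_int l + 2"
  shows "(i, j, l) \<in> hit_cells S"
  using assms by (intro hit_cellsI[OF midpoint_mem[OF assms(1-3)]]) simp_all

lemma hit_cells_sum: "(i, j, l) \<in> hit_cells S \<Longrightarrow> i + j + l = -1 \<or> i + j + l = -2"
  by (simp add: hit_cells_def cell_indices_def)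

lemma hit_cells_eqI:
  assumes "A \<subseteq> hit_cells S" "\<And>a b c. (a, b, c) \<in> hit_cells S \<Longrightarrow> (a, b, c) \<in> A"
  shows "hit_cells S = A"
  using assms by auto

lemma card_hit_cells_no_line:
  assumes S: "zero_sum S" "S \<noteq> {}"
    and m: "misses (coord1 ` S) i" "misses (coord2 ` S) j" "misses (coord3 ` S) l"
  shows "card (hit_cells S) = 1"
proof -
  obtain x y z where p: "(x, y, z) \<in> S" using S by auto
  note d = coord_bounds[OF S(1) p]
  have "(i, j, l) \<in> hit_cells S"
    using p d(1) d(2)[OF m(1)] d(3)[OF m(2)] d(4)[OF m(3)]
    by (intro hit_cellsI[OF p]) linarith+
  then have "hit_cells S = {(i, j, l)}"
    using hit_cells_near[OF S(1)] m by auto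
  then show ?thesis by simp
qed

lemma of_int_sum: "i + j + l = k \<Longrightarrow> real_of_int i + of_int j + of_int l = of_int k"
  by auto

lemma card_hit_cells_one_line:
  assumes S: "zero_sum S" "S \<noteq> {}"
    and m: "crosses (coord1 ` S) i" "misses (coord2 ` S) j" "misses (coord3 ` S) l"
  shows "card (hit_cells S) = 2"
proof -
  obtain x y z x' y' z' where p: "(x, y, z) \<in> S" "x < of_int i" "(x', y', z') \<in> S" "of_int i < x'"
    using crosses_sides m(1) by meson
  note d = coord_bounds[OF S(1) p(1)] and d' = coord_bounds[OF S(1) p(3)]
  have s: "i + j + l = -1"
    using d(1) d'(1) d(5)[OF m(1)] d(3)[OF m(2)] d(4)[OF m(3)]
      d'(5)[OF m(1)] d'(3)[OF m(2)] d'(4)[OF m(3)] p by linarith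
  have "(i - 1, j, l) \<in> hit_cells S"
    using p s d(5)[OF m(1)] d(3)[OF m(2)] d(4)[OF m(3)]
    by (intro hit_cellsI[OF p(1)]) (linarith | simp)+
  moreover have "(i, j, l) \<in> hit_cells S"
    using p s d'(5)[OF m(1)] d'(3)[OF m(2)] d'(4)[OF m(3)]
    by (intro hit_cellsI[OF p(3)]) linarith+
  ultimately have "hit_cells S = {(i, j, l), (i - 1, j, l)}"
    using hit_cells_near(2,3,4)[OF S(1)] m by (intro hit_cells_eqI) blast+
  then show ?thesis by simp
qed

text \<open>Here the crossing point of the two lines lies outside the strip of \<open>S\<close>, on the lower side, and the
reflected configuration covers the other side. The cell between the lines is reached by the midpoint of
a point on one line and a point on the other.\<close>

lemma card_hit_cells_two_lines_up:
  assumes S: "convex S" "zero_sum S"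
    and m: "crosses (coord1 ` S) i" "crosses (coord2 ` S) j" "misses (coord3 ` S) l"
    and le: "i + j + l \<le> -1"
  shows "card (hit_cells S) = 3"
proof -
  obtain x y z x' y' z' where p: "(x, y, z) \<in> S" "x < of_int i" "(x', y', z') \<in> S" "y' < of_int j"
    using crosses_sides m(1,2) by meson
  note d = coord_bounds[OF S(2) p(1)] and d' = coord_bounds[OF S(2) p(3)]
  have s: "i + j + l = -1"
    using d(1) d(5)[OF m(1)] d(6)[OF m(2)] d(4)[OF m(3)] p le by linarith
  have "(i - 1, j, l) \<in> hit_cells S"
    using p s d(1) d(5)[OF m(1)] d(6)[OF m(2)] d(4)[OF m(3)]
    by (intro hit_cellsI[OF p(1)]) (linarith | simp)+
  moreover have "(i, j - 1, l) \<in> hit_cells S"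
    using p s d'(1) d'(5)[OF m(1)] d'(6)[OF m(2)] d'(4)[OF m(3)]
    by (intro hit_cellsI[OF p(3)]) (linarith | simp)+
  moreover have "(i, j, l) \<in> hit_cells S"
  proof -
    obtain y1 z1 x2 z2 where q: "(of_int i, y1, z1) \<in> S" "(x2, of_int j, z2) \<in> S"
      using crosses_points[OF S(1)] m by blast
    note e = coord_bounds[OF S(2) q(1)] and e' = coord_bounds[OF S(2) q(2)]
    show ?thesis
      using s of_int_sum[OF s, simplified] e(1) e(5)[OF m(1)] e(6)[OF m(2)] e(4)[OF m(3)] e'(1) e'(5)[OF m(1)] e'(6)[OF m(2)] e'(4)[OF m(3)]
      by (intro hit_cells_midpointI[OF S(1) q]) (linarith | simp)+
  qed
  ultimately have "hit_cells S = {(i, j, l), (i - 1, j, l), (i, j - 1, l)}"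
  proof (intro hit_cells_eqI)
    fix a b c assume h: "(a, b, c) \<in> hit_cells S"
    show "(a, b, c) \<in> {(i, j, l), (i - 1, j, l), (i, j - 1, l)}"
      using hit_cells_near(4)[OF S(2) h m(1)] hit_cells_near(5)[OF S(2) h m(2)]
        hit_cells_near(3)[OF S(2) h m(3)] hit_cells_sum[OF h] s by (elim disjE) simp_all
  qed simp
  then show ?thesis by simp
qed

lemma card_hit_cells_two_lines:
  assumes S: "convex S" "zero_sum S"
    and m: "crosses (coord1 ` S) i" "crosses (coord2 ` S) j" "misses (coord3 ` S) l"
  shows "card (hit_cells S) = 3"
proof (cases "i + j + l \<le> -1")
  case True
  then show ?thesis using card_hit_cells_two_lines_up[OF S m] by simp
next
  case False
  have "card (hit_cells (uminus ` S)) = 3"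
    using False m
    by (intro card_hit_cells_two_lines_up[where i = "-i" and j = "-j" and l = "-l-1"])
       (simp_all add: S convex_negations zero_sum_uminus coords_uminus crosses_uminus misses_uminus)
  then show ?thesis by (simp add: card_hit_cells_uminus)
qed


text \<open>The three lines bound a lattice triangle: \<open>S\<close> reaches its interior and crosses each of its sides.\<close>

lemma card_hit_cells_three_lines_up:
  assumes S: "convex S" "zero_sum S"
    and m: "crosses (coord1 ` S) i" "crosses (coord2 ` S) j" "crosses (coord3 ` S) l"
    and s: "i + j + l = -1"
  shows "card (hit_cells S) = 4"
proof -
  note sr = of_int_sum[OF s, simplified]
  obtain x y z x' y' z' x'' y'' z'' where p: "(x, y, z) \<in> S" "x < of_int i"
     "(x', y', z') \<in> S" "y' < of_int j" "(x'', y'', z'') \<in> S" "z'' < of_int l"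
    using crosses_sides m by meson
  note d = coord_bounds[OF S(2) p(1)] and d' = coord_bounds[OF S(2) p(3)] and d'' = coord_bounds[OF S(2) p(5)]
  have "(i - 1, j, l) \<in> hit_cells S"
    using p s sr d(1) d(5)[OF m(1)] d(6)[OF m(2)] d(7)[OF m(3)]
    by (intro hit_cellsI[OF p(1)]) (linarith | simp)+
  moreover have "(i, j - 1, l) \<in> hit_cells S"
    using p s sr d'(1) d'(5)[OF m(1)] d'(6)[OF m(2)] d'(7)[OF m(3)]
    by (intro hit_cellsI[OF p(3)]) (linarith | simp)+
  moreover have "(i, j, l - 1) \<in> hit_cells S"
    using p s sr d''(1) d''(5)[OF m(1)] d''(6)[OF m(2)] d''(7)[OF m(3)]
    by (intro hit_cellsI[OF p(5)]) (linarith | simp)+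
  moreover have "(i, j, l) \<in> hit_cells S"
  proof -
    obtain y1 z1 x2 z2 where q: "(of_int i, y1, z1) \<in> S" "(x2, of_int j, z2) \<in> S"
      using crosses_points[OF S(1)] m by blast
    note e = coord_bounds[OF S(2) q(1)] and e' = coord_bounds[OF S(2) q(2)]
    show ?thesis
      using s sr e(1) e(5)[OF m(1)] e(6)[OF m(2)] e(7)[OF m(3)]
        e'(1) e'(5)[OF m(1)] e'(6)[OF m(2)] e'(7)[OF m(3)]
      by (intro hit_cells_midpointI[OF S(1) q]) (linarith | simp)+
  qed
  ultimately have "hit_cells S = {(i, j, l), (i - 1, j, l), (i, j - 1, l), (i, j, l - 1)}"
  proof (intro hit_cells_eqI)
    fix a b c assume h: "(a, b, c) \<in> hit_cells S"
    show "(a, b, c) \<in> {(i, j, l), (i - 1, j, l), (i, j - 1, l), (i, j, l - 1)}"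
      using hit_cells_near(4)[OF S(2) h m(1)] hit_cells_near(5)[OF S(2) h m(2)]
        hit_cells_near(6)[OF S(2) h m(3)] hit_cells_sum[OF h] s by (elim disjE) simp_all
  qed simp
  then show ?thesis by simp
qed

text \<open>A vertex is shown to belong to a convex set by exhibiting a nonnegative linear relation between the vectors
from the vertex to points of the set; normalising the coefficients gives a convex combination.\<close>

lemma convex_conic_mem:
  fixes S :: "(real \<times> real \<times> real) set"
  assumes "convex S" "(x, y, z) \<in> S" "(x', y', z') \<in> S" "(x'', y'', z'') \<in> S"
    and "0 \<le> p" "0 \<le> q"
    and "(x - u) + p * (x' - u) + q * (x'' - u) = 0"
    and "(y - v) + p * (y' - v) + q * (y'' - v) = 0"
    and "(z - w) + p * (z' - w) + q * (z'' - w) = 0"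
  shows "(u, v, w) \<in> S"
proof -
  define k where "k = 1 + p + q"
  have k: "k > 0" using assms by (simp add: k_def)
  have "(1 / k) *\<^sub>R (x, y, z) + (p / k) *\<^sub>R (x', y', z') + (q / k) *\<^sub>R (x'', y'', z'')
      \<in> convex hull {(x, y, z), (x', y', z'), (x'', y'', z'')}"
    unfolding convex_hull_3 using k assms(5,6)
    by (intro CollectI exI[of _ "1 / k"] exI[of _ "p / k"] exI[of _ "q / k"])
       (simp add: add_divide_distrib[symmetric] k_def)
  also have "convex hull {(x, y, z), (x', y', z'), (x'', y'', z'')} \<subseteq> S"
    using assms(1-4) by (intro hull_minimal) auto
  also have "(1 / k) *\<^sub>R (x, y, z) + (p / k) *\<^sub>R (x', y', z') + (q / k) *\<^sub>R (x'', y'', z'') = (u, v, w)"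
  proof -
    have "x + p * x' + q * x'' = k * u" "y + p * y' + q * y'' = k * v" "z + p * z' + q * z'' = k * w"
      using assms(7-9) by (simp_all add: k_def algebra_simps)
    then show ?thesis
      using k by (simp add: add_divide_distrib[symmetric])
  qed
  finally show ?thesis .
qed

text \<open>Three concurrent lines, but the vertex is not in \<open>S\<close>. Of each line only one of the two rays from the
vertex is met, and the assumptions \<open>R1\<close>, \<open>R2\<close>, \<open>R3\<close> fix which. A point of \<open>S\<close> in one of the two sectors
opposite to these rays would yield a relation forcing the vertex into \<open>S\<close>; four sectors remain.\<close>

lemma card_hit_cells_vertex_outside_base:
  assumes S: "convex S" "zero_sum S"
    and m: "crosses (coord1 ` S) i" "crosses (coord2 ` S) j" "crosses (coord3 ` S) l"
    and s: "i + j + l = 0"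
    and nv: "(of_int i, of_int j, of_int l) \<notin> S"
    and R1: "(of_int i, y1, z1) \<in> S" "of_int j < y1"
    and R2: "(x2, of_int j, z2) \<in> S" "of_int i < x2"
    and R3: "(x3, y3, of_int l) \<in> S" "of_int i < x3"
  shows "card (hit_cells S) = 4"
proof -
  note sr = of_int_sum[OF s, simplified]
  have zs: "of_int i + y1 + z1 = 0" "x2 + of_int j + z2 = 0" "x3 + y3 + of_int l = 0"
    using S(2) R1 R2 R3 by (auto simp: zero_sum_def)
  have no: False if P: "(x, y, z) \<in> S" "x \<le> of_int i" "of_int l \<le> z" for x y z
  proof -
    have xyz: "x + y + z = 0" using S(2) P by (auto simp: zero_sum_def)
    show False
    proof (cases "of_int j \<le> y")
      case True
      define p where "p = (y - of_int j) / (x3 - of_int i)"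
      define q where "q = (z - of_int l) / (x2 - of_int i)"
      have pq: "0 \<le> p" "0 \<le> q" "p * (x3 - of_int i) = y - of_int j" "q * (x2 - of_int i) = z - of_int l"
        using True P R2 R3 by (simp_all add: p_def q_def)
      have e: "y3 - of_int j = - (x3 - of_int i)" "z2 - of_int l = - (x2 - of_int i)"
        using sr zs by linarith+
      have f: "p * (y3 - of_int j) = - (y - of_int j)" "q * (z2 - of_int l) = - (z - of_int l)"
        unfolding e mult_minus_right pq by simp_all
      have "(of_int i, of_int j, of_int l) \<in> S"
        using sr xyz
        by (intro convex_conic_mem[OF S(1) P(1) R3(1) R2(1) pq(1,2)]; (unfold pq f)?; simp)
      then show False using nv by simp
    next
      case False
      define p where "p = (of_int i - x) / (x2 - of_int i)"
      define q where "q = (of_int j - y) / (y1 - of_int j)"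
      have pq: "0 \<le> p" "0 \<le> q" "p * (x2 - of_int i) = of_int i - x" "q * (y1 - of_int j) = of_int j - y"
        using False P R2 R1 by (simp_all add: p_def q_def)
      have e: "z1 - of_int l = - (y1 - of_int j)" "z2 - of_int l = - (x2 - of_int i)"
        using sr zs by linarith+
      have f: "q * (z1 - of_int l) = - (of_int j - y)" "p * (z2 - of_int l) = - (of_int i - x)"
        unfolding e mult_minus_right pq by simp_all
      have "(of_int i, of_int j, of_int l) \<in> S"
        using sr xyz
        by (intro convex_conic_mem[OF S(1) P(1) R2(1) R1(1) pq(1,2)]; (unfold pq f)?; simp)
      then show False using nv by simp
    qed
  qed
  obtain x y z x' y' z' where p: "(x, y, z) \<in> S" "x < of_int i"
     "(x', y', z') \<in> S" "of_int l < z'"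
    using crosses_sides m by meson
  have pz: "z < of_int l" using no[OF p(1)] p(2) by force
  have px: "of_int i < x'" using no[OF p(3)] p(4) by force
  note d = coord_bounds[OF S(2) p(1)] and d' = coord_bounds[OF S(2) p(3)]
    and d1 = coord_bounds[OF S(2) R1(1)] and d2 = coord_bounds[OF S(2) R2(1)] and d3 = coord_bounds[OF S(2) R3(1)]
  have "(i - 1, j, l - 1) \<in> hit_cells S"
    using p pz s sr d(1) d(5)[OF m(1)] d(6)[OF m(2)] d(7)[OF m(3)]
    by (intro hit_cellsI[OF p(1)]) (linarith | simp)+
  moreover have "(i, j - 1, l) \<in> hit_cells S"
    using p px s sr d'(1) d'(5)[OF m(1)] d'(6)[OF m(2)] d'(7)[OF m(3)]
    by (intro hit_cellsI[OF p(3)]) (linarith | simp)+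
  moreover have "(i, j, l - 1) \<in> hit_cells S"
    using R1 R2 zs s sr d1(6)[OF m(2)] d1(7)[OF m(3)] d2(5)[OF m(1)] d2(7)[OF m(3)]
    by (intro hit_cells_midpointI[OF S(1) R1(1) R2(1)]) (linarith | simp)+
  moreover have "(i, j - 1, l - 1) \<in> hit_cells S"
    using R3 R2 zs s sr d3(5)[OF m(1)] d3(6)[OF m(2)] d2(5)[OF m(1)] d2(7)[OF m(3)]
    by (intro hit_cells_midpointI[OF S(1) R2(1) R3(1)]) (linarith | simp)+
  ultimately have "hit_cells S = {(i - 1, j, l - 1), (i, j - 1, l), (i, j, l - 1), (i, j - 1, l - 1)}"
  proof (intro hit_cells_eqI)
    fix a b c assume h: "(a, b, c) \<in> hit_cells S"
    have "\<not> (a = i - 1 \<and> c = l)"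
    proof
      assume "a = i - 1 \<and> c = l"
      then obtain x y z where "(x, y, z) \<in> S" "x \<le> of_int i" "of_int l \<le> z"
        using h by (force simp: hit_cells_def in_cell_def)
      then show False by (rule no)
    qed
    then show "(a, b, c) \<in> {(i - 1, j, l - 1), (i, j - 1, l), (i, j, l - 1), (i, j - 1, l - 1)}"
      using hit_cells_near(4)[OF S(2) h m(1)] hit_cells_near(5)[OF S(2) h m(2)]
        hit_cells_near(6)[OF S(2) h m(3)] hit_cells_sum[OF h] s by (elim disjE) simp_all
  qed simp
  then show ?thesis by simp
qed

text \<open>On the six rays going round the vertex, the three sign conditions of each alternative single out three
consecutive rays. The alternatives are the rotations of the base case.\<close>

lemma card_hit_cells_vertex_outside_two_pos:
  assumes S: "convex S" "zero_sum S"
    and m: "crosses (coord1 ` S) i" "crosses (coord2 ` S) j" "crosses (coord3 ` S) l"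
    and s: "i + j + l = 0"
    and nv: "(of_int i, of_int j, of_int l) \<notin> S"
    and R: "(of_int i, y1, z1) \<in> S" "(x2, of_int j, z2) \<in> S" "(x3, y3, of_int l) \<in> S"
    and sgn: "of_int j < y1 \<and> z2 < of_int l \<and> of_int i < x3
      \<or> of_int j < y1 \<and> of_int l < z2 \<and> x3 < of_int i
      \<or> y1 < of_int j \<and> of_int l < z2 \<and> of_int i < x3"
  shows "card (hit_cells S) = 4"
proof -
  have zs: "of_int i + y1 + z1 = 0" "x2 + of_int j + z2 = 0" "x3 + y3 + of_int l = 0"
    using S(2) R by (auto simp: zero_sum_def)
  note sr = of_int_sum[OF s, simplified]
  let ?S1 = "rot ` S" and ?S2 = "rot ` rot ` S"
  from sgn consider "of_int j < y1" "z2 < of_int l" "of_int i < x3"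
    | "of_int j < y1" "of_int l < z2" "x3 < of_int i" | "y1 < of_int j" "of_int l < z2" "of_int i < x3"
    by blast
  then show ?thesis
  proof cases
    case 1
    then show ?thesis
      using zs sr R by (intro card_hit_cells_vertex_outside_base[OF S m s nv R(1) _ R(2) _ R(3)]) linarith+
  next
    case 2
    have "card (hit_cells ?S1) = 4"
      using 2 zs sr R nv s
      by (intro card_hit_cells_vertex_outside_base[of ?S1 j l i z2 x2 y3 x3 y1 z1])
        (simp_all add: m coords_rot mem_rot_image convex_rot zero_sum_rot S)
    then show ?thesis by (simp add: card_hit_cells_rot)
  next
    case 3
    have "card (hit_cells ?S2) = 4"
      using 3 zs sr R nv s
      by (intro card_hit_cells_vertex_outside_base[of ?S2 l i j x3 y3 z1 y1 z2 x2])
        (simp_all add: m coords_rot mem_rot_image convex_rot zero_sum_rot S)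
    then show ?thesis by (simp add: card_hit_cells_rot)
  qed
qed

text \<open>Equal signs would place the three rays at mutual angles surrounding the vertex, which would then lie in the
convex hull. Of the six remaining patterns three are the reflections of the other three.\<close>

lemma card_hit_cells_vertex_outside:
  assumes S: "convex S" "zero_sum S"
    and m: "crosses (coord1 ` S) i" "crosses (coord2 ` S) j" "crosses (coord3 ` S) l"
    and s: "i + j + l = 0"
    and nv: "(of_int i, of_int j, of_int l) \<notin> S"
  shows "card (hit_cells S) = 4"
proof -
  obtain y1 z1 x2 z2 x3 y3 where R: "(of_int i, y1, z1) \<in> S" "(x2, of_int j, z2) \<in> S" "(x3, y3, of_int l) \<in> S"
    using crosses_points[OF S(1)] m by blast
  have zs: "of_int i + y1 + z1 = 0" "x2 + of_int j + z2 = 0" "x3 + y3 + of_int l = 0"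
    using S(2) R by (auto simp: zero_sum_def)
  note sr = of_int_sum[OF s, simplified]
  have ne: "y1 \<noteq> of_int j" "z2 \<noteq> of_int l" "x3 \<noteq> of_int i"
  proof -
    have "y1 = of_int j \<Longrightarrow> z1 = of_int l" "z2 = of_int l \<Longrightarrow> x2 = of_int i"
      "x3 = of_int i \<Longrightarrow> y3 = of_int j"
      using zs sr by linarith+
    then show "y1 \<noteq> of_int j" "z2 \<noteq> of_int l" "x3 \<noteq> of_int i"
      using R nv by blast+
  qed
  have not_same: False
    if sg: "of_int j < y1 \<and> of_int l < z2 \<and> of_int i < x3 \<or> y1 < of_int j \<and> z2 < of_int l \<and> x3 < of_int i"
  proof -
    define p where "p = (y1 - of_int j) / (z2 - of_int l)"
    define q where "q = (y1 - of_int j) / (x3 - of_int i)"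
    have pq: "0 \<le> p" "0 \<le> q" "p * (z2 - of_int l) = y1 - of_int j" "q * (x3 - of_int i) = y1 - of_int j"
      using sg by (auto simp: p_def q_def zero_le_divide_iff)
    have e: "y3 - of_int j = - (x3 - of_int i)" "x2 - of_int i = - (z2 - of_int l)"
      using sr zs by linarith+
    have f: "q * (y3 - of_int j) = - (y1 - of_int j)" "p * (x2 - of_int i) = - (y1 - of_int j)"
      unfolding e mult_minus_right pq by simp_all
    have "(of_int i, of_int j, of_int l) \<in> S"
      using sr zs
      by (intro convex_conic_mem[OF S(1) R pq(1,2)]; (unfold pq f)?; simp)
    then show False using nv by simp
  qed
  show ?thesis
  proof (cases "of_int j < y1 \<and> z2 < of_int l \<and> of_int i < x3
      \<or> of_int j < y1 \<and> of_int l < z2 \<and> x3 < of_int i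
      \<or> y1 < of_int j \<and> of_int l < z2 \<and> of_int i < x3")
    case True
    then show ?thesis by (rule card_hit_cells_vertex_outside_two_pos[OF S m s nv R])
  next
    case False
    have "card (hit_cells (uminus ` S)) = 4"
    proof (rule card_hit_cells_vertex_outside_two_pos[where i = "-i" and j = "-j" and l = "-l"
          and ?y1.0 = "-y1" and ?z1.0 = "-z1" and ?x2.0 = "-x2" and ?z2.0 = "-z2" and ?x3.0 = "-x3" and ?y3.0 = "-y3"])
      show "of_int (- j) < - y1 \<and> - z2 < of_int (- l) \<and> of_int (- i) < - x3
        \<or> of_int (- j) < - y1 \<and> of_int (- l) < - z2 \<and> - x3 < of_int (- i)
        \<or> - y1 < of_int (- j) \<and> of_int (- l) < - z2 \<and> of_int (- i) < - x3"
        unfolding of_int_minus neg_less_iff_less using False not_same ne(1,2,3)[unfolded neq_iff] by blast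
    qed (use R nv s in \<open>simp_all add: m coords_uminus crosses_uminus mem_uminus_image convex_negations zero_sum_uminus S\<close>)
    then show ?thesis by (simp add: card_hit_cells_uminus)
  qed
qed

text \<open>A neighbourhood of the vertex lies in \<open>S\<close> and reaches into all six sectors.\<close>

lemma card_hit_cells_vertex_inside:
  assumes S: "zero_sum S"
    and m: "crosses (coord1 ` S) i" "crosses (coord2 ` S) j" "crosses (coord3 ` S) l"
    and s: "i + j + l = 0"
    and e: "0 < e" "\<And>p q. \<bar>p\<bar> \<le> e \<Longrightarrow> \<bar>q\<bar> \<le> e \<Longrightarrow> (of_int i + p, of_int j + q, of_int l - p - q) \<in> S"
  shows "card (hit_cells S) = 6"
proof -
  have mem: "(a, b, c) \<in> hit_cells S"
    if "\<bar>p\<bar> \<le> e" "\<bar>q\<bar> \<le> e" "a = (if p < 0 then i - 1 else i)" "b = (if q < 0 then j - 1 else j)"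
      "c = (if p + q > 0 then l - 1 else l)" "a + b + c = -1 \<or> a + b + c = -2" for a b c p q
  proof -
    note P = e(2)[OF that(1,2)]
    note d = coord_bounds[OF S P]
    show ?thesis
      using d(5)[OF m(1)] d(6)[OF m(2)] d(7)[OF m(3)] that
      by (intro hit_cellsI[OF P]) (auto split: if_splits)
  qed
  \<comment> \<open>the displacements point into the six sectors, in directions that avoid the three lines\<close>
  have "(i - 1, j, l) \<in> hit_cells S"
    using s e(1) by (intro mem[of "- e" "e / 2"]) auto
  moreover have "(i, j - 1, l) \<in> hit_cells S"
    using s e(1) by (intro mem[of "e / 2" "- e"]) auto
  moreover have "(i, j, l - 1) \<in> hit_cells S"
    using s e(1) by (intro mem[of e e]) auto
  moreover have "(i - 1, j - 1, l) \<in> hit_cells S"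
    using s e(1) by (intro mem[of "- e" "- e"]) auto
  moreover have "(i - 1, j, l - 1) \<in> hit_cells S"
    using s e(1) by (intro mem[of "- e / 2" e]) auto
  moreover have "(i, j - 1, l - 1) \<in> hit_cells S"
    using s e(1) by (intro mem[of e "- e / 2"]) auto
  ultimately have "hit_cells S = {(i - 1, j, l), (i, j - 1, l), (i, j, l - 1),
     (i - 1, j - 1, l), (i - 1, j, l - 1), (i, j - 1, l - 1)}" (is "_ = ?C")
  proof (intro hit_cells_eqI)
    fix a b c assume h: "(a, b, c) \<in> hit_cells S"
    show "(a, b, c) \<in> ?C"
      using hit_cells_near(4)[OF S h m(1)] hit_cells_near(5)[OF S h m(2)]
        hit_cells_near(6)[OF S h m(3)] hit_cells_sum[OF h] s by (elim disjE) simp_all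
  qed simp
  then show ?thesis by simp
qed

definition meets_int :: "real set \<Rightarrow> bool" where
  "meets_int R \<longleftrightarrow> (\<exists>i::int. of_int i \<in> R)"

lemma misses_not_meets_int: "misses R i \<Longrightarrow> \<not> meets_int R"
  unfolding misses_def meets_int_def by force

lemma crosses_meets_int:
  assumes "convex S"
  shows "crosses (coord1 ` S) i \<Longrightarrow> meets_int (coord1 ` S)"
    "crosses (coord2 ` S) j \<Longrightarrow> meets_int (coord2 ` S)"
    "crosses (coord3 ` S) l \<Longrightarrow> meets_int (coord3 ` S)"
  using crosses_points[OF assms] unfolding meets_int_def by force+

lemma card_hit_cells_no_vertex:
  assumes S: "convex S" "zero_sum S" "S \<noteq> {}"
    and c: "(\<exists>i. misses (coord1 ` S) i) \<or> (\<exists>i. crosses (coord1 ` S) i)"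
      "(\<exists>i. misses (coord2 ` S) i) \<or> (\<exists>i. crosses (coord2 ` S) i)"
      "(\<exists>i. misses (coord3 ` S) i) \<or> (\<exists>i. crosses (coord3 ` S) i)"
    and nv: "\<And>i j. (of_int i, of_int j, - of_int i - of_int j) \<notin> S"
  shows "card (hit_cells S) = 1 + of_bool (meets_int (coord1 ` S))
    + of_bool (meets_int (coord2 ` S)) + of_bool (meets_int (coord3 ` S))"
proof -
  note no = misses_not_meets_int and yes = crosses_meets_int[OF S(1)]
  let ?S1 = "rot ` S" and ?S2 = "rot ` rot ` S"
  have S1: "convex ?S1" "zero_sum ?S1" "?S1 \<noteq> {}" and S2: "convex ?S2" "zero_sum ?S2" "?S2 \<noteq> {}"
    using S by (simp_all add: convex_rot zero_sum_rot)
  consider (mmm) i j l where "misses (coord1 ` S) i" "misses (coord2 ` S) j" "misses (coord3 ` S) l"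
    | (cmm) i j l where "crosses (coord1 ` S) i" "misses (coord2 ` S) j" "misses (coord3 ` S) l"
    | (mcm) i j l where "misses (coord1 ` S) i" "crosses (coord2 ` S) j" "misses (coord3 ` S) l"
    | (mmc) i j l where "misses (coord1 ` S) i" "misses (coord2 ` S) j" "crosses (coord3 ` S) l"
    | (mcc) i j l where "misses (coord1 ` S) i" "crosses (coord2 ` S) j" "crosses (coord3 ` S) l"
    | (cmc) i j l where "crosses (coord1 ` S) i" "misses (coord2 ` S) j" "crosses (coord3 ` S) l"
    | (ccm) i j l where "crosses (coord1 ` S) i" "crosses (coord2 ` S) j" "misses (coord3 ` S) l"
    | (ccc) i j l where "crosses (coord1 ` S) i" "crosses (coord2 ` S) j" "crosses (coord3 ` S) l"
    using c by - (elim disjE exE; (rule that; assumption))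
  then show ?thesis
  proof cases
    case mmm
    then show ?thesis using card_hit_cells_no_line[OF S(2,3)] by (simp add: no)
  next
    case cmm
    then show ?thesis using card_hit_cells_one_line[OF S(2,3)] by (simp add: no yes)
  next
    case mcm
    then show ?thesis using card_hit_cells_one_line[OF S1(2,3), of j l i]
      by (simp add: no yes coords_rot card_hit_cells_rot)
  next
    case mmc
    then show ?thesis using card_hit_cells_one_line[OF S2(2,3), of l i j]
      by (simp add: no yes coords_rot card_hit_cells_rot)
  next
    case mcc
    then show ?thesis using card_hit_cells_two_lines[OF S1(1,2), of j l i]
      by (simp add: no yes coords_rot card_hit_cells_rot)
  next
    case cmc
    then show ?thesis using card_hit_cells_two_lines[OF S2(1,2), of l i j]
      by (simp add: no yes coords_rot card_hit_cells_rot)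
  next
    case ccm
    then show ?thesis using card_hit_cells_two_lines[OF S(1,2)] by (simp add: no yes)
  next
    case ccc
    obtain y1 z1 where q: "(of_int i, y1, z1) \<in> S"
      using crosses_points[OF S(1)] ccc by blast
    note d = coord_bounds[OF S(2) q]
    have "i + j + l > -2" "i + j + l < 2"
      using d(1) d(6)[OF ccc(2)] d(7)[OF ccc(3)] by linarith+
    then consider "i + j + l = -1" | "i + j + l = 1" | "i + j + l = 0" by linarith
    then have "card (hit_cells S) = 4"
    proof cases
      case 1
      then show ?thesis by (rule card_hit_cells_three_lines_up[OF S(1,2) ccc])
    next
      case 2
      then have "card (hit_cells (uminus ` S)) = 4"
        using ccc by (intro card_hit_cells_three_lines_up[where i = "-i" and j = "-j" and l = "-l"])
          (simp_all add: coords_uminus crosses_uminus S convex_negations zero_sum_uminus)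
      then show ?thesis by (simp add: card_hit_cells_uminus)
    next
      case 3
      then have "real_of_int l = - of_int i - of_int j" by linarith
      then have "(of_int i, of_int j, of_int l) \<notin> S"
        using nv[of i j] by simp
      then show ?thesis by (rule card_hit_cells_vertex_outside[OF S(1,2) ccc 3])
    qed
    then show ?thesis using ccc by (simp add: yes)
  qed
qed

section \<open>The triangles cut out by the lattice lines\<close>

definition open_cell :: "int \<times> int \<times> int \<Rightarrow> (real \<times> real \<times> real) set" where
  "open_cell = (\<lambda>(i, j, l). {of_int i<..<of_int i + 1} \<times> {of_int j<..<of_int j + 1} \<times> {of_int l<..<of_int l + 1})"

definition closed_cell :: "int \<times> int \<times> int \<Rightarrow> (real \<times> real \<times> real) set" where
  "closed_cell = (\<lambda>(i, j, l). {of_int i..of_int i + 1} \<times> {of_int j..of_int j + 1} \<times> {of_int l..of_int l + 1})"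

text \<open>The three coordinates of a point relative to the lattice, up to translation and scale its barycentric
coordinates. Surjectivity onto the plane of zero sum expresses that two of them can be prescribed.\<close>

definition barycentric :: "(real \<times> real \<Rightarrow> real \<times> real \<times> real) \<Rightarrow> bool" where
  "barycentric B \<longleftrightarrow> linear B \<and> range B = {(x, y, z). x + y + z = 0}"

lemma in_cell_iff: "in_cell t p \<longleftrightarrow> p \<in> closed_cell t"
  by (auto simp: in_cell_def closed_cell_def)

lemma barycentricD:
  assumes "barycentric B"
  shows "linear B" "continuous_on S B" "B p = (x, y, z) \<Longrightarrow> x + y + z = 0"
    and "x + y + z = 0 \<Longrightarrow> \<exists>p. B p = (x, y, z)"
proof -
  have lin: "linear B" and ran: "range B = {(x, y, z). x + y + z = 0}"
    using assms by (auto simp: barycentric_def)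
  show "linear B" by fact
  then show "continuous_on S B"
    by (simp add: linear_continuous_on linear_conv_bounded_linear)
  show "x + y + z = 0" if "B p = (x, y, z)"
  proof -
    have "(x, y, z) \<in> range B" using that by (metis rangeI)
    then show ?thesis unfolding ran by simp
  qed
  show "\<exists>p. B p = (x, y, z)" if "x + y + z = 0"
  proof -
    have "(x, y, z) \<in> range B" unfolding ran using that by simp
    then show ?thesis by force
  qed
qed

text \<open>The centroid has fractional parts all equal to 1/3 or to 2/3.\<close>

lemma open_cell_centre:
  assumes "barycentric B" "t \<in> cell_indices"
  shows "\<exists>p. B p \<in> open_cell t"
proof -
  obtain i j l where t: "t = (i, j, l)" by (cases t)
  define d :: real where "d = (if i + j + l = -1 then 1/3 else 2/3)"
  have sum: "real_of_int (i + j + l) = - 3 * d"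
    using assms(2) by (auto simp: t cell_indices_def d_def simp del: of_int_add)
  then have "(of_int i + d) + (of_int j + d) + (of_int l + d) = 0"
    by simp
  then obtain p where "B p = (of_int i + d, of_int j + d, of_int l + d)"
    using barycentricD(4)[OF assms(1)] by blast
  moreover have "0 < d" "d < 1" by (auto simp: d_def)
  ultimately have "B p \<in> open_cell t" by (simp add: t open_cell_def)
  then show ?thesis by blast
qed

lemma open_cell_disjoint:
  assumes "p \<in> open_cell t" "p \<in> closed_cell t'"
  shows "t = t'"
proof -
  have same: "i = i'" if "of_int i < x" "x < of_int i + 1" "of_int i' \<le> x" "x \<le> of_int i' + 1" for i i' and x :: real
    using that by linarith
  obtain x y z i j l i' j' l' where [simp]: "p = (x, y, z)" "t = (i, j, l)" "t' = (i', j', l')"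
    by (metis surj_pair)
  show ?thesis
    using assms same[of i x i'] same[of j y j'] same[of l z l']
    by (simp add: open_cell_def closed_cell_def)
qed

lemma open_cell_subset: "open_cell t \<subseteq> closed_cell t"
  by (auto simp: open_cell_def closed_cell_def)

lemma cells_cover:
  assumes B: "barycentric B"
  shows "(\<Union>t\<in>cell_indices. B -` open_cell t) =
    {p. coord1 (B p) \<notin> \<int> \<and> coord2 (B p) \<notin> \<int> \<and> coord3 (B p) \<notin> \<int>}" (is "?L = ?R")
proof (intro equalityI subsetI)
  fix p assume "p \<in> ?L"
  then show "p \<in> ?R"
    by (auto simp: open_cell_def elim!: Ints_cases)
next
  fix p assume p: "p \<in> ?R"
  obtain x y z where xyz: "B p = (x, y, z)" by (cases "B p")
  have ni: "x \<notin> \<int>" "y \<notin> \<int>" "z \<notin> \<int>" using p xyz by auto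
  have fl: "of_int \<lfloor>r\<rfloor> < r" "r < of_int \<lfloor>r\<rfloor> + 1" if "r \<notin> \<int>" for r :: real
  proof -
    have "of_int \<lfloor>r\<rfloor> \<noteq> r" using that by (metis Ints_of_int)
    then show "of_int \<lfloor>r\<rfloor> < r" "r < of_int \<lfloor>r\<rfloor> + 1"
      using floor_correct[of r] by linarith+
  qed
  have s0: "x + y + z = 0" using barycentricD(3)[OF B xyz] .
  have "\<lfloor>x\<rfloor> + \<lfloor>y\<rfloor> + \<lfloor>z\<rfloor> = -1 \<or> \<lfloor>x\<rfloor> + \<lfloor>y\<rfloor> + \<lfloor>z\<rfloor> = -2"
    using fl[OF ni(1)] fl[OF ni(2)] fl[OF ni(3)] s0 by linarith
  then have "(\<lfloor>x\<rfloor>, \<lfloor>y\<rfloor>, \<lfloor>z\<rfloor>) \<in> cell_indices" by (simp add: cell_indices_def)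
  moreover have "B p \<in> open_cell (\<lfloor>x\<rfloor>, \<lfloor>y\<rfloor>, \<lfloor>z\<rfloor>)"
    using fl[OF ni(1)] fl[OF ni(2)] fl[OF ni(3)] by (simp add: xyz open_cell_def)
  ultimately show "p \<in> ?L" by blast
qed

lemma components_cells:
  assumes B: "barycentric B"
  shows "components {p. coord1 (B p) \<notin> \<int> \<and> coord2 (B p) \<notin> \<int> \<and> coord3 (B p) \<notin> \<int>} =
    (\<lambda>t. B -` open_cell t) ` cell_indices"
proof (rule components_open_unique)
  show "pairwise disjnt ((\<lambda>t. B -` open_cell t) ` cell_indices)"
    unfolding pairwise_def disjnt_def using open_cell_disjoint open_cell_subset by blast
  show "\<Union> ((\<lambda>t. B -` open_cell t) ` cell_indices) =
    {p. coord1 (B p) \<notin> \<int> \<and> coord2 (B p) \<notin> \<int> \<and> coord3 (B p) \<notin> \<int>}"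
    using cells_cover[OF B] by simp
  fix X assume "X \<in> (\<lambda>t. B -` open_cell t) ` cell_indices"
  then obtain t where t: "t \<in> cell_indices" "X = B -` open_cell t" by blast
  have "open X"
    unfolding t(2) using barycentricD(2)[OF B]
    by (intro open_vimage) (auto simp: open_cell_def split: prod.splits intro!: open_Times)
  moreover have "connected X"
    unfolding t(2) using barycentricD(1)[OF B]
    by (intro convex_connected convex_linear_vimage)
       (auto simp: open_cell_def split: prod.splits intro!: convex_Times)
  moreover have "X \<noteq> {}"
    using open_cell_centre[OF B t(1)] t(2) by blast
  ultimately show "open X \<and> connected X \<and> X \<noteq> {}" by blast
qed

text \<open>Every point of a closed cell is approached along the segment from the centroid, which runs inside.\<close>

lemma closure_cell:
  assumes B: "barycentric B" and t: "t \<in> cell_indices"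
  shows "closure (B -` open_cell t) = B -` closed_cell t"
proof (rule antisym)
  have "closed (B -` closed_cell t)"
    using barycentricD(2)[OF B]
    by (intro closed_vimage) (auto simp: closed_cell_def split: prod.splits intro!: closed_Times)
  then show "closure (B -` open_cell t) \<subseteq> B -` closed_cell t"
    by (intro closure_minimal vimage_mono open_cell_subset)
  show "B -` closed_cell t \<subseteq> closure (B -` open_cell t)"
  proof
    fix p assume p: "p \<in> B -` closed_cell t"
    obtain q where q: "B q \<in> open_cell t" using open_cell_centre[OF B t] by blast
    let ?f = "\<lambda>e::real. (1 - e) *\<^sub>R p + e *\<^sub>R q"
    obtain i j l where ijl: "t = (i, j, l)" by (cases t)
    have strict: "I < (1 - e) * x + e * y \<and> (1 - e) * x + e * y < I + 1"
      if "I \<le> x" "x \<le> I + 1" "I < y" "y < I + 1" "0 < e" "e < 1" for I x y e :: real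
    proof -
      have "(1 - e) * I \<le> (1 - e) * x" "(1 - e) * x \<le> (1 - e) * (I + 1)"
        using that by (intro mult_left_mono; simp)+
      moreover have "e * I < e * y" "e * y < e * (I + 1)"
        using that by simp_all
      ultimately show ?thesis by (simp add: algebra_simps)
    qed
    have ev: "eventually (\<lambda>e. ?f e \<in> closure (B -` open_cell t)) (at_right 0)"
      unfolding eventually_at_right_field
    proof (intro exI[of _ 1] conjI allI impI)
      fix e :: real assume e: "0 < e" "e < 1"
      obtain x y z x' y' z' where Bp: "B p = (x, y, z)" and Bq: "B q = (x', y', z')"
        by (metis surj_pair)
      have "B (?f e) = ((1 - e) * x + e * x', (1 - e) * y + e * y', (1 - e) * z + e * z')"
        using barycentricD(1)[OF B] by (simp only: linear_add linear_scale Bp Bq) simp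
      then have "B (?f e) \<in> open_cell t"
        using p q e strict[of "of_int i" x x' e] strict[of "of_int j" y y' e] strict[of "of_int l" z z' e]
        by (simp add: ijl open_cell_def closed_cell_def Bp Bq)
      then show "?f e \<in> closure (B -` open_cell t)"
        by (intro subsetD[OF closure_subset] vimageI2)
    qed simp
    have "(?f \<longlongrightarrow> (1 - 0) *\<^sub>R p + 0 *\<^sub>R q) (at_right 0)"
      by (intro tendsto_intros)
    then show "p \<in> closure (B -` open_cell t)"
      using Lim_in_closed_set[OF closed_closure ev, of p] by simp
  qed
qed

lemma inj_on_cells:
  assumes B: "barycentric B"
  shows "inj_on (\<lambda>t. B -` closed_cell t) cell_indices"
proof (rule inj_onI)
  fix t t' assume t: "t \<in> cell_indices" and eq: "B -` closed_cell t = B -` closed_cell t'"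
  obtain q where q: "B q \<in> open_cell t" using open_cell_centre[OF B t] by blast
  then have "B q \<in> closed_cell t'" using eq open_cell_subset by blast
  then show "t = t'" using q open_cell_disjoint by blast
qed


text \<open>Counting triangles is counting index triples. The index of a triangle is determined by the triangle, so
the count is unchanged.\<close>

lemma triangles_hit:
  assumes B: "barycentric B"
    and lines: "L = - {p. coord1 (B p) \<notin> \<int> \<and> coord2 (B p) \<notin> \<int> \<and> coord3 (B p) \<notin> \<int>}"
  shows "card {T \<in> closure ` components (- L). X \<inter> T \<noteq> {}} = card (hit_cells (B ` X))"
proof -
  have "closure ` components (- L) = (\<lambda>t. B -` closed_cell t) ` cell_indices"
    unfolding lines double_complement components_cells[OF B] image_image
    using closure_cell[OF B] by (rule image_cong[OF refl])
  moreover have "hit_cells (B ` X) = {t \<in> cell_indices. X \<inter> (B -` closed_cell t) \<noteq> {}}"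
    unfolding hit_cells_def in_cell_iff bex_simps disjoint_iff by (simp add: Bex_def)
  moreover have "{T \<in> f ` C. P T} = f ` {t \<in> C. P (f t)}" for f :: "int \<times> int \<times> int \<Rightarrow> (real \<times> real) set" and C P
    by auto
  ultimately have "{T \<in> closure ` components (- L). X \<inter> T \<noteq> {}} = (\<lambda>t. B -` closed_cell t) ` hit_cells (B ` X)"
    by (simp only:)
  moreover have "inj_on (\<lambda>t. B -` closed_cell t) (hit_cells (B ` X))"
    using inj_on_cells[OF B] by (rule inj_on_subset) (auto simp: hit_cells_def)
  ultimately show ?thesis by (simp add: card_image)
qed

text \<open>Transported from subsets of the natural numbers along an enumeration.\<close>

lemma measurable_card_countable:
  fixes S :: "'a \<Rightarrow> 'b::countable set"
  assumes "\<And>i. {x \<in> space M. i \<in> S x} \<in> sets M"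
  shows "(\<lambda>x. card (S x)) \<in> measurable M (count_space UNIV)"
proof -
  have "(\<lambda>x. card (to_nat ` S x)) \<in> measurable M (count_space UNIV)"
  proof (rule measurable_card)
    fix n :: nat
    have "{x \<in> space M. n \<in> to_nat ` S x} =
      (if n \<in> range (to_nat :: 'b \<Rightarrow> nat) then {x \<in> space M. from_nat n \<in> S x} else {})"
      by auto
    then show "{x \<in> space M. n \<in> to_nat ` S x} \<in> sets M"
      using assms by simp
  qed
  then show ?thesis by (simp add: card_image)
qed

text \<open>The positions in which a compact body hits a closed triangle form a closed set, as a projection along a
compact factor. This gives the measurability of the events, whose probability would otherwise be zero by
convention.\<close>

lemma closed_hit_set:
  assumes B: "barycentric B" and K: "compact K"
  shows "closed {w. t \<in> hit_cells (B ` moved K (fst w) (\<theta> + snd w))}"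
proof (cases "t \<in> cell_indices")
  case True
  let ?g = "\<lambda>q :: (real \<times> real) \<times> ((real \<times> real) \<times> real). B (fst (fst (snd q)) + fst (fst q) * cos (\<theta> + snd (snd q)) - snd (fst q) * sin (\<theta> + snd (snd q)),
       snd (fst (snd q)) + fst (fst q) * sin (\<theta> + snd (snd q)) + snd (fst q) * cos (\<theta> + snd (snd q)))"
  have "continuous_on UNIV ?g"
    by (intro continuous_on_compose2[OF barycentricD(2)[OF B, of UNIV]] continuous_intros) auto
  then have "closed (?g -` closed_cell t)"
    by (intro closed_vimage) (auto simp: closed_cell_def split: prod.splits intro!: closed_Times)
  then have "closed {w. \<exists>k. k \<in> K \<and> (k, w) \<in> ?g -` closed_cell t}"
    by (rule closed_compact_projection[OF K])
  also have "{w. \<exists>k. k \<in> K \<and> (k, w) \<in> ?g -` closed_cell t} =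
      {w. t \<in> hit_cells (B ` moved K (fst w) (\<theta> + snd w))}"
    using True by (simp add: hit_cells_def moved_def in_cell_iff case_prod_beta Bex_def[of K])
  finally show ?thesis .
next
  case False
  then show ?thesis by (simp add: hit_cells_def)
qed

section \<open>Area and periodicity in the plane\<close>

lemma skew_measurable: "(\<lambda>p :: real \<times> real. (m * fst p + k * snd p, n * snd p)) \<in> borel \<rightarrow>\<^sub>M borel"
  by (intro borel_measurable_continuous_onI continuous_intros)

text \<open>Triangular linear maps suffice for all changes of variables below, and for them iterated integration and
the one-dimensional substitution rule are enough.\<close>

lemma nn_integral_skew:
  fixes f :: "real \<times> real \<Rightarrow> ennreal"
  assumes f [measurable]: "f \<in> borel_measurable borel" and mn: "0 < m" "0 < n"
  shows "(\<integral>\<^sup>+p. f p \<partial>lborel) = ennreal (m * n) * (\<integral>\<^sup>+p. f (m * fst p + k * snd p, n * snd p) \<partial>lborel)"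
proof -
  have f' [measurable]: "f \<in> borel_measurable (lborel \<Otimes>\<^sub>M lborel)"
    unfolding lborel_prod by simp
  let ?g = "\<lambda>p. f (m * fst p + k * snd p, n * snd p)"
  have g [measurable]: "?g \<in> borel_measurable (lborel \<Otimes>\<^sub>M lborel)"
    unfolding lborel_prod using measurable_compose[OF skew_measurable f] by simp
  have "(\<integral>\<^sup>+p. f p \<partial>lborel) = (\<integral>\<^sup>+y. (\<integral>\<^sup>+x. f (x, y) \<partial>lborel) \<partial>lborel)"
    using lborel_pair.nn_integral_snd[OF f'] by (simp add: lborel_prod)
  also have "\<dots> = ennreal n * (\<integral>\<^sup>+y. (\<integral>\<^sup>+x. f (x, n * y) \<partial>lborel) \<partial>lborel)"
    using mn by (subst nn_integral_real_affine[where c = n and t = 0]) auto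
  also have "\<dots> = ennreal n * (\<integral>\<^sup>+y. ennreal m * (\<integral>\<^sup>+x. f (m * x + k * y, n * y) \<partial>lborel) \<partial>lborel)"
  proof -
    have "(\<integral>\<^sup>+x. f (x, n * y) \<partial>lborel) = ennreal m * (\<integral>\<^sup>+x. f (m * x + k * y, n * y) \<partial>lborel)" for y
      using mn by (subst nn_integral_real_affine[where c = m and t = "k * y"]) (auto simp: add.commute)
    then show ?thesis by simp
  qed
  also have "\<dots> = ennreal (m * n) * (\<integral>\<^sup>+y. (\<integral>\<^sup>+x. ?g (x, y) \<partial>lborel) \<partial>lborel)"
    using mn by (subst nn_integral_cmult) (auto simp: ennreal_mult' mult_ac)
  also have "(\<integral>\<^sup>+y. (\<integral>\<^sup>+x. ?g (x, y) \<partial>lborel) \<partial>lborel) = (\<integral>\<^sup>+p. ?g p \<partial>lborel)"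
    using lborel_pair.nn_integral_snd[OF g] by (simp add: lborel_prod)
  finally show ?thesis .
qed

lemma emeasure_skew:
  fixes E :: "(real \<times> real) set"
  assumes E [measurable]: "E \<in> sets borel" and mn: "0 < m" "0 < n"
  shows "emeasure lborel E = ennreal (m * n) * emeasure lborel {p. (m * fst p + k * snd p, n * snd p) \<in> E}"
proof -
  have "{p. (m * fst p + k * snd p, n * snd p) \<in> E} \<in> sets borel"
    using measurable_sets[OF skew_measurable E, of m k n] by (simp add: vimage_def)
  moreover have "(\<integral>\<^sup>+p. indicator E (m * fst p + k * snd p, n * snd p) \<partial>lborel) =
      (\<integral>\<^sup>+p. indicator {p. (m * fst p + k * snd p, n * snd p) \<in> E} p \<partial>lborel)"
    by (intro nn_integral_cong) (simp add: indicator_def)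
  ultimately have "(\<integral>\<^sup>+p. indicator E (m * fst p + k * snd p, n * snd p) \<partial>lborel) =
      emeasure lborel {p. (m * fst p + k * snd p, n * snd p) \<in> E}"
    by (simp only: nn_integral_indicator sets_lborel)
  then show ?thesis
    using nn_integral_skew[of "indicator E" m n k] mn by simp
qed

lemma emeasure_translate:
  fixes E :: "(real \<times> real) set"
  assumes E [measurable]: "E \<in> sets borel"
  shows "emeasure lborel {p. p - c \<in> E} = emeasure lborel E"
proof -
  have "emeasure lborel E = emeasure (distr lborel borel ((+) (- c))) E"
    by (simp add: lborel_distr_plus)
  also have "\<dots> = emeasure lborel {p. p - c \<in> E}"
    by (subst emeasure_distr) (auto simp: vimage_def)
  finally show ?thesis ..
qed

lemma AE_not_on_line:
  fixes a :: "real \<times> real"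
  assumes "a \<noteq> 0"
  shows "AE p in lborel. a \<bullet> p \<noteq> b"
proof -
  have "negligible {p. a \<bullet> p = b}"
    using assms by (intro negligible_hyperplane) auto
  then have "{p. a \<bullet> p = b} \<in> null_sets lebesgue"
    by (simp add: negligible_iff_null_sets)
  moreover have "closed {p. a \<bullet> p = b}"
    by (rule closed_hyperplane)
  ultimately have "{p. a \<bullet> p = b} \<in> null_sets lborel"
    by (simp add: null_sets_completion_iff)
  from AE_not_in[OF this] show ?thesis by simp
qed

text \<open>Completing the square gives the quadratic form \<open>norm (u r + v s)\<^sup>2\<close> a triangular square root whose
determinant is that of \<open>r\<close> and \<open>s\<close> up to sign.\<close>

lemma area_ellipse:
  fixes r s :: "real \<times> real"
  defines "D \<equiv> fst r * snd s - snd r * fst s"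
  assumes D: "D \<noteq> 0"
  shows "emeasure lborel {p. norm (fst p *\<^sub>R r + snd p *\<^sub>R s) \<le> 1} = ennreal (pi / \<bar>D\<bar>)"
    and "emeasure lborel {p. norm (fst p *\<^sub>R r + snd p *\<^sub>R s) < 1} = ennreal (pi / \<bar>D\<bar>)"
proof -
  have "r \<noteq> 0" using D by (auto simp: D_def)
  define m where "m = norm r"
  \<comment> \<open>the Cholesky factors of the Gram matrix of \<open>r\<close> and \<open>s\<close>\<close>
  define k where "k = (r \<bullet> s) / norm r"
  define n where "n = \<bar>D\<bar> / norm r"
  have m: "m > 0" and n: "n > 0" and mn: "m * n = \<bar>D\<bar>" and mk: "m * k = r \<bullet> s"
    using \<open>r \<noteq> 0\<close> D by (simp_all add: m_def n_def k_def)
  have "m\<^sup>2 * (k\<^sup>2 + n\<^sup>2) = (m * k)\<^sup>2 + (m * n)\<^sup>2"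
    by (simp add: power_mult_distrib algebra_simps)
  also have "\<dots> = m\<^sup>2 * (norm s)\<^sup>2"
    unfolding mn mk
    by (cases r, cases s) (simp add: D_def m_def norm_Pair power2_eq_square algebra_simps)
  finally have kn: "k\<^sup>2 + n\<^sup>2 = (norm s)\<^sup>2"
    using m by simp
  have norm_eq: "norm (fst p *\<^sub>R r + snd p *\<^sub>R s) = norm (m * fst p + k * snd p, n * snd p)" for p
  proof (rule power2_eq_imp_eq)
    have "(norm (fst p *\<^sub>R r + snd p *\<^sub>R s))\<^sup>2 = (fst p)\<^sup>2 * (norm r)\<^sup>2 + 2 * (fst p * snd p) * (r \<bullet> s) + (snd p)\<^sup>2 * (norm s)\<^sup>2"
      unfolding power2_norm_eq_inner
      by (simp add: inner_add_left inner_add_right inner_commute algebra_simps power2_eq_square)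
    also have "\<dots> = (fst p)\<^sup>2 * m\<^sup>2 + 2 * (fst p * snd p) * (m * k) + (snd p)\<^sup>2 * (k\<^sup>2 + n\<^sup>2)"
      unfolding mk kn by (simp add: m_def)
    also have "\<dots> = (norm (m * fst p + k * snd p, n * snd p))\<^sup>2"
      unfolding power2_norm_eq_inner by (simp add: power2_eq_square algebra_simps)
    finally show "(norm (fst p *\<^sub>R r + snd p *\<^sub>R s))\<^sup>2 = (norm (m * fst p + k * snd p, n * snd p))\<^sup>2" .
  qed simp_all
  have disc: "ennreal (pi / \<bar>D\<bar>) = emeasure lborel {p. (m * fst p + k * snd p, n * snd p) \<in> E}"
    if "E = cball 0 1 \<or> E = ball 0 1" for E :: "(real \<times> real) set"
  proof -
    have E: "E \<in> sets borel" using that by auto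
    have em: "emeasure lborel E = ennreal pi"
      using that by (auto simp: emeasure_cball emeasure_ball unit_ball_vol_2)
    let ?e = "emeasure lborel {p. (m * fst p + k * snd p, n * snd p) \<in> E}"
    have eq: "ennreal pi = ennreal \<bar>D\<bar> * ?e"
      using emeasure_skew[OF E m n, of k] em mn by simp
    then have "?e \<noteq> \<infinity>"
      using D by (auto simp: ennreal_mult_eq_top_iff)
    then obtain x where x: "?e = ennreal x" "x \<ge> 0" by (cases ?e) auto
    then have "pi = \<bar>D\<bar> * x"
      using eq by (simp add: ennreal_mult'[symmetric])
    then have "pi / \<bar>D\<bar> = x"
      using D by (metis abs_eq_0 nonzero_mult_div_cancel_left)
    then show ?thesis using x by simp
  qed
  show "emeasure lborel {p. norm (fst p *\<^sub>R r + snd p *\<^sub>R s) \<le> 1} = ennreal (pi / \<bar>D\<bar>)"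
    "emeasure lborel {p. norm (fst p *\<^sub>R r + snd p *\<^sub>R s) < 1} = ennreal (pi / \<bar>D\<bar>)"
    unfolding norm_eq using disc[of "cball 0 1"] disc[of "ball 0 1"] by (simp_all del: norm_Pair)
qed

lemma nn_integral_unit_period:
  fixes f :: "real \<Rightarrow> ennreal"
  assumes f [measurable]: "f \<in> borel_measurable borel" and per: "\<And>x. f (x + 1) = f x"
  shows "(\<integral>\<^sup>+x. f x * indicator {a..<a + 1} x \<partial>lborel) = (\<integral>\<^sup>+x. f x * indicator {0..<1} x \<partial>lborel)"
proof -
  have shift: "(\<integral>\<^sup>+x. f x * indicator {s + t..<s' + t} x \<partial>lborel) = (\<integral>\<^sup>+x. f (t + x) * indicator {s..<s'} x \<partial>lborel)" for s s' t
  proof -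
    have "indicator {s + t..<s' + t} (t + x) = (indicator {s..<s'} x :: ennreal)" for x
      by (auto simp: indicator_def)
    then show ?thesis
      by (subst nn_integral_real_affine[where c = 1 and t = t]) auto
  qed
  have pern: "f (of_nat n + x) = f x" for n :: nat and x
  proof (induction n)
    case (Suc n)
    then show ?case using per[of "of_nat n + x"] by (simp add: add_ac)
  qed simp
  have peri: "f (of_int i + x) = f x" for i x
  proof (cases i rule: int_cases2)
    case (nonneg n)
    then show ?thesis using pern by simp
  next
    case (nonpos n)
    then show ?thesis using pern[of n "of_int i + x"] by simp
  qed
  define n where "n = \<lfloor>a\<rfloor>"
  have n: "of_int n \<le> a" "a < of_int n + 1" by (simp_all add: n_def)
  have join: "(\<integral>\<^sup>+x. f x * indicator {r..<t} x \<partial>lborel) =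
      (\<integral>\<^sup>+x. f x * indicator {r..<s} x \<partial>lborel) + (\<integral>\<^sup>+x. f x * indicator {s..<t} x \<partial>lborel)"
    if "r \<le> s" "s \<le> t" for r s t
  proof -
    have "f x * indicator {r..<t} x = f x * indicator {r..<s} x + f x * indicator {s..<t} x" for x
      using that by (auto simp: indicator_def)
    then show ?thesis by (simp add: nn_integral_add)
  qed
  have "(\<integral>\<^sup>+x. f x * indicator {a..<a + 1} x \<partial>lborel) =
      (\<integral>\<^sup>+x. f x * indicator {a..<of_int n + 1} x \<partial>lborel) + (\<integral>\<^sup>+x. f x * indicator {of_int n + 1..<a + 1} x \<partial>lborel)"
    using n by (intro join) auto
  also have "(\<integral>\<^sup>+x. f x * indicator {of_int n + 1..<a + 1} x \<partial>lborel) = (\<integral>\<^sup>+x. f x * indicator {of_int n..<a} x \<partial>lborel)"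
    unfolding shift using per by (simp add: add.commute)
  also have "(\<integral>\<^sup>+x. f x * indicator {a..<of_int n + 1} x \<partial>lborel) + (\<integral>\<^sup>+x. f x * indicator {of_int n..<a} x \<partial>lborel) =
      (\<integral>\<^sup>+x. f x * indicator {of_int n..<of_int n + 1} x \<partial>lborel)"
    using n by (subst join[of "of_int n" a "of_int n + 1"]) (auto simp: add.commute)
  also have "\<dots> = (\<integral>\<^sup>+x. f x * indicator {0..<1} x \<partial>lborel)"
    using shift[of 0 "of_int n" 1] peri by (simp add: add.commute)
  finally show ?thesis .
qed

definition near_int :: "real \<Rightarrow> real set" where
  "near_int r = {x. \<exists>i::int. \<bar>x - of_int i\<bar> \<le> r}"

lemma near_int_borel [measurable]: "near_int r \<in> sets borel"
proof -
  have "near_int r = (\<Union>i::int. {x. \<bar>x - of_int i\<bar> \<le> r})"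
    by (auto simp: near_int_def)
  also have "\<dots> \<in> sets borel" by measurable
  finally show ?thesis .
qed

lemma near_int_periodic: "x + 1 \<in> near_int r \<longleftrightarrow> x \<in> near_int r"
proof -
  have "(\<exists>i::int. \<bar>x + 1 - of_int i\<bar> \<le> r) \<longleftrightarrow> (\<exists>i::int. \<bar>x + 1 - of_int (i + 1)\<bar> \<le> r)"
    by (metis diff_add_cancel)
  then show ?thesis by (simp add: near_int_def)
qed

text \<open>Lines of one family are met with probability \<open>2r\<close> whatever the other coordinate is. The offset \<open>u\<close> disappears
by periodicity; this is the pairwise independence of the coordinates modulo 1.\<close>

lemma emeasure_near_int:
  assumes r: "0 \<le> r" "r < 1/2"
  shows "emeasure lborel {v \<in> {0..<1}. u + v \<in> near_int r} = ennreal (2 * r)"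
proof -
  let ?f = "indicator (near_int r) :: real \<Rightarrow> ennreal"
  have per: "?f (x + 1) = ?f x" for x
    by (simp add: indicator_def near_int_periodic)
  have "emeasure lborel {v \<in> {0..<1}. u + v \<in> near_int r} =
     (\<integral>\<^sup>+v. ?f (u + v) * indicator {0..<1} v \<partial>lborel)"
  proof -
    have "?f (u + v) * indicator {0..<1} v = indicator {v \<in> {0..<1}. u + v \<in> near_int r} v" for v
      by (auto simp: indicator_def)
    moreover have "{v \<in> {0..<1}. u + v \<in> near_int r} \<in> sets borel" by measurable
    ultimately show ?thesis by simp
  qed
  also have "\<dots> = (\<integral>\<^sup>+v. ?f v * indicator {u..<u + 1} v \<partial>lborel)"
  proof -
    have "indicator {u..<u + 1} (u + v) = (indicator {0..<1} v :: ennreal)" for v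
      by (auto simp: indicator_def)
    then show ?thesis
      by (subst nn_integral_real_affine[where c = 1 and t = u and f = "\<lambda>v. ?f v * indicator {u..<u + 1} v"]) auto
  qed
  also have "\<dots> = (\<integral>\<^sup>+v. ?f v * indicator {-1/2..<-1/2 + 1} v \<partial>lborel)"
    using nn_integral_unit_period[of ?f u] nn_integral_unit_period[of ?f "-1/2"] per by simp
  also have "\<dots> = (\<integral>\<^sup>+v. indicator {-r..r} v \<partial>lborel)"
  proof (intro nn_integral_cong)
    fix v :: real
    have "v \<in> near_int r \<longleftrightarrow> \<bar>v\<bar> \<le> r" if "-1/2 \<le> v" "v < 1/2"
    proof
      assume "v \<in> near_int r"
      then obtain i :: int where i: "\<bar>v - of_int i\<bar> \<le> r" by (auto simp: near_int_def)
      then have "i = 0" using that r by linarith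
      then show "\<bar>v\<bar> \<le> r" using i by simp
    next
      assume "\<bar>v\<bar> \<le> r"
      then show "v \<in> near_int r" unfolding near_int_def by (intro CollectI exI[of _ 0]) simp
    qed
    then show "?f v * indicator {-1/2..<-1/2 + 1} v = indicator {-r..r} v"
      using r by (auto simp: indicator_def)
  qed
  also have "\<dots> = ennreal (2 * r)" using r by simp
  finally show ?thesis .
qed

section \<open>Areas in the unit square\<close>

definition unit_square :: "(real \<times> real) set" where
  "unit_square = {0..<1} \<times> {0..<1}"

lemma unit_square_borel [measurable]: "unit_square \<in> sets borel"
  unfolding unit_square_def by (intro borel_Times) auto

lemma borel_plane: "A \<in> sets borel \<Longrightarrow> A \<in> sets (lborel \<Otimes>\<^sub>M lborel)" for A :: "(real \<times> real) set"
  by (metis lborel_prod sets_lborel)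

lemma emeasure_plane_sections:
  fixes A :: "(real \<times> real) set"
  assumes "A \<in> sets borel"
  shows "emeasure lborel A = (\<integral>\<^sup>+u. emeasure lborel {v. (u, v) \<in> A} \<partial>lborel)"
    and "emeasure lborel A = (\<integral>\<^sup>+v. emeasure lborel {u. (u, v) \<in> A} \<partial>lborel)"
  using lborel.emeasure_pair_measure_alt[OF borel_plane[OF assms]]
    lborel_pair.emeasure_pair_measure_alt2[OF borel_plane[OF assms]]
  by (simp_all add: lborel_prod vimage_def)

lemma emeasure_square_near_sum:
  assumes P [measurable]: "P \<in> sets borel" and r: "0 \<le> r" "r < 1/2"
  shows "emeasure lborel (unit_square \<inter> {p. fst p \<in> P \<and> fst p + snd p \<in> near_int r}) =
      emeasure lborel ({0..<1} \<inter> P) * ennreal (2 * r)" (is "emeasure lborel ?E = _")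
    and "emeasure lborel (unit_square \<inter> {p. snd p \<in> P \<and> fst p + snd p \<in> near_int r}) =
      emeasure lborel ({0..<1} \<inter> P) * ennreal (2 * r)" (is "emeasure lborel ?F = _")
proof -
  have [measurable]: "fst \<in> borel_measurable (borel :: (real \<times> real) measure)"
    "snd \<in> borel_measurable (borel :: (real \<times> real) measure)"
    by (intro borel_measurable_continuous_onI continuous_intros)+
  have E: "?E \<in> sets borel" and F: "?F \<in> sets borel" by measurable
  have "{v. (u, v) \<in> ?E} = (if u \<in> {0..<1} \<inter> P then {v \<in> {0..<1}. u + v \<in> near_int r} else {})" for u
    by (auto simp: unit_square_def)
  then have "emeasure lborel ?E = (\<integral>\<^sup>+u. ennreal (2 * r) * indicator ({0..<1} \<inter> P) u \<partial>lborel)"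
    unfolding emeasure_plane_sections(1)[OF E]
    by (intro nn_integral_cong) (simp add: emeasure_near_int[OF r, simplified] indicator_def)
  then show "emeasure lborel ?E = emeasure lborel ({0..<1} \<inter> P) * ennreal (2 * r)"
    by (simp add: nn_integral_cmult mult.commute)
  have "{u. (u, v) \<in> ?F} = (if v \<in> {0..<1} \<inter> P then {u \<in> {0..<1}. v + u \<in> near_int r} else {})" for v
    by (auto simp: unit_square_def add.commute)
  then have "emeasure lborel ?F = (\<integral>\<^sup>+u. ennreal (2 * r) * indicator ({0..<1} \<inter> P) u \<partial>lborel)"
    unfolding emeasure_plane_sections(2)[OF F]
    by (intro nn_integral_cong) (simp add: emeasure_near_int[OF r, simplified] indicator_def)
  then show "emeasure lborel ?F = emeasure lborel ({0..<1} \<inter> P) * ennreal (2 * r)"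
    by (simp add: nn_integral_cmult mult.commute)
qed

lemma emeasure_times_plane:
  fixes A B :: "real set"
  assumes "A \<in> sets borel" "B \<in> sets borel"
  shows "emeasure lborel (A \<times> B) = emeasure lborel A * emeasure lborel B"
  using lborel.emeasure_pair_measure_Times[of A lborel B] assms by (simp add: lborel_prod)

lemma near_int_unit:
  assumes "0 \<le> r" "r < 1/2"
  shows "emeasure lborel ({0..<1} \<inter> near_int r) = ennreal (2 * r)"
proof -
  have "{0..<1} \<inter> near_int r = {v \<in> {0..<1}. 0 + v \<in> near_int r}" by auto
  then show ?thesis using emeasure_near_int[OF assms, of 0] by simp
qed

lemma not_near_int_iff:
  assumes "0 \<le> r" "r < 1/2" "of_int i \<le> t" "t < of_int i + 1"
  shows "t \<notin> near_int r \<longleftrightarrow> of_int i + r < t \<and> t < of_int i + 1 - r"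
proof
  assume "t \<notin> near_int r"
  then have "\<not> \<bar>t - of_int i\<bar> \<le> r" "\<not> \<bar>t - of_int (i + 1)\<bar> \<le> r"
    unfolding near_int_def by blast+
  then show "of_int i + r < t \<and> t < of_int i + 1 - r"
    using assms by (auto simp: abs_le_iff)
next
  assume t: "of_int i + r < t \<and> t < of_int i + 1 - r"
  show "t \<notin> near_int r"
  proof
    assume "t \<in> near_int r"
    then obtain k :: int where k: "\<bar>t - of_int k\<bar> \<le> r" unfolding near_int_def by blast
    then have "of_int i < (of_int k :: real)" "of_int k < (of_int (i + 1) :: real)"
      using t by (auto simp: abs_le_iff)
    then have "i < k" "k < i + 1" by (simp_all only: of_int_less_iff)
    then show False by simp
  qed
qed

text \<open>The centres avoiding all lines form one triangle below and one above the antidiagonal of the square. Moving the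
upper one by a translation completes the lower one to a square of side \<open>1 - A - B - C\<close>. The triangle
inequalities keep the two triangles inside the strips allowed by the remaining lines.\<close>

lemma emeasure_square_none:
  assumes "0 \<le> A" "A < 1/2" "0 \<le> B" "B < 1/2" "0 \<le> C" "C < 1/2" "A + B + C \<le> 1"
    and tri: "A \<le> B + C" "B \<le> A + C" "C \<le> A + B"
  shows "emeasure lborel (unit_square \<inter> {p. fst p \<notin> near_int A \<and> snd p \<notin> near_int B \<and> fst p + snd p \<notin> near_int C}) =
     ennreal ((1 - A - B - C)\<^sup>2)" (is "emeasure lborel ?N = _")
proof -
  define L where "L = 1 - A - B - C"
  have L: "L \<ge> 0" using assms by (simp add: L_def)
  define T1 where "T1 = {p :: real \<times> real. A < fst p \<and> B < snd p \<and> fst p + snd p < A + B + L}"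
  define T2 where "T2 = {p :: real \<times> real. fst p < 1 - A \<and> snd p < 1 - B \<and> 1 + C < fst p + snd p}"
  \<comment> \<open>\<open>T2\<close> moved so that its corner meets the opposite corner of the completed square\<close>
  define T3 where "T3 = {p :: real \<times> real. fst p < A + L \<and> snd p < B + L \<and> A + B + L < fst p + snd p}"
  have op: "open T1" "open T2" "open T3"
    unfolding T1_def T2_def T3_def
    by (intro open_Collect_conj open_Collect_less continuous_intros)+
  have N: "?N = T1 \<union> T2"
  proof (intro set_eqI iffI)
    fix p assume p: "p \<in> ?N"
    obtain u v where uv: "p = (u, v)" by (cases p)
    have s: "0 \<le> u" "u < 1" "0 \<le> v" "v < 1" using p by (auto simp: uv unit_square_def)
    have u: "A < u" "u < 1 - A" and v: "B < v" "v < 1 - B"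
      using not_near_int_iff[of A 0 u] not_near_int_iff[of B 0 v] p s assms by (auto simp: uv)
    show "p \<in> T1 \<union> T2"
    proof (cases "u + v < 1")
      case True
      then have "u + v < 1 - C"
        using not_near_int_iff[of C 0 "u + v"] p s assms by (auto simp: uv)
      then show ?thesis using u v by (simp add: T1_def uv L_def)
    next
      case False
      then have "1 + C < u + v"
        using not_near_int_iff[of C 1 "u + v"] p s assms by (auto simp: uv)
      then show ?thesis using u v by (simp add: T2_def uv)
    qed
  next
    fix p assume p: "p \<in> T1 \<union> T2"
    obtain u v where uv: "p = (u, v)" by (cases p)
    show "p \<in> ?N"
    proof (cases "p \<in> T1")
      case True
      then have h: "A < u" "B < v" "u + v < 1 - C" by (auto simp: T1_def uv L_def)
      have "u < 1 - A" "v < 1 - B" "C < u + v" using h tri by linarith+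
      then show ?thesis
        using h not_near_int_iff[of A 0 u] not_near_int_iff[of B 0 v] not_near_int_iff[of C 0 "u + v"] assms
        by (auto simp: uv unit_square_def)
    next
      case False
      then have h: "u < 1 - A" "v < 1 - B" "1 + C < u + v" using p by (auto simp: T2_def uv)
      have "A < u" "B < v" "u + v < 2 - C" using h tri by linarith+
      then show ?thesis
        using h not_near_int_iff[of A 0 u] not_near_int_iff[of B 0 v] not_near_int_iff[of C 1 "u + v"] assms
        by (auto simp: uv unit_square_def)
    qed
  qed
  have "T1 \<inter> T2 = {}" using assms(5) by (auto simp: T1_def T2_def L_def)
  then have "emeasure lborel ?N = emeasure lborel T1 + emeasure lborel T2"
    unfolding N using op by (subst plus_emeasure) auto
  also have "emeasure lborel T2 = emeasure lborel T3"
  proof -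
    have "T3 = {p. p - (A + L - (1 - A), B + L - (1 - B)) \<in> T2}"
      by (auto simp: T2_def T3_def L_def)
    then show ?thesis using op by (simp add: emeasure_translate)
  qed
  also have "emeasure lborel T1 + emeasure lborel T3 = emeasure lborel (T1 \<union> T3)"
  proof -
    have "T1 \<inter> T3 = {}" by (auto simp: T1_def T3_def)
    then show ?thesis using op by (subst plus_emeasure) auto
  qed
  also have "\<dots> = emeasure lborel ({A<..<A + L} \<times> {B<..<B + L})"
  proof (rule emeasure_eq_AE)
    have "AE p in lborel. (1, 1) \<bullet> (p :: real \<times> real) \<noteq> A + B + L"
      by (rule AE_not_on_line) (simp add: zero_prod_def)
    then show "AE p in lborel. p \<in> T1 \<union> T3 \<longleftrightarrow> p \<in> {A<..<A + L} \<times> {B<..<B + L}"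
      by eventually_elim (auto simp: T1_def T3_def)
  qed (use op in \<open>auto intro!: borel_Times\<close>)
  also have "\<dots> = ennreal (L\<^sup>2)"
    using L by (subst emeasure_times_plane) (auto simp: ennreal_mult' power2_eq_square)
  finally show ?thesis unfolding L_def .
qed

lemma nn_integral_square_period:
  fixes f :: "real \<times> real \<Rightarrow> ennreal"
  assumes f: "f \<in> borel_measurable borel"
    and per: "\<And>u v. f (u + 1, v) = f (u, v)" "\<And>u v. f (u, v + 1) = f (u, v)"
  shows "(\<integral>\<^sup>+p. f p * indicator unit_square p \<partial>lborel) =
    (\<integral>\<^sup>+p. f p * indicator ({-1/2..<1/2} \<times> {-1/2..<1/2}) p \<partial>lborel)"
proof -
  have f' [measurable]: "f \<in> borel_measurable (lborel \<Otimes>\<^sub>M lborel)"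
    unfolding lborel_prod using f by simp
  have iter: "(\<integral>\<^sup>+p. f p * indicator (I \<times> I) p \<partial>lborel) =
     (\<integral>\<^sup>+u. (\<integral>\<^sup>+v. f (u, v) * indicator I v \<partial>lborel) * indicator I u \<partial>lborel)"
    if [measurable]: "I \<in> sets borel" for I :: "real set"
  proof -
    have "(\<integral>\<^sup>+p. f p * indicator (I \<times> I) p \<partial>lborel) =
       (\<integral>\<^sup>+u. (\<integral>\<^sup>+v. f (u, v) * indicator (I \<times> I) (u, v) \<partial>lborel) \<partial>lborel)"
      unfolding lborel_prod[symmetric] by (intro lborel.nn_integral_fst[symmetric]) measurable
    also have "\<dots> = (\<integral>\<^sup>+u. (\<integral>\<^sup>+v. f (u, v) * indicator I v * indicator I u \<partial>lborel) \<partial>lborel)"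
      by (intro nn_integral_cong) (auto simp: indicator_def)
    also have "\<dots> = (\<integral>\<^sup>+u. (\<integral>\<^sup>+v. f (u, v) * indicator I v \<partial>lborel) * indicator I u \<partial>lborel)"
      by (intro nn_integral_cong nn_integral_multc) measurable
    finally show ?thesis .
  qed
  have one: "(\<integral>\<^sup>+x. g x * indicator {0..<1} x \<partial>lborel) = (\<integral>\<^sup>+x. g x * indicator {-1/2..<1/2} x \<partial>lborel)"
    if "g \<in> borel_measurable borel" "\<And>x. g (x + 1) = g x" for g :: "real \<Rightarrow> ennreal"
    using nn_integral_unit_period[OF that, of "-1/2"] by simp
  have meas: "(\<lambda>v. f (u, v)) \<in> borel_measurable borel" for u
    using f' by measurable
  have "(\<integral>\<^sup>+p. f p * indicator unit_square p \<partial>lborel) =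
      (\<integral>\<^sup>+u. (\<integral>\<^sup>+v. f (u, v) * indicator {-1/2..<1/2} v \<partial>lborel) * indicator {0..<1} u \<partial>lborel)"
    unfolding unit_square_def by (subst iter) (auto simp: one[OF meas per(2)])
  also have "\<dots> = (\<integral>\<^sup>+u. (\<integral>\<^sup>+v. f (u, v) * indicator {-1/2..<1/2} v \<partial>lborel) * indicator {-1/2..<1/2} u \<partial>lborel)"
  proof (rule one)
    show "(\<lambda>u. \<integral>\<^sup>+v. f (u, v) * indicator {-1/2..<1/2} v \<partial>lborel) \<in> borel_measurable borel"
      using lborel.borel_measurable_nn_integral_fst[of "\<lambda>p. f p * indicator {-1/2..<1/2} (snd p)" lborel]
      by simp
  qed (simp add: per)
  also have "\<dots> = (\<integral>\<^sup>+p. f p * indicator ({-1/2..<1/2} \<times> {-1/2..<1/2}) p \<partial>lborel)"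
    by (subst iter) auto
  finally show ?thesis .
qed


text \<open>The lattice vertices are the integer points. For the dual basis \<open>r\<close>, \<open>s\<close> of two vectors, \<open>u r + v s\<close> is the
unique point with products \<open>u\<close> and \<open>v\<close> with them, so the norm condition says that the displacement from
the vertex to \<open>p\<close> comes from a point of the disc. The disc is symmetric, so the direction is immaterial.\<close>

definition vertex_within :: "real \<times> real \<Rightarrow> real \<times> real \<Rightarrow> real \<times> real \<Rightarrow> bool" where
  "vertex_within r s p \<longleftrightarrow> (\<exists>i j::int. norm ((fst p - of_int i) *\<^sub>R r + (snd p - of_int j) *\<^sub>R s) \<le> 1)"

lemma closed_vertex_term: "closed {p. norm ((fst p - x) *\<^sub>R r + (snd p - y) *\<^sub>R s) \<le> 1}"
  for r s :: "real \<times> real" and x y :: real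
  by (intro closed_Collect_le continuous_intros)

lemma vertex_within_borel [measurable]: "{p. vertex_within r s p} \<in> sets borel"
proof -
  have "{p. vertex_within r s p} = (\<Union>i::int. \<Union>j::int. {p. norm ((fst p - of_int i) *\<^sub>R r + (snd p - of_int j) *\<^sub>R s) \<le> 1})"
    by (auto simp: vertex_within_def)
  also have "\<dots> \<in> sets borel"
    using closed_vertex_term by (intro sets.countable_UN'' borel_closed) auto
  finally show ?thesis .
qed

lemma vertex_within_periodic:
  "vertex_within r s (u + 1, v) \<longleftrightarrow> vertex_within r s (u, v)"
  "vertex_within r s (u, v + 1) \<longleftrightarrow> vertex_within r s (u, v)"
proof -
  have ex_shift: "(\<exists>i::int. Q i) \<longleftrightarrow> (\<exists>i. Q (i + 1))" for Q
    by (metis diff_add_cancel)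
  have "vertex_within r s (u + 1, v) \<longleftrightarrow>
      (\<exists>i::int. \<exists>j::int. norm ((u + 1 - of_int (i + 1)) *\<^sub>R r + (v - of_int j) *\<^sub>R s) \<le> 1)"
    unfolding vertex_within_def fst_conv snd_conv by (rule ex_shift)
  then show "vertex_within r s (u + 1, v) \<longleftrightarrow> vertex_within r s (u, v)"
    by (simp add: vertex_within_def)
  have "vertex_within r s (u, v + 1) \<longleftrightarrow>
      (\<exists>i::int. \<exists>j::int. norm ((u - of_int i) *\<^sub>R r + (v + 1 - of_int (j + 1)) *\<^sub>R s) \<le> 1)"
    unfolding vertex_within_def fst_conv snd_conv by (subst ex_shift) simp
  then show "vertex_within r s (u, v + 1) \<longleftrightarrow> vertex_within r s (u, v)"
    by (simp add: vertex_within_def)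
qed

text \<open>On the square centred at the origin only the vertex 0 can be within reach, so there the event is a single
ellipse. Periodicity transfers its area to the unit square.\<close>

lemma emeasure_square_vertex:
  fixes r s :: "real \<times> real"
  assumes D: "fst r * snd s - snd r * fst s \<noteq> 0"
    and small: "\<And>u v. norm (u *\<^sub>R r + v *\<^sub>R s) \<le> 1 \<Longrightarrow> \<bar>u\<bar> < 1/2 \<and> \<bar>v\<bar> < 1/2"
  shows "emeasure lborel (unit_square \<inter> {p. vertex_within r s p}) =
    ennreal (pi / \<bar>fst r * snd s - snd r * fst s\<bar>)"
proof -
  let ?V = "{p. vertex_within r s p}" and ?H = "{-1/2..<1/2} \<times> {-1/2..<1/2} :: (real \<times> real) set"
  have ind: "indicator ?V p * indicator W p = (indicator (W \<inter> ?V) p :: ennreal)" for p W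
    by (auto simp: indicator_def)
  have H: "?H \<in> sets borel" by (intro borel_Times) auto
  have "emeasure lborel (unit_square \<inter> ?V) = (\<integral>\<^sup>+p. indicator ?V p * indicator unit_square p \<partial>lborel)"
    unfolding ind by simp
  also have "\<dots> = (\<integral>\<^sup>+p. indicator ?V p * indicator ?H p \<partial>lborel)"
  proof (rule nn_integral_square_period)
    show "indicator ?V \<in> borel_measurable borel"
      by (intro borel_measurable_indicator vertex_within_borel)
  qed (simp_all add: indicator_def vertex_within_periodic)
  also have "\<dots> = emeasure lborel (?H \<inter> ?V)"
    unfolding ind using H by simp
  also have "?H \<inter> ?V = {p. norm (fst p *\<^sub>R r + snd p *\<^sub>R s) \<le> 1}"
  proof (intro set_eqI iffI)
    fix p assume p: "p \<in> ?H \<inter> ?V"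
    then obtain i j :: int where ij: "norm ((fst p - of_int i) *\<^sub>R r + (snd p - of_int j) *\<^sub>R s) \<le> 1"
      by (auto simp: vertex_within_def)
    have "-1/2 \<le> fst p" "fst p < 1/2" "-1/2 \<le> snd p" "snd p < 1/2"
      using p by (auto simp: mem_Times_iff)
    then have "i = 0" "j = 0"
      using small[OF ij] by linarith+
    then show "p \<in> {p. norm (fst p *\<^sub>R r + snd p *\<^sub>R s) \<le> 1}" using ij by simp
  next
    fix p assume p: "p \<in> {p. norm (fst p *\<^sub>R r + snd p *\<^sub>R s) \<le> 1}"
    then have "vertex_within r s p"
      unfolding vertex_within_def by (intro exI[of _ 0]) simp
    moreover have "\<bar>fst p\<bar> < 1/2 \<and> \<bar>snd p\<bar> < 1/2" using small[of "fst p" "snd p"] p by simp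
    ultimately show "p \<in> ?H \<inter> ?V" by (auto simp: mem_Times_iff abs_less_iff)
  qed
  finally show ?thesis using area_ellipse(1)[OF D] by simp
qed

text \<open>The boundary curve is the difference of the closed and the open ellipse, whose areas agree.\<close>

lemma AE_no_boundary_vertex:
  fixes r s :: "real \<times> real"
  assumes D: "fst r * snd s - snd r * fst s \<noteq> 0"
  shows "AE p in lborel. \<forall>i j::int. norm ((fst p - of_int i) *\<^sub>R r + (snd p - of_int j) *\<^sub>R s) \<noteq> 1"
proof -
  let ?E = "{p. norm (fst p *\<^sub>R r + snd p *\<^sub>R s) = 1}"
  let ?L = "{p. norm (fst p *\<^sub>R r + snd p *\<^sub>R s) \<le> 1}" and ?O = "{p. norm (fst p *\<^sub>R r + snd p *\<^sub>R s) < 1}"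
  have op: "open ?O" by (intro open_Collect_less continuous_intros)
  have cl: "closed ?L" by (intro closed_Collect_le continuous_intros)
  have clE: "closed ?E" by (intro closed_Collect_eq continuous_intros)
  have "emeasure lborel (?L - ?O) = emeasure lborel ?L - emeasure lborel ?O"
    using op cl area_ellipse(2)[OF D] by (intro emeasure_Diff) auto
  also have "\<dots> = 0" using area_ellipse[OF D] by simp
  finally have E0: "emeasure lborel ?E = 0"
    by (smt (verit) Collect_cong mem_Collect_eq set_diff_eq)
  have "AE p in lborel. norm ((fst p - of_int i) *\<^sub>R r + (snd p - of_int j) *\<^sub>R s) \<noteq> 1" for i j :: int
  proof -
    have sh: "{p. p - (of_int i, of_int j) \<in> ?E} = {p. norm ((fst p - of_int i) *\<^sub>R r + (snd p - of_int j) *\<^sub>R s) = 1}"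
      by simp
    have "emeasure lborel {p. norm ((fst p - of_int i) *\<^sub>R r + (snd p - of_int j) *\<^sub>R s) = 1} = 0"
      using emeasure_translate[of ?E "(of_int i, of_int j)"] clE E0 unfolding sh by simp
    moreover have "closed {p. norm ((fst p - of_int i) *\<^sub>R r + (snd p - of_int j) *\<^sub>R s) = 1}"
      by (intro closed_Collect_eq continuous_intros)
    ultimately have "{p. norm ((fst p - of_int i) *\<^sub>R r + (snd p - of_int j) *\<^sub>R s) = 1} \<in> null_sets lborel"
      by (intro null_setsI) auto
    from AE_not_in[OF this] show ?thesis by simp
  qed
  then show ?thesis by (simp add: AE_all_countable)
qed

section \<open>Affine images of the disc in general position\<close>

text \<open>The ellipse centred at the point with first two coordinates \<open>p\<close>, in the three coordinates; \<open>m\<close>, \<open>n\<close> and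
\<open>-(m + n)\<close> are the coordinate functionals pulled back to the disc.\<close>

definition disc_image :: "real \<times> real \<Rightarrow> real \<times> real \<Rightarrow> real \<times> real \<Rightarrow> (real \<times> real \<times> real) set" where
  "disc_image m n p = (\<lambda>x. (fst p + m \<bullet> x, snd p + n \<bullet> x, - (fst p + snd p) - (m + n) \<bullet> x)) ` cball 0 1"

definition cross :: "real \<times> real \<Rightarrow> real \<times> real \<Rightarrow> real" where
  "cross r s = fst r * snd s - snd r * fst s"

lemma image_affine_cball:
  fixes n :: "real \<times> real"
  shows "(\<lambda>x. c + n \<bullet> x) ` cball 0 1 = {c - norm n..c + norm n}"
proof (intro equalityI subsetI)
  fix t assume "t \<in> (\<lambda>x. c + n \<bullet> x) ` cball 0 1"
  then obtain x where x: "t = c + n \<bullet> x" "norm x \<le> 1" by auto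
  have "\<bar>n \<bullet> x\<bar> \<le> norm n * norm x" by (rule Cauchy_Schwarz_ineq2)
  also have "\<dots> \<le> norm n" using x(2) by (simp add: mult_left_le)
  finally show "t \<in> {c - norm n..c + norm n}" using x(1) by (auto simp: abs_le_iff)
next
  fix t assume t: "t \<in> {c - norm n..c + norm n}"
  show "t \<in> (\<lambda>x. c + n \<bullet> x) ` cball 0 1"
  proof (cases "n = 0")
    case True
    then show ?thesis using t by (auto intro!: image_eqI[of _ _ 0])
  next
    case False
    have nn: "n \<bullet> n = norm n * norm n"
      by (simp add: power2_norm_eq_inner[symmetric] power2_eq_square)
    let ?x = "((t - c) / (norm n * norm n)) *\<^sub>R n"
    have "norm ?x = \<bar>t - c\<bar> / norm n" using False by simp
    also have "\<dots> \<le> 1" using t False by (auto simp: divide_le_eq_1 abs_le_iff)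
    finally have "?x \<in> cball 0 1" by simp
    moreover have "t = c + n \<bullet> ?x" using False by (simp add: nn)
    ultimately show ?thesis by blast
  qed
qed

lemma coords_disc_image:
  "coord1 ` disc_image m n p = {fst p - norm m..fst p + norm m}"
  "coord2 ` disc_image m n p = {snd p - norm n..snd p + norm n}"
  "coord3 ` disc_image m n p = {- (fst p + snd p) - norm (m + n)..- (fst p + snd p) + norm (m + n)}"
proof -
  have "- (fst p + snd p) - (m + n) \<bullet> x = - (fst p + snd p) + (- (m + n)) \<bullet> x" for x
    by (simp only: inner_minus_left diff_conv_add_uminus)
  then show "coord3 ` disc_image m n p = {- (fst p + snd p) - norm (m + n)..- (fst p + snd p) + norm (m + n)}"
    unfolding disc_image_def image_image snd_conv using image_affine_cball[of _ "- (m + n)"]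
    by (simp only: norm_minus_cancel)
qed (simp_all add: disc_image_def image_image image_affine_cball)

lemma convex_disc_image: "convex (disc_image m n p)"
proof -
  have eq: "disc_image m n p = (+) (fst p, snd p, - (fst p + snd p)) ` (\<lambda>x. (m \<bullet> x, n \<bullet> x, - ((m + n) \<bullet> x))) ` cball 0 1"
    by (simp add: disc_image_def image_image algebra_simps)
  have "linear (\<lambda>x. (m \<bullet> x, n \<bullet> x, - ((m + n) \<bullet> x)))"
    by (intro linearI) (simp_all add: inner_add_right)
  then show ?thesis
    unfolding eq by (intro convex_translation convex_linear_image convex_cball)
qed

lemma zero_sum_disc_image: "zero_sum (disc_image m n p)"
  by (auto simp: zero_sum_def disc_image_def inner_add_left)

lemma disc_image_nonempty: "disc_image m n p \<noteq> {}"
  by (simp add: disc_image_def)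

lemma interval_misses_or_crosses:
  assumes "0 \<le> r" "r < 1/2" "\<And>k::int. c - r \<noteq> of_int k" "\<And>k::int. c + r \<noteq> of_int k"
  shows "(\<exists>i. misses {c - r..c + r} i) \<or> (\<exists>i. crosses {c - r..c + r} i)"
proof -
  define i where "i = \<lfloor>c + r\<rfloor>"
  have i: "of_int i < c + r" "c + r < of_int i + 1"
    using assms(4)[of i] floor_correct[of "c + r"] by (auto simp: i_def less_le)
  show ?thesis
  proof (cases "of_int i < c - r")
    case True
    then have "misses {c - r..c + r} i" using i by (auto simp: misses_def)
    then show ?thesis by blast
  next
    case False
    then have "c - r < of_int i" using assms(3)[of i] by simp
    then have "crosses {c - r..c + r} i"
      unfolding crosses_def using i assms(1,2)
      by (intro conjI ballI bexI[of _ "c - r"] bexI[of _ "c + r"]) auto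
    then show ?thesis by blast
  qed
qed

lemma interval_crosses:
  assumes "0 \<le> r" "r < 1/2" "\<And>k::int. c - r \<noteq> of_int k" "\<And>k::int. c + r \<noteq> of_int k"
    and "of_int i \<in> {c - r..c + r}"
  shows "crosses {c - r..c + r} i"
proof -
  have "c - r < of_int i" "of_int i < c + r"
    using assms(3)[of i] assms(4)[of i] assms(5) by (auto simp: less_le)
  then show ?thesis
    unfolding crosses_def using assms(1,2)
    by (intro conjI ballI bexI[of _ "c - r"] bexI[of _ "c + r"]) auto
qed

lemma meets_int_interval: "meets_int {c - r..c + r} \<longleftrightarrow> c \<in> near_int r"
  by (auto simp: meets_int_def near_int_def abs_le_iff algebra_simps)

lemma near_int_uminus: "- c \<in> near_int r \<longleftrightarrow> c \<in> near_int r"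
proof -
  have *: "c \<in> near_int r \<Longrightarrow> - c \<in> near_int r" for c
  proof -
    assume "c \<in> near_int r"
    then obtain i :: int where "\<bar>c - of_int i\<bar> \<le> r" by (auto simp: near_int_def)
    then have "\<bar>- c - of_int (- i)\<bar> \<le> r" by (simp add: abs_minus_commute)
    then show "- c \<in> near_int r" unfolding near_int_def by blast
  qed
  show ?thesis using *[of c] *[of "- c"] by auto
qed

text \<open>Equality in the triangle inequality forces the vectors to be parallel. This strictness is where the roundness
of the body enters: it bounds each half-length by less than 1/2.\<close>

lemma norm_add_less:
  assumes "cross m n \<noteq> 0"
  shows "norm (m + n) < norm m + norm n" "norm m < norm (m + n) + norm n" "norm n < norm (m + n) + norm m"
proof -
  have strict: "norm (x + y) < norm x + norm y" if "cross x y \<noteq> 0" for x y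
  proof (rule ccontr)
    assume "\<not> norm (x + y) < norm x + norm y"
    then have "norm (x + y) = norm x + norm y" using norm_triangle_ineq[of x y] by simp
    then have "norm x *\<^sub>R y = norm y *\<^sub>R x" by (simp add: norm_triangle_eq)
    then have eq: "norm x * fst y = norm y * fst x" "norm x * snd y = norm y * snd x"
      by (metis fst_scaleR real_scaleR_def, metis snd_scaleR real_scaleR_def)
    have "norm x * cross x y = fst x * (norm x * snd y) - snd x * (norm x * fst y)"
      by (simp add: cross_def algebra_simps)
    also have "\<dots> = 0" unfolding eq by simp
    finally have "x = 0" using that by simp
    then show False using that by (simp add: cross_def)
  qed
  show "norm (m + n) < norm m + norm n" using strict assms by blast
  have "cross (m + n) (- n) \<noteq> 0" "cross (m + n) (- m) \<noteq> 0"
    using assms by (simp_all add: cross_def algebra_simps)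
  then show "norm m < norm (m + n) + norm n" "norm n < norm (m + n) + norm m"
    using strict[of "m + n" "- n"] strict[of "m + n" "- m"] by simp_all
qed

text \<open>With the next definition the basis dual to \<open>m\<close> and \<open>n\<close>, so that displacements can be pulled back to the disc.\<close>

definition dual1 :: "real \<times> real \<Rightarrow> real \<times> real \<Rightarrow> real \<times> real" where
  "dual1 m n = (snd n / cross m n, - fst n / cross m n)"

definition dual2 :: "real \<times> real \<Rightarrow> real \<times> real \<Rightarrow> real \<times> real" where
  "dual2 m n = (- snd m / cross m n, fst m / cross m n)"

lemma dual:
  assumes "cross m n \<noteq> 0"
  shows "m \<bullet> (x *\<^sub>R dual1 m n + y *\<^sub>R dual2 m n) = x"
    and "n \<bullet> (x *\<^sub>R dual1 m n + y *\<^sub>R dual2 m n) = y"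
    and "(m \<bullet> z) *\<^sub>R dual1 m n + (n \<bullet> z) *\<^sub>R dual2 m n = z"
    and "cross (dual1 m n) (dual2 m n) = 1 / cross m n"
proof -
  obtain a b c d where mn: "m = (a, b)" "n = (c, d)" by (metis surj_pair)
  define K where "K = cross m n"
  have K: "K \<noteq> 0" "K = a * d - b * c" using assms by (simp_all add: K_def cross_def mn)
  note defs = dual1_def dual2_def K_def[symmetric]
  have "m \<bullet> (x *\<^sub>R dual1 m n + y *\<^sub>R dual2 m n) = (x * K) / K"
    using K(1) unfolding defs by (simp add: mn field_simps) (simp add: K(2) algebra_simps)
  then show "m \<bullet> (x *\<^sub>R dual1 m n + y *\<^sub>R dual2 m n) = x" using K(1) by simp
  have "n \<bullet> (x *\<^sub>R dual1 m n + y *\<^sub>R dual2 m n) = (y * K) / K"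
    using K(1) unfolding defs by (simp add: mn field_simps) (simp add: K(2) algebra_simps)
  then show "n \<bullet> (x *\<^sub>R dual1 m n + y *\<^sub>R dual2 m n) = y" using K(1) by simp
  have "(m \<bullet> z) *\<^sub>R dual1 m n + (n \<bullet> z) *\<^sub>R dual2 m n = ((fst z * K) / K, (snd z * K) / K)"
    using K(1) unfolding defs by (cases z) (simp add: mn field_simps, simp add: K(2) algebra_simps)
  then show "(m \<bullet> z) *\<^sub>R dual1 m n + (n \<bullet> z) *\<^sub>R dual2 m n = z" using K(1) by simp
  have "dual1 m n = (d / K, - c / K)" "dual2 m n = (- b / K, a / K)"
    unfolding defs by (simp_all add: mn)
  then have "cross (dual1 m n) (dual2 m n) = (a * d - b * c) / (K * K)"
    by (simp add: cross_def diff_divide_distrib mult.commute)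
  then have "cross (dual1 m n) (dual2 m n) = K / (K * K)"
    unfolding K(2)[symmetric] .
  then show "cross (dual1 m n) (dual2 m n) = 1 / cross m n" using K(1) by (simp add: K_def)
qed

lemma disc_image_mem_iff:
  assumes "cross m n \<noteq> 0"
  shows "(x, y, - x - y) \<in> disc_image m n p \<longleftrightarrow> norm ((fst p - x) *\<^sub>R dual1 m n + (snd p - y) *\<^sub>R dual2 m n) \<le> 1"
    (is "_ \<longleftrightarrow> norm ?w \<le> 1")
proof
  assume "(x, y, - x - y) \<in> disc_image m n p"
  then obtain z where z: "norm z \<le> 1" "x = fst p + m \<bullet> z" "y = snd p + n \<bullet> z"
    by (auto simp: disc_image_def)
  have "?w = - z"
    using dual(3)[OF assms, of z] z by (simp add: algebra_simps)
  then show "norm ?w \<le> 1" using z by simp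
next
  assume w: "norm ?w \<le> 1"
  define z where "z = - ?w"
  have "m \<bullet> z = x - fst p" "n \<bullet> z = y - snd p"
    unfolding z_def inner_minus_right dual(1,2)[OF assms] by simp_all
  moreover have "norm z \<le> 1" using w unfolding z_def norm_minus_cancel .
  ultimately show "(x, y, - x - y) \<in> disc_image m n p"
    unfolding disc_image_def by (intro image_eqI[of _ _ z]) (simp_all add: inner_add_left)
qed

text \<open>No tangent line and no vertex on the boundary.\<close>

definition in_general_position :: "real \<times> real \<Rightarrow> real \<times> real \<Rightarrow> real \<times> real \<Rightarrow> bool" where
  "in_general_position m n p \<longleftrightarrow>
    (\<forall>k::int. fst p - norm m \<noteq> of_int k \<and> fst p + norm m \<noteq> of_int k
      \<and> snd p - norm n \<noteq> of_int k \<and> snd p + norm n \<noteq> of_int k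
      \<and> - (fst p + snd p) - norm (m + n) \<noteq> of_int k \<and> - (fst p + snd p) + norm (m + n) \<noteq> of_int k)
    \<and> (\<forall>i j::int. norm ((fst p - of_int i) *\<^sub>R dual1 m n + (snd p - of_int j) *\<^sub>R dual2 m n) \<noteq> 1)"

lemma AE_in_general_position:
  assumes D: "cross m n \<noteq> 0"
  shows "AE p in lborel. in_general_position m n p"
proof -
  have e: "(1, 0) \<noteq> (0 :: real \<times> real)" "(0, 1) \<noteq> (0 :: real \<times> real)" "(1, 1) \<noteq> (0 :: real \<times> real)"
    by (simp_all add: zero_prod_def)
  have "AE p in lborel. \<forall>k::int. fst p - norm m \<noteq> of_int k \<and> fst p + norm m \<noteq> of_int k
      \<and> snd p - norm n \<noteq> of_int k \<and> snd p + norm n \<noteq> of_int k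
      \<and> - (fst p + snd p) - norm (m + n) \<noteq> of_int k \<and> - (fst p + snd p) + norm (m + n) \<noteq> of_int k"
    unfolding AE_all_countable
  proof
    fix k :: int
    have A: "AE p in lborel. (1, 0) \<bullet> (p :: real \<times> real) \<noteq> of_int k + norm m"
      "AE p in lborel. (1, 0) \<bullet> (p :: real \<times> real) \<noteq> of_int k - norm m"
      "AE p in lborel. (0, 1) \<bullet> (p :: real \<times> real) \<noteq> of_int k + norm n"
      "AE p in lborel. (0, 1) \<bullet> (p :: real \<times> real) \<noteq> of_int k - norm n"
      "AE p in lborel. (1, 1) \<bullet> (p :: real \<times> real) \<noteq> - of_int k - norm (m + n)"
      "AE p in lborel. (1, 1) \<bullet> (p :: real \<times> real) \<noteq> - of_int k + norm (m + n)"
      by (intro AE_not_on_line e)+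
    show "AE p in lborel. fst p - norm m \<noteq> of_int k \<and> fst p + norm m \<noteq> of_int k
      \<and> snd p - norm n \<noteq> of_int k \<and> snd p + norm n \<noteq> of_int k
      \<and> - (fst p + snd p) - norm (m + n) \<noteq> of_int k \<and> - (fst p + snd p) + norm (m + n) \<noteq> of_int k"
      using A by eventually_elim (auto simp: inner_prod_def)
  qed
  moreover have "AE p in lborel. \<forall>i j::int. norm ((fst p - of_int i) *\<^sub>R dual1 m n + (snd p - of_int j) *\<^sub>R dual2 m n) \<noteq> 1"
    using dual(4)[OF D] D by (intro AE_no_boundary_vertex) (simp add: cross_def)
  ultimately show ?thesis
    unfolding in_general_position_def by eventually_elim blast
qed

text \<open>The second claim is needed to express the events as polynomials in indicator functions: containing a vertex
implies meeting a line of each family.\<close>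

lemma card_hit_cells_disc_image:
  assumes D: "cross m n \<noteq> 0" and fit: "norm m + norm n + norm (m + n) \<le> 1"
    and gen: "in_general_position m n p"
  shows "card (hit_cells (disc_image m n p)) = (if vertex_within (dual1 m n) (dual2 m n) p then 6
    else 1 + of_bool (fst p \<in> near_int (norm m)) + of_bool (snd p \<in> near_int (norm n))
      + of_bool (fst p + snd p \<in> near_int (norm (m + n))))"
    and "vertex_within (dual1 m n) (dual2 m n) p \<Longrightarrow>
      fst p \<in> near_int (norm m) \<and> snd p \<in> near_int (norm n) \<and> fst p + snd p \<in> near_int (norm (m + n))"
proof -
  let ?S = "disc_image m n p"
  have half: "norm m < 1/2" "norm n < 1/2" "norm (m + n) < 1/2"
    using norm_add_less[OF D] fit by linarith+
  have g: "fst p - norm m \<noteq> of_int k" "fst p + norm m \<noteq> of_int k"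
      "snd p - norm n \<noteq> of_int k" "snd p + norm n \<noteq> of_int k"
      "- (fst p + snd p) - norm (m + n) \<noteq> of_int k" "- (fst p + snd p) + norm (m + n) \<noteq> of_int k" for k :: int
    using gen unfolding in_general_position_def by blast+
  have meets: "meets_int (coord1 ` ?S) \<longleftrightarrow> fst p \<in> near_int (norm m)"
    "meets_int (coord2 ` ?S) \<longleftrightarrow> snd p \<in> near_int (norm n)"
    "meets_int (coord3 ` ?S) \<longleftrightarrow> fst p + snd p \<in> near_int (norm (m + n))"
    unfolding coords_disc_image meets_int_interval near_int_uminus by (rule refl)+
  have vertex: "(of_int i, of_int j, - of_int i - of_int j) \<in> ?S \<longleftrightarrow>
      norm ((fst p - of_int i) *\<^sub>R dual1 m n + (snd p - of_int j) *\<^sub>R dual2 m n) \<le> 1" for i j :: int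
    by (rule disc_image_mem_iff[OF D])
  show "fst p \<in> near_int (norm m) \<and> snd p \<in> near_int (norm n) \<and> fst p + snd p \<in> near_int (norm (m + n))"
    if V: "vertex_within (dual1 m n) (dual2 m n) p"
  proof -
    obtain i j :: int where "(of_int i, of_int j, - of_int i - of_int j) \<in> ?S"
      using V unfolding vertex_within_def vertex[symmetric] by blast
    then have "of_int i \<in> coord1 ` ?S" "of_int j \<in> coord2 ` ?S" "of_int (- i - j) \<in> coord3 ` ?S"
      by force+
    then show ?thesis unfolding meets[symmetric] meets_int_def by blast
  qed
  show "card (hit_cells ?S) = (if vertex_within (dual1 m n) (dual2 m n) p then 6
    else 1 + of_bool (fst p \<in> near_int (norm m)) + of_bool (snd p \<in> near_int (norm n))
      + of_bool (fst p + snd p \<in> near_int (norm (m + n))))"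
  proof (cases "vertex_within (dual1 m n) (dual2 m n) p")
    case False
    have "card (hit_cells ?S) = 1 + of_bool (meets_int (coord1 ` ?S))
      + of_bool (meets_int (coord2 ` ?S)) + of_bool (meets_int (coord3 ` ?S))"
    proof (rule card_hit_cells_no_vertex[OF convex_disc_image zero_sum_disc_image disc_image_nonempty])
      show "(of_int i, of_int j, - of_int i - of_int j) \<notin> ?S" for i j :: int
        using False unfolding vertex vertex_within_def by blast
    qed (unfold coords_disc_image, (intro interval_misses_or_crosses half g norm_ge_zero)+)
    then show ?thesis using False by (simp only: meets if_False)
  next
    case True
    then obtain i j :: int where ij: "norm ((fst p - of_int i) *\<^sub>R dual1 m n + (snd p - of_int j) *\<^sub>R dual2 m n) \<le> 1"
      unfolding vertex_within_def by blast
    let ?w = "(fst p - of_int i) *\<^sub>R dual1 m n + (snd p - of_int j) *\<^sub>R dual2 m n"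
    have w: "norm ?w < 1" using ij gen unfolding in_general_position_def by (simp add: less_le)
    \<comment> \<open>a square of this size around the vertex is pulled back into the disc\<close>
    define e where "e = (1 - norm ?w) / (norm (dual1 m n) + norm (dual2 m n) + 1)"
    have den: "norm (dual1 m n) + norm (dual2 m n) + 1 > 0"
      by (simp add: add_nonneg_pos)
    have e: "0 < e" using w den by (simp add: e_def)
    have eb: "e * (norm (dual1 m n) + norm (dual2 m n)) \<le> 1 - norm ?w"
    proof -
      have "e * (norm (dual1 m n) + norm (dual2 m n)) \<le> e * (norm (dual1 m n) + norm (dual2 m n) + 1)"
        using e by (intro mult_left_mono) auto
      also have "\<dots> = 1 - norm ?w" using den by (simp add: e_def)
      finally show ?thesis .
    qed
    have in_S: "(of_int i, of_int j, - of_int i - of_int j) \<in> ?S"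
      using ij vertex by blast
    then have memb: "of_int i \<in> coord1 ` ?S" "of_int j \<in> coord2 ` ?S" "of_int (- i - j) \<in> coord3 ` ?S"
      by force+
    have "card (hit_cells ?S) = 6"
    proof (rule card_hit_cells_vertex_inside[OF zero_sum_disc_image, of _ _ _ i j "- i - j" e])
      show "crosses (coord1 ` ?S) i" "crosses (coord2 ` ?S) j" "crosses (coord3 ` ?S) (- i - j)"
        unfolding coords_disc_image
        by (rule interval_crosses[OF norm_ge_zero half(1) g(1,2) memb(1)[unfolded coords_disc_image]]
             interval_crosses[OF norm_ge_zero half(2) g(3,4) memb(2)[unfolded coords_disc_image]]
             interval_crosses[OF norm_ge_zero half(3) g(5,6) memb(3)[unfolded coords_disc_image]])+
      show "(of_int i + x, of_int j + y, of_int (- i - j) - x - y) \<in> ?S" if xy: "\<bar>x\<bar> \<le> e" "\<bar>y\<bar> \<le> e" for x y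
      proof -
        have "(fst p - (of_int i + x)) *\<^sub>R dual1 m n + (snd p - (of_int j + y)) *\<^sub>R dual2 m n =
            ?w - (x *\<^sub>R dual1 m n + y *\<^sub>R dual2 m n)"
          by (simp add: algebra_simps)
        also have "norm \<dots> \<le> norm ?w + norm (x *\<^sub>R dual1 m n + y *\<^sub>R dual2 m n)"
          by (rule norm_triangle_ineq4)
        also have "norm (x *\<^sub>R dual1 m n + y *\<^sub>R dual2 m n) \<le> \<bar>x\<bar> * norm (dual1 m n) + \<bar>y\<bar> * norm (dual2 m n)"
          using norm_triangle_ineq[of "x *\<^sub>R dual1 m n" "y *\<^sub>R dual2 m n"] by simp
        also have "\<dots> \<le> e * norm (dual1 m n) + e * norm (dual2 m n)"
          using xy by (intro add_mono mult_right_mono) auto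
        finally have "norm ((fst p - (of_int i + x)) *\<^sub>R dual1 m n + (snd p - (of_int j + y)) *\<^sub>R dual2 m n) \<le> 1"
          using eb by (simp add: distrib_left)
        then have "(of_int i + x, of_int j + y, - (of_int i + x) - (of_int j + y)) \<in> ?S"
          unfolding disc_image_mem_iff[OF D] .
        moreover have "of_int (- i - j) - x - y = - (of_int i + x) - (of_int j + y)" by simp
        ultimately show ?thesis by (simp only:)
      qed
    qed (use e in simp_all)
    then show ?thesis using True by simp
  qed
qed

section \<open>The distribution for a fixed direction\<close>

text \<open>The distribution of the number of hit triangles for half-lengths \<open>A\<close>, \<open>B\<close>, \<open>C\<close>, where \<open>V\<close> is the probability
of containing a vertex. With \<open>T = 2 (A B + B C + C A) - (A\<^sup>2 + B\<^sup>2 + C\<^sup>2)\<close>, the probability of meeting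
all three families, the entries for 2, 3 and 4 are \<open>2 (A + B + C) - 8 (A B + B C + C A) + 3 T\<close>,
\<open>4 (A B + B C + C A) - 3 T\<close> and \<open>T - V\<close>.\<close>

definition cell_count_prob :: "real \<Rightarrow> real \<Rightarrow> real \<Rightarrow> real \<Rightarrow> nat \<Rightarrow> real" where
  "cell_count_prob A B C V k =
    (if k = 1 then (1 - A - B - C)\<^sup>2
     else if k = 2 then 2 * (A + B + C) - 2 * (A * B + B * C + C * A) - 3 * (A\<^sup>2 + B\<^sup>2 + C\<^sup>2)
     else if k = 3 then 3 * (A\<^sup>2 + B\<^sup>2 + C\<^sup>2) - 2 * (A * B + B * C + C * A)
     else if k = 4 then 2 * (A * B + B * C + C * A) - (A\<^sup>2 + B\<^sup>2 + C\<^sup>2) - V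
     else if k = 6 then V else 0)"

lemma emeasure_unit_square: "emeasure lborel unit_square = 1"
  unfolding unit_square_def by (subst emeasure_times_plane) auto

text \<open>The three single and three pairwise probabilities are areas of strips and of products of strips. The area
\<open>(1 - A - B - C)\<^sup>2\<close> without any line then yields the triple probability by inclusion and exclusion, and the
indicator function of each count is almost everywhere a polynomial in those of the events.\<close>

lemma measure_square_cell_count:
  fixes m n :: "real \<times> real" and k :: nat
  assumes D: "cross m n \<noteq> 0" and fit: "norm m + norm n + norm (m + n) \<le> 1"
    and meas: "{p. card (hit_cells (disc_image m n p)) = k} \<in> sets borel" and k: "1 \<le> k"
  shows "emeasure lborel (unit_square \<inter> {p. card (hit_cells (disc_image m n p)) = k}) =
    ennreal (cell_count_prob (norm m) (norm n) (norm (m + n)) (pi * \<bar>cross m n\<bar>) k)"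
    and "0 \<le> cell_count_prob (norm m) (norm n) (norm (m + n)) (pi * \<bar>cross m n\<bar>) k"
proof -
  define A B C where "A = norm m" and "B = norm n" and "C = norm (m + n)"
  have tri: "A < B + C" "B < A + C" "C < A + B" and nn: "0 \<le> A" "0 \<le> B" "0 \<le> C"
    and fit': "A + B + C \<le> 1"
    using norm_add_less[OF D] fit by (simp_all add: A_def B_def C_def add_ac)
  have half: "A < 1/2" "B < 1/2" "C < 1/2"
    using tri fit' by linarith+
  note unitA = near_int_unit[OF nn(1) half(1)] and unitB = near_int_unit[OF nn(2) half(2)]
  define P0 where "P0 = uniform_measure lborel unit_square"
  interpret P0: prob_space P0
    unfolding P0_def by (rule prob_space_uniform_measure) (simp_all add: emeasure_unit_square)
  have sets_P0 [measurable_cong]: "sets P0 = sets borel" by (simp add: P0_def)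
  have em: "emeasure P0 S = emeasure lborel (unit_square \<inter> S)" if "S \<in> sets borel" for S
    unfolding P0_def using that by (subst emeasure_uniform_measure) (auto simp: emeasure_unit_square divide_ennreal_def)
  have [measurable]: "fst \<in> borel_measurable (borel :: (real \<times> real) measure)"
    "snd \<in> borel_measurable (borel :: (real \<times> real) measure)"
    by (intro borel_measurable_continuous_onI continuous_intros)+
  define X where "X = {p :: real \<times> real. fst p \<in> near_int A}"
  define Y where "Y = {p :: real \<times> real. snd p \<in> near_int B}"
  define Z where "Z = {p :: real \<times> real. fst p + snd p \<in> near_int C}"
  define W where "W = {p. vertex_within (dual1 m n) (dual2 m n) p}"
  have [measurable]: "X \<in> sets borel" "Y \<in> sets borel" "Z \<in> sets borel" "W \<in> sets borel"
    unfolding X_def Y_def Z_def W_def by measurable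
  have mX: "measure P0 X = 2 * A"
  proof -
    have "unit_square \<inter> X = ({0..<1} \<inter> near_int A) \<times> {0..<1}" by (auto simp: unit_square_def X_def)
    then have "emeasure P0 X = ennreal (2 * A)"
      by (subst em) (simp_all add: emeasure_times_plane unitA unitB)
    then show ?thesis using nn by (simp add: measure_def)
  qed
  have mY: "measure P0 Y = 2 * B"
  proof -
    have "unit_square \<inter> Y = {0..<1} \<times> ({0..<1} \<inter> near_int B)" by (auto simp: unit_square_def Y_def)
    then have "emeasure P0 Y = ennreal (2 * B)"
      by (subst em) (simp_all add: emeasure_times_plane unitA unitB)
    then show ?thesis using nn by (simp add: measure_def)
  qed
  have mXY: "measure P0 (X \<inter> Y) = 4 * (A * B)"
  proof -
    have "unit_square \<inter> (X \<inter> Y) = ({0..<1} \<inter> near_int A) \<times> ({0..<1} \<inter> near_int B)"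
      by (auto simp: unit_square_def X_def Y_def)
    then have "emeasure P0 (X \<inter> Y) = ennreal (2 * A) * ennreal (2 * B)"
      by (subst em) (simp_all add: emeasure_times_plane unitA unitB)
    also have "\<dots> = ennreal (4 * (A * B))" using nn by (simp add: ennreal_mult'[symmetric])
    finally show ?thesis using nn by (simp add: measure_def)
  qed
  have mZ: "measure P0 Z = 2 * C"
  proof -
    have "emeasure P0 Z = ennreal (2 * C)"
      using emeasure_square_near_sum(1)[of UNIV, OF _ nn(3) half(3)] by (subst em) (simp_all add: Z_def)
    then show ?thesis using nn by (simp add: measure_def)
  qed
  have mXZ: "measure P0 (X \<inter> Z) = 4 * (A * C)"
  proof -
    have "X \<inter> Z = {p. fst p \<in> near_int A \<and> fst p + snd p \<in> near_int C}" by (auto simp: X_def Z_def)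
    then have "emeasure P0 (X \<inter> Z) = ennreal (2 * A) * ennreal (2 * C)"
      using emeasure_square_near_sum(1)[OF near_int_borel nn(3) half(3), of A] unitA
      by (subst em) (simp_all)
    also have "\<dots> = ennreal (4 * (A * C))" using nn by (simp add: ennreal_mult'[symmetric])
    finally show ?thesis using nn by (simp add: measure_def)
  qed
  have mYZ: "measure P0 (Y \<inter> Z) = 4 * (B * C)"
  proof -
    have "Y \<inter> Z = {p. snd p \<in> near_int B \<and> fst p + snd p \<in> near_int C}" by (auto simp: Y_def Z_def)
    then have "emeasure P0 (Y \<inter> Z) = ennreal (2 * B) * ennreal (2 * C)"
      using emeasure_square_near_sum(2)[OF near_int_borel nn(3) half(3), of B] unitB
      by (subst em) (simp_all)
    also have "\<dots> = ennreal (4 * (B * C))" using nn by (simp add: ennreal_mult'[symmetric])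
    finally show ?thesis using nn by (simp add: measure_def)
  qed
  define N where "N = - (X \<union> Y \<union> Z)"
  have [measurable]: "N \<in> sets borel" unfolding N_def by measurable
  have mN: "measure P0 N = (1 - A - B - C)\<^sup>2"
  proof -
    have "N = {p. fst p \<notin> near_int A \<and> snd p \<notin> near_int B \<and> fst p + snd p \<notin> near_int C}"
      by (auto simp: N_def X_def Y_def Z_def)
    then have "emeasure P0 N = ennreal ((1 - A - B - C)\<^sup>2)"
      using emeasure_square_none[OF nn(1) half(1) nn(2) half(2) nn(3) half(3) fit'] tri by (subst em) simp_all
    then show ?thesis by (simp add: measure_def)
  qed
  have mW: "measure P0 W = pi * \<bar>cross m n\<bar>"
  proof -
    have d4: "fst (dual1 m n) * snd (dual2 m n) - snd (dual1 m n) * fst (dual2 m n) = 1 / cross m n"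
      using dual(4)[OF D] by (simp add: cross_def)
    have "emeasure P0 W = ennreal (pi / \<bar>1 / cross m n\<bar>)"
      unfolding em[OF \<open>W \<in> sets borel\<close>] unfolding W_def d4[symmetric]
    proof (rule emeasure_square_vertex)
      show "fst (dual1 m n) * snd (dual2 m n) - snd (dual1 m n) * fst (dual2 m n) \<noteq> 0"
        unfolding d4 using D by simp
      fix u v assume le: "norm (u *\<^sub>R dual1 m n + v *\<^sub>R dual2 m n) \<le> 1" (is "norm ?w \<le> 1")
      have "\<bar>u\<bar> = \<bar>m \<bullet> ?w\<bar>" "\<bar>v\<bar> = \<bar>n \<bullet> ?w\<bar>" unfolding dual(1,2)[OF D] by simp_all
      moreover have "\<bar>m \<bullet> ?w\<bar> \<le> A" "\<bar>n \<bullet> ?w\<bar> \<le> B"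
        using Cauchy_Schwarz_ineq2[of m ?w] Cauchy_Schwarz_ineq2[of n ?w]
          mult_left_le[OF le norm_ge_zero[of m]] mult_left_le[OF le norm_ge_zero[of n]]
        unfolding A_def B_def by linarith+
      ultimately show "\<bar>u\<bar> < 1/2 \<and> \<bar>v\<bar> < 1/2" using half by linarith
    qed
    then show ?thesis by (simp add: measure_def)
  qed
  let ?i = "indicator :: (real \<times> real) set \<Rightarrow> real \<times> real \<Rightarrow> real"
  have int: "integrable P0 (?i S)" if "S \<in> sets borel" for S
    using that by (intro integrable_real_indicator) (simp_all add: sets_P0 P0.emeasure_eq_measure)
  have ex: "(\<integral>p. ?i S p \<partial>P0) = measure P0 S" if "S \<in> sets borel" for S
    using that by (simp add: sets_P0 P0_def)
  have ints: "integrable P0 (?i X)" "integrable P0 (?i Y)" "integrable P0 (?i Z)"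
     "integrable P0 (?i (X \<inter> Y))" "integrable P0 (?i (X \<inter> Z))" "integrable P0 (?i (Y \<inter> Z))"
     "integrable P0 (?i (X \<inter> Y \<inter> Z))" "integrable P0 (?i W)"
    by (intro int; measurable)+
  have exs: "(\<integral>p. ?i X p \<partial>P0) = 2 * A" "(\<integral>p. ?i Y p \<partial>P0) = 2 * B" "(\<integral>p. ?i Z p \<partial>P0) = 2 * C"
     "(\<integral>p. ?i (X \<inter> Y) p \<partial>P0) = 4 * (A * B)" "(\<integral>p. ?i (X \<inter> Z) p \<partial>P0) = 4 * (A * C)"
     "(\<integral>p. ?i (Y \<inter> Z) p \<partial>P0) = 4 * (B * C)" "(\<integral>p. ?i W p \<partial>P0) = pi * \<bar>cross m n\<bar>"
     "(\<integral>p. ?i N p \<partial>P0) = (1 - A - B - C)\<^sup>2"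
    by (simp_all add: ex mX mY mZ mXY mXZ mYZ mW mN)
  have XYZ: "(\<integral>p. ?i (X \<inter> Y \<inter> Z) p \<partial>P0) = 2 * (A * B + B * C + C * A) - (A\<^sup>2 + B\<^sup>2 + C\<^sup>2)"
  proof -
    have "?i N p = 1 - ?i X p - ?i Y p - ?i Z p + ?i (X \<inter> Y) p + ?i (X \<inter> Z) p + ?i (Y \<inter> Z) p - ?i (X \<inter> Y \<inter> Z) p" for p
      by (simp add: N_def indicator_def)
    then have "(\<integral>p. ?i N p \<partial>P0) = (\<integral>p. 1 - ?i X p - ?i Y p - ?i Z p + ?i (X \<inter> Y) p + ?i (X \<inter> Z) p + ?i (Y \<inter> Z) p - ?i (X \<inter> Y \<inter> Z) p \<partial>P0)"
      by presburger
    also have "\<dots> = 1 - 2 * A - 2 * B - 2 * C + 4 * (A * B) + 4 * (A * C) + 4 * (B * C) - (\<integral>p. ?i (X \<inter> Y \<inter> Z) p \<partial>P0)"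
      using ints exs by (simp del: integral_indicator indicator_simps add: P0.prob_space)
    finally show ?thesis unfolding exs by (simp add: power2_eq_square algebra_simps)
  qed
  define f where "f = (\<lambda>p. if k = 1 then ?i N p
     else if k = 2 then ?i X p + ?i Y p + ?i Z p - 2 * (?i (X \<inter> Y) p + ?i (X \<inter> Z) p + ?i (Y \<inter> Z) p) + 3 * ?i (X \<inter> Y \<inter> Z) p
     else if k = 3 then ?i (X \<inter> Y) p + ?i (X \<inter> Z) p + ?i (Y \<inter> Z) p - 3 * ?i (X \<inter> Y \<inter> Z) p
     else if k = 4 then ?i (X \<inter> Y \<inter> Z) p - ?i W p
     else if k = 6 then ?i W p else 0)"
  have f [measurable]: "f \<in> borel_measurable borel" unfolding f_def by measurable
  let ?E = "{p. card (hit_cells (disc_image m n p)) = k}"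
  have "AE p in P0. ?i ?E p = f p"
    unfolding P0_def
  proof (rule AE_uniform_measureI)
    show "AE p in lborel. p \<in> unit_square \<longrightarrow> ?i ?E p = f p"
      using AE_in_general_position[OF D]
    proof eventually_elim
      case (elim p)
      note c = card_hit_cells_disc_image[OF D fit elim]
      have WX: "p \<in> W \<Longrightarrow> p \<in> X \<and> p \<in> Y \<and> p \<in> Z"
        using c(2) by (simp add: W_def X_def Y_def Z_def A_def B_def C_def)
      have card: "card (hit_cells (disc_image m n p)) = (if p \<in> W then 6 else 1 + of_bool (p \<in> X) + of_bool (p \<in> Y) + of_bool (p \<in> Z))"
        using c(1) by (simp add: W_def X_def Y_def Z_def A_def B_def C_def)
      show ?case
      proof (cases "p \<in> W")
        case True
        then show ?thesis using WX k by (auto simp: f_def N_def indicator_def card)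
      next
        case False
        then show ?thesis
          by (cases "p \<in> X"; cases "p \<in> Y"; cases "p \<in> Z") (use k in \<open>auto simp: f_def N_def indicator_def card\<close>)
      qed
    qed
  qed simp
  then have "(\<integral>p. ?i ?E p \<partial>P0) = (\<integral>p. f p \<partial>P0)"
    using meas by (intro integral_cong_AE) (auto simp: measurable_cong_sets[OF sets_P0 refl])
  also have "\<dots> = cell_count_prob A B C (pi * \<bar>cross m n\<bar>) k"
  proof -
    consider "k = 1" | "k = 2" | "k = 3" | "k = 4" | "k = 6" | "k \<notin> {1, 2, 3, 4, 6}" by blast
    then show ?thesis
    proof cases
      case 2
      then have "(\<integral>p. f p \<partial>P0) = 2 * A + 2 * B + 2 * C - 2 * (4 * (A * B) + 4 * (A * C) + 4 * (B * C))
          + 3 * (\<integral>p. ?i (X \<inter> Y \<inter> Z) p \<partial>P0)"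
        using ints exs by (simp del: integral_indicator add: f_def)
      then show ?thesis using 2 unfolding XYZ by (simp add: cell_count_prob_def algebra_simps)
    next
      case 3
      then have "(\<integral>p. f p \<partial>P0) = 4 * (A * B) + 4 * (A * C) + 4 * (B * C) - 3 * (\<integral>p. ?i (X \<inter> Y \<inter> Z) p \<partial>P0)"
        using ints exs by (simp del: integral_indicator add: f_def)
      then show ?thesis using 3 unfolding XYZ by (simp add: cell_count_prob_def algebra_simps)
    next
      case 4
      then have "(\<integral>p. f p \<partial>P0) = (\<integral>p. ?i (X \<inter> Y \<inter> Z) p \<partial>P0) - pi * \<bar>cross m n\<bar>"
        using ints exs by (simp del: integral_indicator add: f_def)
      then show ?thesis using 4 unfolding XYZ by (simp add: cell_count_prob_def algebra_simps)
    qed (use exs in \<open>simp_all del: integral_indicator add: f_def cell_count_prob_def\<close>)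
  qed
  finally have main: "measure P0 ?E = cell_count_prob A B C (pi * \<bar>cross m n\<bar>) k"
    using ex[OF meas] by simp
  then show "0 \<le> cell_count_prob (norm m) (norm n) (norm (m + n)) (pi * \<bar>cross m n\<bar>) k"
    unfolding A_def B_def C_def using measure_nonneg[of P0 ?E] by simp
  have "emeasure lborel (unit_square \<inter> ?E) = emeasure P0 ?E" using em[OF meas] by simp
  also have "\<dots> = ennreal (measure P0 ?E)" by (rule P0.emeasure_eq_measure)
  finally show "emeasure lborel (unit_square \<inter> ?E) =
    ennreal (cell_count_prob (norm m) (norm n) (norm (m + n)) (pi * \<bar>cross m n\<bar>) k)"
    unfolding main A_def B_def C_def .
qed

section \<open>Integrals of the support function over a period\<close>

lemma integral_shift_real: "integral {a..b} (\<lambda>x. f (c + x)) = integral {a + c..b + c :: real} f"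
  for f :: "real \<Rightarrow> real"
  using integral_shift_Icc_real[of a b f c] by (simp add: o_def)

lemma integral_period:
  fixes f :: "real \<Rightarrow> real"
  assumes cont: "continuous_on UNIV f" and T: "0 < T" and per: "\<And>x. f (x + T) = f x"
  shows "integral {a..a + T} f = integral {0..T} f"
proof -
  have int: "f integrable_on {c..d}" for c d
    using cont continuous_on_subset by (intro integrable_continuous_real) blast
  have pern: "f (of_nat n * T + x) = f x" for n :: nat and x
  proof (induction n)
    case (Suc n)
    then show ?case using per[of "of_nat n * T + x"] by (simp add: algebra_simps)
  qed simp
  have peri: "f (of_int i * T + x) = f x" for i x
  proof (cases i rule: int_cases2)
    case (nonneg n)
    then show ?thesis using pern by simp
  next
    case (nonpos n)
    then show ?thesis using pern[of n "of_int i * T + x"] by simp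
  qed
  define n where "n = \<lfloor>a / T\<rfloor>"
  define r where "r = a - of_int n * T"
  have r: "0 \<le> r" "r < T"
    using floor_divide_lower[OF T, of a] floor_divide_upper[OF T, of a] by (simp_all add: r_def n_def algebra_simps)
  have "integral {a..a + T} f = integral {r..r + T} (\<lambda>x. f (of_int n * T + x))"
    unfolding integral_shift_real by (simp add: r_def)
  also have "\<dots> = integral {r..r + T} f" unfolding peri ..
  also have "\<dots> = integral {r..T} f + integral {T..r + T} f"
    using Henstock_Kurzweil_Integration.integral_combine[of r T "r + T" f] r int by simp
  also have "integral {T..r + T} f = integral {0..r} (\<lambda>x. f (T + x))"
    unfolding integral_shift_real by simp
  also have "\<dots> = integral {0..r} f" using per by (simp add: add.commute)
  also have "integral {r..T} f + integral {0..r} f = integral {0..T} f"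
    using Henstock_Kurzweil_Integration.integral_combine[of 0 r T f] r int by simp
  finally show ?thesis .
qed

lemma integral_two_periods:
  fixes f :: "real \<Rightarrow> real"
  assumes cont: "continuous_on UNIV f" and T: "0 < T" and per: "\<And>x. f (x + T) = f x"
  shows "integral {0..2 * T} f = 2 * integral {0..T} f"
proof -
  have int: "f integrable_on {c..d}" for c d
    using cont continuous_on_subset by (intro integrable_continuous_real) blast
  have "integral {0..2 * T} f = integral {0..T} f + integral {T..2 * T} f"
    using Henstock_Kurzweil_Integration.integral_combine[of 0 T "2 * T" f] T int by simp
  also have "integral {T..2 * T} f = integral {0..T} f"
    using integral_period[OF assms, of T] by simp
  finally show ?thesis by simp
qed

lemma integral_even_period:
  fixes f :: "real \<Rightarrow> real"
  assumes cont: "continuous_on UNIV f" and T: "0 < T" and per: "\<And>x. f (x + 2 * T) = f x"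
    and even: "\<And>x. f (- x) = f x"
  shows "integral {0..2 * T} f = 2 * integral {0..T} f"
proof -
  have int: "f integrable_on {c..d}" for c d
    using cont continuous_on_subset by (intro integrable_continuous_real) blast
  have "integral {0..2 * T} f = integral {-T..-T + 2 * T} f"
    using integral_period[OF cont _ per, of "-T"] T by simp
  also have "\<dots> = integral {-T..0} f + integral {0..T} f"
    using Henstock_Kurzweil_Integration.integral_combine[of "- T" 0 T f] T int by simp
  also have "integral {-T..0} f = integral {0..T} f"
    using Henstock_Kurzweil_Integration.integral_reflect_real[of T 0 f] by (simp add: even)
  finally show ?thesis by simp
qed

text \<open>Translation by \<open>x\<close> does not change integrals over a period \<open>\<pi>\<close>, so a product of two translates depends only on
the difference of the translations; by the same argument that dependence is even.\<close>

lemma support_integrals: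
  fixes \<kappa> :: real
  assumes w_def: "w = (\<lambda>\<phi>. sqrt (1 - \<kappa> * (sin \<phi>)\<^sup>2))"
  shows "((\<lambda>\<phi>. w (\<phi> + x)) has_integral 4 * integral {0..pi / 2} w) {0..2 * pi}"
    and "((\<lambda>\<phi>. w (\<phi> + x) * w (\<phi> + y)) has_integral 2 * integral {0..pi} (\<lambda>\<phi>. w \<phi> * w (\<phi> + (y - x)))) {0..2 * pi}"
    and "integral {0..pi} (\<lambda>\<phi>. w \<phi> * w (\<phi> - x)) = integral {0..pi} (\<lambda>\<phi>. w \<phi> * w (\<phi> + x))"
proof -
  have w: "continuous_on UNIV w" unfolding w_def by (intro continuous_intros)
  have cont: "continuous_on S (\<lambda>\<phi>. w (\<phi> + a))" for S a
    unfolding w_def by (intro continuous_intros)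
  have per: "w (\<phi> + pi) = w \<phi>" and even: "w (- \<phi>) = w \<phi>" for \<phi> by (simp_all add: w_def)
  have per': "w (\<phi> + pi + a) = w (\<phi> + a)" for \<phi> a
    using per[of "\<phi> + a"] by (simp add: add_ac)
  have "integral {0..2 * pi} (\<lambda>\<phi>. w (\<phi> + x)) = 2 * integral {0..pi} (\<lambda>\<phi>. w (\<phi> + x))"
    by (rule integral_two_periods) (simp_all add: cont per')
  also have "integral {0..pi} (\<lambda>\<phi>. w (\<phi> + x)) = integral {x..x + pi} w"
    using integral_shift_real[of 0 pi w x] by (simp add: add.commute)
  also have "\<dots> = integral {0..pi} w"
    by (rule integral_period[OF w]) (simp_all add: per)
  also have "\<dots> = 2 * integral {0..pi / 2} w"
    using integral_even_period[OF w, of "pi / 2"] per even by simp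
  finally have "integral {0..2 * pi} (\<lambda>\<phi>. w (\<phi> + x)) = 4 * integral {0..pi / 2} w" by simp
  then show "((\<lambda>\<phi>. w (\<phi> + x)) has_integral 4 * integral {0..pi / 2} w) {0..2 * pi}"
    using integrable_integral[OF integrable_continuous_real[OF cont[of "{0..2 * pi}" x]]] by simp
  have prod: "integral {0..pi} (\<lambda>\<phi>. w (\<phi> + a) * w (\<phi> + b)) = integral {0..pi} (\<lambda>\<phi>. w \<phi> * w (\<phi> + (b - a)))" for a b
  proof -
    have "integral {0..pi} (\<lambda>\<phi>. w (\<phi> + a) * w (\<phi> + b)) = integral {a..a + pi} (\<lambda>\<phi>. w \<phi> * w (\<phi> + (b - a)))"
      using integral_shift_real[of 0 pi "\<lambda>\<phi>. w \<phi> * w (\<phi> + (b - a))" a] by (simp add: add.commute)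
    also have "\<dots> = integral {0..pi} (\<lambda>\<phi>. w \<phi> * w (\<phi> + (b - a)))"
    proof (rule integral_period)
      show "continuous_on UNIV (\<lambda>\<phi>. w \<phi> * w (\<phi> + (b - a)))"
        by (intro continuous_on_mult w cont)
      show "w (\<phi> + pi) * w (\<phi> + pi + (b - a)) = w \<phi> * w (\<phi> + (b - a))" for \<phi>
        unfolding per per' ..
    qed simp
    finally show ?thesis .
  qed
  have "integral {0..2 * pi} (\<lambda>\<phi>. w (\<phi> + x) * w (\<phi> + y)) = 2 * integral {0..pi} (\<lambda>\<phi>. w (\<phi> + x) * w (\<phi> + y))"
  proof (rule integral_two_periods)
    show "continuous_on UNIV (\<lambda>\<phi>. w (\<phi> + x) * w (\<phi> + y))" by (intro continuous_on_mult cont)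
  qed (simp_all add: per')
  then have "integral {0..2 * pi} (\<lambda>\<phi>. w (\<phi> + x) * w (\<phi> + y)) = 2 * integral {0..pi} (\<lambda>\<phi>. w \<phi> * w (\<phi> + (y - x)))"
    unfolding prod .
  moreover have "(\<lambda>\<phi>. w (\<phi> + x) * w (\<phi> + y)) integrable_on {0..2 * pi}"
    by (intro integrable_continuous_real continuous_on_mult cont)
  ultimately show "((\<lambda>\<phi>. w (\<phi> + x) * w (\<phi> + y)) has_integral 2 * integral {0..pi} (\<lambda>\<phi>. w \<phi> * w (\<phi> + (y - x)))) {0..2 * pi}"
    using integrable_integral by fastforce
  show "integral {0..pi} (\<lambda>\<phi>. w \<phi> * w (\<phi> - x)) = integral {0..pi} (\<lambda>\<phi>. w \<phi> * w (\<phi> + x))"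
    using prod[of x 0] by (simp add: mult.commute)
qed

section \<open>The thrown ellipse in lattice coordinates\<close>

text \<open>The first coordinate counts the lines parallel to \<open>b\<close>, the second those parallel to \<open>c\<close>. Minus their sum counts
the lines parallel to \<open>a\<close>.\<close>

definition lattice_coords :: "real \<Rightarrow> real \<Rightarrow> real \<Rightarrow> real \<Rightarrow> real \<Rightarrow> real \<times> real \<Rightarrow> real \<times> real" where
  "lattice_coords a b c \<alpha> \<gamma> p =
    (1 / c * fst p + (- cos \<alpha> / (a * sin \<gamma>)) * snd p, c / (a * b * sin \<gamma>) * snd p)"

definition lattice_barycentric :: "real \<Rightarrow> real \<Rightarrow> real \<Rightarrow> real \<Rightarrow> real \<Rightarrow> real \<times> real \<Rightarrow> real \<times> real \<times> real" where
  "lattice_barycentric a b c \<alpha> \<gamma> p = (fst (lattice_coords a b c \<alpha> \<gamma> p), snd (lattice_coords a b c \<alpha> \<gamma> p),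
     - fst (lattice_coords a b c \<alpha> \<gamma> p) - snd (lattice_coords a b c \<alpha> \<gamma> p))"

text \<open>The support functional of the reference ellipse in a direction at angle \<open>- \<phi>\<close> from the major axis, pulled back to
the unit disc. Its norm is the support function.\<close>

definition axis_vector :: "real \<Rightarrow> real \<Rightarrow> real \<Rightarrow> real \<times> real" where
  "axis_vector g h \<phi> = (g / 2 * cos \<phi>, - (h / 2) * sin \<phi>)"

lemma norm_real_pair: "norm (x, y) = sqrt (x\<^sup>2 + y\<^sup>2)" for x y :: real
  by (simp add: norm_Pair)

lemma ellipse_image:
  assumes "0 < g" "0 < h"
  shows "ellipse g h = (\<lambda>x. (g / 2 * fst x, h / 2 * snd x)) ` cball 0 1"
proof (intro equalityI subsetI)
  fix p assume p: "p \<in> ellipse g h"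
  obtain x y where [simp]: "p = (x, y)" by (cases p)
  have "sqrt ((x / (g / 2))\<^sup>2 + (y / (h / 2))\<^sup>2) \<le> 1"
    using p by (simp add: ellipse_def)
  then have "(x / (g / 2), y / (h / 2)) \<in> cball 0 1" by (simp add: norm_real_pair)
  moreover have "p = (g / 2 * fst (x / (g / 2), y / (h / 2)), h / 2 * snd (x / (g / 2), y / (h / 2)))"
    using assms by simp
  ultimately show "p \<in> (\<lambda>x. (g / 2 * fst x, h / 2 * snd x)) ` cball 0 1" by (rule rev_image_eqI)
next
  fix p assume "p \<in> (\<lambda>x. (g / 2 * fst x, h / 2 * snd x)) ` cball 0 1"
  then obtain x y where xy: "sqrt (x\<^sup>2 + y\<^sup>2) \<le> 1" "p = (g / 2 * x, h / 2 * y)"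
    by (auto simp: norm_real_pair)
  then have "x\<^sup>2 + y\<^sup>2 \<le> 1" by simp
  then show "p \<in> ellipse g h" using assms xy by (simp add: ellipse_def)
qed

lemma compact_ellipse:
  assumes "0 < g" "0 < h"
  shows "compact (ellipse g h)"
  unfolding ellipse_image[OF assms]
  by (intro compact_continuous_image continuous_intros compact_cball)

lemma norm_axis_vector:
  assumes g: "0 < g" and mu: "\<mu>\<^sup>2 = 1 - (h / g)\<^sup>2"
  shows "norm (axis_vector g h \<phi>) = g / 2 * sqrt (1 - \<mu>\<^sup>2 * (sin \<phi>)\<^sup>2)"
proof -
  have eq: "(g / 2 * cos \<phi>)\<^sup>2 + (- (h / 2) * sin \<phi>)\<^sup>2 = (g / 2)\<^sup>2 * (1 - \<mu>\<^sup>2 * (sin \<phi>)\<^sup>2)"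
    unfolding mu using g by (simp add: cos_squared_eq power_mult_distrib power_divide field_simps)
  show ?thesis
    unfolding axis_vector_def norm_real_pair eq real_sqrt_mult using g by simp
qed

context
  fixes a b c \<alpha> \<beta> \<gamma> Q :: real
  assumes triangle: "is_triangle a b c \<alpha> \<beta> \<gamma>" and Q: "Q = a * b * sin \<gamma>"
begin

lemmas triangle_facts = triangle_trig[OF triangle]

lemma area_eqs: "Q > 0" "a * b * sin \<gamma> = Q" "a * c * sin \<beta> = Q" "b * c * sin \<alpha> = Q"
proof -
  show "Q > 0" using triangle_facts(1,2,6) by (simp add: Q)
  show "a * b * sin \<gamma> = Q" by (simp add: Q)
  have "a * c * sin \<beta> = a * (c * sin \<beta>)" "b * c * sin \<alpha> = b * (c * sin \<alpha>)" by simp_all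
  then show "a * c * sin \<beta> = Q" "b * c * sin \<alpha> = Q"
    unfolding triangle_facts(9)[symmetric] triangle_facts(8)[symmetric] by (simp_all add: Q)
qed

lemma sine_eqs: "sin \<alpha> = Q / (b * c)" "sin \<beta> = Q / (a * c)" "sin \<gamma> = Q / (a * b)"
proof -
  show "sin \<alpha> = Q / (b * c)" unfolding area_eqs(4)[symmetric] using triangle_facts(1-3) by simp
  show "sin \<beta> = Q / (a * c)" unfolding area_eqs(3)[symmetric] using triangle_facts(1-3) by simp
  show "sin \<gamma> = Q / (a * b)" unfolding area_eqs(2)[symmetric] using triangle_facts(1-3) by simp
qed

lemma lattice_coords_eq:
  "lattice_coords a b c \<alpha> \<gamma> p = (1 / c * fst p + (- (b * cos \<alpha> / Q)) * snd p, c / Q * snd p)"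
  using triangle_facts(1-3) area_eqs(1) by (simp add: lattice_coords_def sine_eqs)

text \<open>The third family is covered by the first two because \<open>c = a cos \<beta> + b cos \<alpha>\<close>.\<close>

lemma lattice_coords_sum:
  "fst (lattice_coords a b c \<alpha> \<gamma> p) + snd (lattice_coords a b c \<alpha> \<gamma> p) = (fst p * sin \<beta> + snd p * cos \<beta>) / (b * sin \<gamma>)"
proof -
  have "(fst p * sin \<beta> + snd p * cos \<beta>) / (b * sin \<gamma>) = fst p / c + snd p * (a * cos \<beta>) / Q"
    using triangle_facts(1-3) area_eqs(1) by (simp add: sine_eqs(2,3) field_simps)
  also have "a * cos \<beta> = c - b * cos \<alpha>" using triangle_facts(10) by simp
  finally show ?thesis
    unfolding lattice_coords_eq using area_eqs(1) by (simp add: field_simps)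
qed

lemma barycentric_lattice: "barycentric (lattice_barycentric a b c \<alpha> \<gamma>)"
  unfolding barycentric_def
proof
  show "linear (lattice_barycentric a b c \<alpha> \<gamma>)"
    by (intro linearI) (simp_all add: lattice_barycentric_def lattice_coords_def algebra_simps add_divide_distrib)
  show "range (lattice_barycentric a b c \<alpha> \<gamma>) = {(x, y, z). x + y + z = 0}"
  proof (intro equalityI subsetI)
    fix q assume "q \<in> {(x, y, z). x + y + z = (0::real)}"
    then obtain u v where q: "q = (u, v, - u - v)"
      by (cases q) (auto intro!: that simp: algebra_simps)
    have "lattice_barycentric a b c \<alpha> \<gamma> (c * u + b * cos \<alpha> * v, Q / c * v) = q"
      using triangle_facts(1-3) area_eqs(1) unfolding lattice_barycentric_def lattice_coords_eq q
      by (simp add: field_simps)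
    then show "q \<in> range (lattice_barycentric a b c \<alpha> \<gamma>)" by (metis rangeI)
  qed (auto simp: lattice_barycentric_def)
qed

lemma lattice_lines_eq:
  "lattice_lines a b c \<alpha> \<beta> \<gamma> =
    - {p. coord1 (lattice_barycentric a b c \<alpha> \<gamma> p) \<notin> \<int> \<and> coord2 (lattice_barycentric a b c \<alpha> \<gamma> p) \<notin> \<int>
        \<and> coord3 (lattice_barycentric a b c \<alpha> \<gamma> p) \<notin> \<int>}"
proof (rule set_eqI)
  fix p :: "real \<times> real"
  obtain x y where p: "p = (x, y)" by (cases p)
  let ?u = "fst (lattice_coords a b c \<alpha> \<gamma> p)" and ?v = "snd (lattice_coords a b c \<alpha> \<gamma> p)"
  have pos: "b * sin \<gamma> > 0" "a * sin \<gamma> > 0" "a * sin \<beta> > 0" using triangle_facts by simp_all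
  have Ints: "r \<in> \<int> \<longleftrightarrow> (\<exists>k::int. t = of_int k * d)" if "r = t / d" "d > 0" for r t d :: real
    using that by (auto simp: Ints_def image_def field_simps)
  have "?u = (x * sin \<alpha> - y * cos \<alpha>) / (a * sin \<gamma>)"
    using triangle_facts(1-3) area_eqs(1) by (simp add: p lattice_coords_def sine_eqs field_simps)
  then have 1: "?u \<in> \<int> \<longleftrightarrow> (\<exists>k::int. x * sin \<alpha> - y * cos \<alpha> = of_int k * (a * sin \<gamma>))"
    by (rule Ints[OF _ pos(2)])
  have "?v = y / (a * sin \<beta>)"
    using triangle_facts(1-3) area_eqs(1) by (simp add: p lattice_coords_def sine_eqs field_simps)
  then have 2: "?v \<in> \<int> \<longleftrightarrow> (\<exists>k::int. y = of_int k * (a * sin \<beta>))"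
    by (rule Ints[OF _ pos(3)])
  have "?u + ?v = (x * sin \<beta> + y * cos \<beta>) / (b * sin \<gamma>)"
    using lattice_coords_sum[of p] by (simp add: p)
  then have 3: "?u + ?v \<in> \<int> \<longleftrightarrow> (\<exists>k::int. x * sin \<beta> + y * cos \<beta> = of_int k * (b * sin \<gamma>))"
    by (rule Ints[OF _ pos(1)])
  have "- ?u - ?v \<in> \<int> \<longleftrightarrow> ?u + ?v \<in> \<int>"
    by (metis Ints_minus minus_add_distrib diff_conv_add_uminus minus_minus)
  then show "p \<in> lattice_lines a b c \<alpha> \<beta> \<gamma> \<longleftrightarrow> p \<in>
    - {p. coord1 (lattice_barycentric a b c \<alpha> \<gamma> p) \<notin> \<int> \<and> coord2 (lattice_barycentric a b c \<alpha> \<gamma> p) \<notin> \<int>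
        \<and> coord3 (lattice_barycentric a b c \<alpha> \<gamma> p) \<notin> \<int>}"
    using 1 2 3 by (auto simp: lattice_lines_def lattice_barycentric_def p)
qed

text \<open>The normals of the three families make the angles \<open>\<phi>\<close>, \<open>\<phi> + \<alpha>\<close> and \<open>\<phi> + \<alpha> + \<beta>\<close> with the major axis, up to sign
and half turns, which is why the three translates of \<open>s\<close> appear.\<close>

lemma moved_ellipse_coords:
  assumes "0 < g" "0 < h"
  shows "lattice_barycentric a b c \<alpha> \<gamma> ` moved (ellipse g h) p (\<alpha> - pi / 2 + \<phi>) =
    disc_image ((b / Q) *\<^sub>R axis_vector g h \<phi>) (- (c / Q) *\<^sub>R axis_vector g h (\<phi> + \<alpha>)) (lattice_coords a b c \<alpha> \<gamma> p)"
proof -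
  have ang: "\<alpha> - pi / 2 + \<phi> = (\<phi> + \<alpha>) - pi / 2" by simp
  have cs: "cos (\<alpha> - pi / 2 + \<phi>) = sin (\<phi> + \<alpha>)" "sin (\<alpha> - pi / 2 + \<phi>) = - cos (\<phi> + \<alpha>)"
    unfolding ang by (simp_all add: cos_diff sin_diff)
  have inv: "cos \<phi> = sin \<alpha> * sin (\<phi> + \<alpha>) + cos \<alpha> * cos (\<phi> + \<alpha>)"
    "sin \<phi> = cos \<alpha> * sin (\<phi> + \<alpha>) - sin \<alpha> * cos (\<phi> + \<alpha>)"
    using cos_diff[of "\<phi> + \<alpha>" \<alpha>] sin_diff[of "\<phi> + \<alpha>" \<alpha>] by (simp_all add: algebra_simps)
  have c1: "1 / c = b * sin \<alpha> / Q" using triangle_facts(1-3) area_eqs(1) by (simp add: sine_eqs)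
  have pt: "lattice_barycentric a b c \<alpha> \<gamma>
      (fst p + g / 2 * fst x * cos (\<alpha> - pi / 2 + \<phi>) - h / 2 * snd x * sin (\<alpha> - pi / 2 + \<phi>),
       snd p + g / 2 * fst x * sin (\<alpha> - pi / 2 + \<phi>) + h / 2 * snd x * cos (\<alpha> - pi / 2 + \<phi>)) =
    (fst (lattice_coords a b c \<alpha> \<gamma> p) + (b / Q) *\<^sub>R axis_vector g h \<phi> \<bullet> x,
     snd (lattice_coords a b c \<alpha> \<gamma> p) + (- (c / Q) *\<^sub>R axis_vector g h (\<phi> + \<alpha>)) \<bullet> x,
     - (fst (lattice_coords a b c \<alpha> \<gamma> p) + snd (lattice_coords a b c \<alpha> \<gamma> p))
       - ((b / Q) *\<^sub>R axis_vector g h \<phi> + (- (c / Q) *\<^sub>R axis_vector g h (\<phi> + \<alpha>))) \<bullet> x)" for x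
  proof -
    define X Y where "X = fst x" and "Y = snd x"
    have x: "x = (X, Y)" by (simp add: X_def Y_def)
    have u: "1 / c * (fst p + g / 2 * X * sin (\<phi> + \<alpha>) - h / 2 * Y * - cos (\<phi> + \<alpha>))
        + (- (b * cos \<alpha> / Q)) * (snd p + g / 2 * X * - cos (\<phi> + \<alpha>) + h / 2 * Y * sin (\<phi> + \<alpha>)) =
        1 / c * fst p + (- (b * cos \<alpha> / Q)) * snd p + (b / Q) *\<^sub>R axis_vector g h \<phi> \<bullet> x"
      unfolding axis_vector_def inv c1 x by (simp add: algebra_simps add_divide_distrib diff_divide_distrib)
    have v: "c / Q * (snd p + g / 2 * X * - cos (\<phi> + \<alpha>) + h / 2 * Y * sin (\<phi> + \<alpha>)) =
        c / Q * snd p + (- (c / Q) *\<^sub>R axis_vector g h (\<phi> + \<alpha>)) \<bullet> x"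
      unfolding axis_vector_def x by (simp add: algebra_simps add_divide_distrib diff_divide_distrib)
    show ?thesis
      unfolding lattice_barycentric_def lattice_coords_eq cs fst_conv snd_conv X_def[symmetric] Y_def[symmetric] u v
      by (simp only: inner_add_left) simp
  qed
  show ?thesis
    unfolding moved_def ellipse_image[OF assms] disc_image_def image_image case_prod_beta fst_conv snd_conv pt ..
qed

lemma third_axis_vector:
  "(b / Q) *\<^sub>R axis_vector g h \<phi> + (- (c / Q) *\<^sub>R axis_vector g h (\<phi> + \<alpha>)) =
    - (a / Q) *\<^sub>R axis_vector g h (\<phi> + \<alpha> + \<beta>)"
proof -
  define \<psi> where "\<psi> = \<phi> + \<alpha>"
  have \<phi>: "\<phi> = \<psi> - \<alpha>" by (simp add: \<psi>_def)
  have k: "c = a * cos \<beta> + b * cos \<alpha>" "b * sin \<alpha> = a * sin \<beta>" using triangle_facts(7,10) by simp_all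
  have C: "b * cos (\<psi> - \<alpha>) - c * cos \<psi> = - (a * cos (\<psi> + \<beta>))"
  proof -
    have "b * cos (\<psi> - \<alpha>) - c * cos \<psi> = (b * cos \<alpha> - c) * cos \<psi> + (b * sin \<alpha>) * sin \<psi>"
      by (simp add: cos_diff algebra_simps)
    then show ?thesis unfolding k by (simp add: cos_add algebra_simps)
  qed
  have S: "b * sin (\<psi> - \<alpha>) - c * sin \<psi> = - (a * sin (\<psi> + \<beta>))"
  proof -
    have "b * sin (\<psi> - \<alpha>) - c * sin \<psi> = (b * cos \<alpha> - c) * sin \<psi> - (b * sin \<alpha>) * cos \<psi>"
      by (simp add: sin_diff algebra_simps)
    then show ?thesis unfolding k by (simp add: sin_add algebra_simps)
  qed
  have "b / Q * (g / 2 * cos (\<psi> - \<alpha>)) + - (c / Q) * (g / 2 * cos \<psi>) = g / (2 * Q) * (b * cos (\<psi> - \<alpha>) - c * cos \<psi>)"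
    using area_eqs(1) by (simp add: field_simps)
  then have C': "b / Q * (g / 2 * cos (\<psi> - \<alpha>)) + - (c / Q) * (g / 2 * cos \<psi>) = - (a / Q) * (g / 2 * cos (\<psi> + \<beta>))"
    unfolding C by (simp add: mult_ac)
  have "b / Q * (- (h / 2) * sin (\<psi> - \<alpha>)) + - (c / Q) * (- (h / 2) * sin \<psi>) = - (h / (2 * Q)) * (b * sin (\<psi> - \<alpha>) - c * sin \<psi>)"
    using area_eqs(1) by (simp add: field_simps)
  then have S': "b / Q * (- (h / 2) * sin (\<psi> - \<alpha>)) + - (c / Q) * (- (h / 2) * sin \<psi>) = - (a / Q) * (- (h / 2) * sin (\<psi> + \<beta>))"
    unfolding S by (simp add: mult_ac)
  show ?thesis
    unfolding \<psi>_def[symmetric] unfolding \<phi> axis_vector_def scaleR_Pair real_scaleR_def add_Pair C' S' ..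
qed

text \<open>The determinant of the pulled back coordinates is the area of the ellipse divided by \<open>\<pi> Q\<close>.\<close>

lemma cross_axis_vectors:
  "cross ((b / Q) *\<^sub>R axis_vector g h \<phi>) (- (c / Q) *\<^sub>R axis_vector g h (\<phi> + \<alpha>)) = g * h / (4 * Q)"
proof -
  have bil: "cross (x *\<^sub>R v) (y *\<^sub>R w) = x * y * cross v w" for x y and v w :: "real \<times> real"
    by (simp add: cross_def algebra_simps)
  have "cross (axis_vector g h \<phi>) (axis_vector g h (\<phi> + \<alpha>)) =
      - (g * h / 4) * (sin (\<phi> + \<alpha>) * cos \<phi> - cos (\<phi> + \<alpha>) * sin \<phi>)"
    by (simp add: cross_def axis_vector_def right_diff_distrib mult_ac)
  also have "sin (\<phi> + \<alpha>) * cos \<phi> - cos (\<phi> + \<alpha>) * sin \<phi> = sin \<alpha>"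
    using sin_diff[of "\<phi> + \<alpha>" \<phi>] by simp
  finally have "cross ((b / Q) *\<^sub>R axis_vector g h \<phi>) (- (c / Q) *\<^sub>R axis_vector g h (\<phi> + \<alpha>)) =
      (b * c / (Q * Q)) * (g * h / 4) * sin \<alpha>"
    unfolding bil by simp
  also have "(b * c / (Q * Q)) * (g * h / 4) * sin \<alpha> = g * h / (4 * Q)"
    using triangle_facts(1-3) area_eqs(1) by (simp add: sine_eqs)
  finally show ?thesis .
qed


lemma lattice_coords_measurable: "lattice_coords a b c \<alpha> \<gamma> \<in> borel \<rightarrow>\<^sub>M borel"
  unfolding lattice_coords_eq[abs_def] by (rule skew_measurable)

text \<open>The parallelogram and the unit square correspond up to boundary sides, which have no area.\<close>

lemma emeasure_parallelogram:
  assumes E: "E \<in> sets borel"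
  shows "emeasure lborel (fund_parallelogram a b c \<alpha> \<beta> \<gamma> \<inter> {p. lattice_coords a b c \<alpha> \<gamma> p \<in> E}) =
    ennreal Q * emeasure lborel (unit_square \<inter> E)"
proof -
  let ?S = "{0..1} \<times> {0..1} :: (real \<times> real) set" and ?L = "lattice_coords a b c \<alpha> \<gamma>"
  have S: "?S \<inter> E \<in> sets borel" using E by (intro sets.Int borel_Times) auto
  have in_S: "p \<in> fund_parallelogram a b c \<alpha> \<beta> \<gamma> \<longleftrightarrow> ?L p \<in> ?S" for p
  proof -
    obtain x y where p: "p = (x, y)" by (cases p)
    have cot: "cot \<alpha> = b * c * cos \<alpha> / Q" using triangle_facts(1-3) area_eqs(1) by (simp add: cot_def sine_eqs)
    have alt: "a * sin \<beta> = Q / c" using triangle_facts(1-3) by (simp add: sine_eqs)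
    show ?thesis
      unfolding p fund_parallelogram_def mem_Collect_eq case_prod_conv alt cot lattice_coords_eq
      using triangle_facts(1-3) area_eqs(1) by (auto simp: field_simps zero_le_mult_iff)
  qed
  have "fund_parallelogram a b c \<alpha> \<beta> \<gamma> \<inter> {p. ?L p \<in> E} =
      {p. (1 / c * fst p + (- (b * cos \<alpha> / Q)) * snd p, c / Q * snd p) \<in> ?S \<inter> E}"
    unfolding lattice_coords_eq[symmetric] by (intro set_eqI) (simp only: Int_iff mem_Collect_eq in_S)
  then have "ennreal (1 / c * (c / Q)) * emeasure lborel (fund_parallelogram a b c \<alpha> \<beta> \<gamma> \<inter> {p. ?L p \<in> E}) =
      emeasure lborel (?S \<inter> E)"
    using emeasure_skew[OF S, of "1 / c" "c / Q" "- (b * cos \<alpha> / Q)"] triangle_facts(1-3) area_eqs(1) by simp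
  also have "\<dots> = emeasure lborel (unit_square \<inter> E)"
  proof (rule emeasure_eq_AE)
    have "AE p in lborel. (1, 0) \<bullet> (p :: real \<times> real) \<noteq> 1" "AE p in lborel. (0, 1) \<bullet> (p :: real \<times> real) \<noteq> 1"
      by (intro AE_not_on_line; simp add: zero_prod_def)+
    then show "AE p in lborel. p \<in> ?S \<inter> E \<longleftrightarrow> p \<in> unit_square \<inter> E"
      by eventually_elim (auto simp: unit_square_def)
  qed (use S E in auto)
  finally have *: "ennreal (1 / Q) * emeasure lborel (fund_parallelogram a b c \<alpha> \<beta> \<gamma> \<inter> {p. ?L p \<in> E}) =
      emeasure lborel (unit_square \<inter> E)"
    using triangle_facts(1-3) by simp
  show ?thesis
    unfolding *[symmetric] mult.assoc[symmetric] using area_eqs(1) by (simp add: ennreal_mult'[symmetric])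
qed

context
  fixes g h :: real
  assumes gh: "0 < g" "0 < h"
begin

abbreviation "line_b_vector \<phi> \<equiv> (b / Q) *\<^sub>R axis_vector g h \<phi>"
abbreviation "line_c_vector \<phi> \<equiv> - (c / Q) *\<^sub>R axis_vector g h (\<phi> + \<alpha>)"

definition hit_event :: "nat \<Rightarrow> ((real \<times> real) \<times> real) set" where
  "hit_event i = {w. card (hit_cells (disc_image (line_b_vector (snd w)) (line_c_vector (snd w)) (lattice_coords a b c \<alpha> \<gamma> (fst w)))) = i}"

lemma card_hit_triangles:
  "card (hit_triangles a b c \<alpha> \<beta> \<gamma> (ellipse g h) w) =
    card (hit_cells (disc_image (line_b_vector (snd w)) (line_c_vector (snd w)) (lattice_coords a b c \<alpha> \<gamma> (fst w))))"
  unfolding hit_triangles_def lattice_triangles_def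
    triangles_hit[OF barycentric_lattice lattice_lines_eq] moved_ellipse_coords[OF gh] ..

lemma hit_event_borel: "hit_event i \<in> sets borel"
proof -
  have "(\<lambda>w. card (hit_cells (lattice_barycentric a b c \<alpha> \<gamma> ` moved (ellipse g h) (fst w) (\<alpha> - pi / 2 + snd w))))
      \<in> measurable borel (count_space UNIV)"
    using closed_hit_set[OF barycentric_lattice compact_ellipse[OF gh]]
    by (intro measurable_card_countable) (simp add: borel_closed)
  from measurable_sets[OF this, of "{i}"] show ?thesis
    by (simp add: vimage_def hit_event_def moved_ellipse_coords[OF gh])
qed

text \<open>By Fubini's theorem the probability is the mean over the direction of the conditional probabilities.\<close>

lemma hit_prob_eq_integral:
  assumes i: "1 \<le> i"
    and fit: "\<And>\<phi>. \<phi> \<in> {0..2 * pi} \<Longrightarrow> norm (line_b_vector \<phi>) + norm (line_c_vector \<phi>) + norm (line_b_vector \<phi> + line_c_vector \<phi>) \<le> 1"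
    and J: "((\<lambda>\<phi>. cell_count_prob (norm (line_b_vector \<phi>)) (norm (line_c_vector \<phi>)) (norm (line_b_vector \<phi> + line_c_vector \<phi>)) (pi * g * h / 4 / Q) i)
      has_integral J) {0..2 * pi}"
  shows "hit_prob a b c \<alpha> \<beta> \<gamma> (ellipse g h) i = J / (2 * pi)"
proof -
  let ?P = "fund_parallelogram a b c \<alpha> \<beta> \<gamma>" and ?L = "lattice_coords a b c \<alpha> \<gamma>"
  let ?q = "\<lambda>\<phi>. cell_count_prob (norm (line_b_vector \<phi>)) (norm (line_c_vector \<phi>)) (norm (line_b_vector \<phi> + line_c_vector \<phi>)) (pi * g * h / 4 / Q) i"
  define M1 where "M1 = uniform_measure lborel ?P"
  define M2 where "M2 = uniform_measure lborel {0..2 * pi}"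
  have sets12 [measurable_cong]: "sets M1 = sets borel" "sets M2 = sets borel" by (simp_all add: M1_def M2_def)
  have emP: "emeasure lborel ?P = ennreal Q"
    using emeasure_parallelogram[of UNIV] by (simp add: emeasure_unit_square)
  have P: "?P \<in> sets lborel"
    using emP area_eqs(1) by (metis emeasure_notin_sets ennreal_0 ennreal_eq_0_iff not_le)
  interpret M1: prob_space M1
    unfolding M1_def by (rule prob_space_uniform_measure) (use area_eqs(1) in \<open>simp_all add: emP\<close>)
  interpret M2: prob_space M2
    unfolding M2_def by (rule prob_space_uniform_measure) simp_all
  interpret pair_sigma_finite M1 M2 ..
  have sets_pair: "sets (M1 \<Otimes>\<^sub>M M2) = sets (borel :: ((real \<times> real) \<times> real) measure)"
    using sets_pair_measure_cong[OF sets12] by (simp only: Binary_Product_Measure.borel_prod)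
  have space_pair: "space (M1 \<Otimes>\<^sub>M M2) = UNIV"
    using sets_eq_imp_space_eq[OF sets_pair] by simp
  \<comment> \<open>a set of positive cardinality is finite\<close>
  have ev: "{w \<in> space (M1 \<Otimes>\<^sub>M M2). finite (hit_triangles a b c \<alpha> \<beta> \<gamma> (ellipse g h) w)
      \<and> card (hit_triangles a b c \<alpha> \<beta> \<gamma> (ellipse g h) w) = i} = hit_event i"
    using i by (auto simp: space_pair hit_event_def card_hit_triangles intro: card_ge_0_finite)
  have E: "hit_event i \<in> sets (M1 \<Otimes>\<^sub>M M2)" using hit_event_borel sets_pair by simp
  have slice: "emeasure M1 ((\<lambda>p. (p, \<phi>)) -` hit_event i) = ennreal (?q \<phi>)" "0 \<le> ?q \<phi>"
    if \<phi>: "\<phi> \<in> {0..2 * pi}" for \<phi>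
  proof -
    define G where "G = {p. card (hit_cells (disc_image (line_b_vector \<phi>) (line_c_vector \<phi>) p)) = i}"
    have D: "cross (line_b_vector \<phi>) (line_c_vector \<phi>) \<noteq> 0" and V: "pi * \<bar>cross (line_b_vector \<phi>) (line_c_vector \<phi>)\<bar> = pi * g * h / 4 / Q"
      unfolding cross_axis_vectors using gh area_eqs(1) by simp_all
    have vim: "(\<lambda>p. (p, \<phi>)) -` hit_event i = {p. ?L p \<in> G}"
      by (auto simp: hit_event_def G_def)
    have G: "G \<in> sets borel"
    proof -
      \<comment> \<open>\<open>G\<close> is measurable as a section of the hit event along the inverse of the coordinate map\<close>
      let ?inv = "\<lambda>q :: real \<times> real. (c * fst q + b * cos \<alpha> * snd q, Q / c * snd q)"
      have Linv: "?L (?inv q) = q" for q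
        using triangle_facts(1-3) area_eqs(1) unfolding lattice_coords_eq by (cases q) (simp add: field_simps)
      have "(\<lambda>q. (?inv q, \<phi>)) \<in> borel \<rightarrow>\<^sub>M borel"
        by (intro borel_measurable_continuous_onI continuous_intros)
      from measurable_sets[OF this hit_event_borel[of i]]
      have "{q. ?L (?inv q) \<in> G} \<in> sets borel"
        by (simp add: vimage_def hit_event_def G_def)
      then show ?thesis unfolding Linv by simp
    qed
    have "{p. ?L p \<in> G} \<in> sets lborel"
      using measurable_sets[OF lattice_coords_measurable G] by (simp add: vimage_def)
    then have "emeasure M1 {p. ?L p \<in> G} = emeasure lborel (?P \<inter> {p. ?L p \<in> G}) / ennreal Q"
      unfolding M1_def using P by (simp add: emP)
    also have "\<dots> = emeasure lborel (unit_square \<inter> G)"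
      unfolding emeasure_parallelogram[OF G] using area_eqs(1)
      by (simp add: ennreal_mult_divide_eq mult.commute[of "ennreal Q"])
    also have "\<dots> = ennreal (?q \<phi>)"
      using measure_square_cell_count(1)[OF D fit[OF \<phi>] G[unfolded G_def] i] unfolding V G_def .
    finally show "emeasure M1 ((\<lambda>p. (p, \<phi>)) -` hit_event i) = ennreal (?q \<phi>)" unfolding vim .
    show "0 \<le> ?q \<phi>"
      using measure_square_cell_count(2)[OF D fit[OF \<phi>] G[unfolded G_def] i] unfolding V .
  qed
  have "emeasure (M1 \<Otimes>\<^sub>M M2) (hit_event i) = (\<integral>\<^sup>+\<phi>. emeasure M1 ((\<lambda>p. (p, \<phi>)) -` hit_event i) \<partial>M2)"
    by (rule emeasure_pair_measure_alt2[OF E])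
  also have "\<dots> = (\<integral>\<^sup>+\<phi>. emeasure M1 ((\<lambda>p. (p, \<phi>)) -` hit_event i) * indicator {0..2 * pi} \<phi> \<partial>lborel) / ennreal (2 * pi)"
  proof -
    have "(\<lambda>\<phi>. emeasure M1 ((\<lambda>p. (p, \<phi>)) -` hit_event i)) \<in> borel_measurable M2"
      by (rule measurable_emeasure_Pair2[OF E])
    then have "(\<lambda>\<phi>. emeasure M1 ((\<lambda>p. (p, \<phi>)) -` hit_event i)) \<in> borel_measurable lborel"
      using sets12(2) by (simp cong: measurable_cong_sets)
    then show ?thesis unfolding M2_def by (subst nn_integral_uniform_measure) simp_all
  qed
  also have "(\<integral>\<^sup>+\<phi>. emeasure M1 ((\<lambda>p. (p, \<phi>)) -` hit_event i) * indicator {0..2 * pi} \<phi> \<partial>lborel) =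
      (\<integral>\<^sup>+\<phi>. ennreal (?q \<phi>) * indicator {0..2 * pi} \<phi> \<partial>lborel)"
    by (intro nn_integral_cong) (auto simp: indicator_def slice(1))
  also have "\<dots> = ennreal J"
    by (rule nn_integral_has_integral_lebesgue'[OF slice(2) J])
  finally have "emeasure (M1 \<Otimes>\<^sub>M M2) (hit_event i) = ennreal J / ennreal (2 * pi)" .
  moreover have "0 \<le> J" using has_integral_nonneg[OF J slice(2)] .
  ultimately have "emeasure (M1 \<Otimes>\<^sub>M M2) (hit_event i) = ennreal (J / (2 * pi))"
    by (simp add: divide_ennreal)
  then show ?thesis
    using \<open>0 \<le> J\<close> unfolding hit_prob_def throw_space_def M1_def[symmetric] M2_def[symmetric] ev
    by (simp add: measure_def)
qed

end

end

section \<open>The hitting probabilities\<close>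

theorem mainTheorem6:
  fixes a b c \<alpha> \<beta> \<gamma> g h \<mu> Q F u :: real
    and s cstar I :: "real \<Rightarrow> real"
    and p :: "nat \<Rightarrow> real"
  assumes triangle: "is_triangle a b c \<alpha> \<beta> \<gamma>"
    and axes: "0 < h" "h \<le> g"
    and mu: "\<mu>\<^sup>2 = 1 - (h / g)\<^sup>2"
    and s: "s = (\<lambda>\<phi>. g / 2 * sqrt (1 - \<mu>\<^sup>2 * (sin \<phi>)\<^sup>2))"
    and cstar: "cstar = (\<lambda>\<phi>. s \<phi> * (1 / sin \<alpha>) + s (\<phi> + \<alpha> + \<beta>) * (1 / sin \<beta>)
                              + s (\<phi> + \<alpha> + pi) * (cot \<alpha> + cot \<beta>))"
    and fits: "\<forall>\<phi>. 0 \<le> \<phi> \<and> \<phi> < 2 * pi \<longrightarrow> cstar \<phi> \<le> c"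
    and Q: "Q = a * b * sin \<gamma>"
    and F: "F = pi * g * h / 4"
    and u: "u = 2 * g * integral {0..pi / 2} (\<lambda>\<phi>. sqrt (1 - \<mu>\<^sup>2 * (sin \<phi>)\<^sup>2))"
    and I: "I = (\<lambda>x. g\<^sup>2 * integral {0..pi}
              (\<lambda>\<phi>. sqrt ((1 - \<mu>\<^sup>2 * (sin \<phi>)\<^sup>2) * (1 - \<mu>\<^sup>2 * (sin (\<phi> + x))\<^sup>2))))"
    and p: "p = hit_prob a b c \<alpha> \<beta> \<gamma> (ellipse g h)"
  shows "p 1 = 1 - (a + b + c) * u / (pi * Q) + (a\<^sup>2 + b\<^sup>2 + c\<^sup>2) * I 0 / (4 * pi * Q\<^sup>2)
               + (b * c * I \<alpha> + c * a * I \<beta> + a * b * I \<gamma>) / (2 * pi * Q\<^sup>2) \<and>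
         p 2 = (a + b + c) * u / (pi * Q) - 3 * (a\<^sup>2 + b\<^sup>2 + c\<^sup>2) * I 0 / (4 * pi * Q\<^sup>2)
               - (b * c * I \<alpha> + c * a * I \<beta> + a * b * I \<gamma>) / (2 * pi * Q\<^sup>2) \<and>
         p 3 = 3 * (a\<^sup>2 + b\<^sup>2 + c\<^sup>2) * I 0 / (4 * pi * Q\<^sup>2)
               - (b * c * I \<alpha> + c * a * I \<beta> + a * b * I \<gamma>) / (2 * pi * Q\<^sup>2) \<and>
         p 4 = (b * c * I \<alpha> + c * a * I \<beta> + a * b * I \<gamma>) / (2 * pi * Q\<^sup>2)
               - (a\<^sup>2 + b\<^sup>2 + c\<^sup>2) * I 0 / (4 * pi * Q\<^sup>2) - F / Q \<and>
         p 5 = 0 \<and>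
         p 6 = F / Q"
proof -
  note tri = triangle_trig[OF triangle]
  note Q_pos = area_eqs(1)[OF triangle Q] and sines = sine_eqs[OF triangle Q]
  have g: "0 < g" using axes by linarith
  define w where "w = (\<lambda>\<phi>. sqrt (1 - \<mu>\<^sup>2 * (sin \<phi>)\<^sup>2))"
  define A B C where "A = (\<lambda>\<phi>. b * g / (2 * Q) * w \<phi>)" and "B = (\<lambda>\<phi>. c * g / (2 * Q) * w (\<phi> + \<alpha>))"
    and "C = (\<lambda>\<phi>. a * g / (2 * Q) * w (\<phi> + \<alpha> + \<beta>))"
  let ?m = "\<lambda>\<phi>. (b / Q) *\<^sub>R axis_vector g h \<phi>" and ?n = "\<lambda>\<phi>. - (c / Q) *\<^sub>R axis_vector g h (\<phi> + \<alpha>)"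
  have norms: "norm (?m \<phi>) = A \<phi>" "norm (?n \<phi>) = B \<phi>" "norm (?m \<phi> + ?n \<phi>) = C \<phi>" for \<phi>
  proof -
    have nav: "norm (axis_vector g h \<psi>) = g / 2 * w \<psi>" for \<psi>
      unfolding w_def by (rule norm_axis_vector[OF g mu])
    show "norm (?m \<phi>) = A \<phi>" "norm (?n \<phi>) = B \<phi>" "norm (?m \<phi> + ?n \<phi>) = C \<phi>"
      unfolding third_axis_vector[OF triangle Q] A_def B_def C_def using tri(1-3) Q_pos by (simp_all add: nav)
  qed
  have cstar_eq: "cstar \<phi> = c * (A \<phi> + B \<phi> + C \<phi>)" for \<phi>
  proof -
    have s': "s \<psi> = g / 2 * w \<psi>" for \<psi> by (simp add: s w_def)
    have "s (\<phi> + \<alpha> + pi) = s (\<phi> + \<alpha>)" by (simp add: s)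
    moreover have "cot \<alpha> + cot \<beta> = c * (a * cos \<beta> + b * cos \<alpha>) / Q"
      using tri(1-3) Q_pos by (simp add: cot_def sines field_simps)
    ultimately have "cstar \<phi> = s \<phi> * (b * c / Q) + s (\<phi> + \<alpha> + \<beta>) * (a * c / Q) + s (\<phi> + \<alpha>) * (c * c / Q)"
      unfolding cstar tri(10) by (simp add: sines)
    then show ?thesis
      unfolding s' A_def B_def C_def using Q_pos by (simp add: field_simps)
  qed
  have fit: "norm (?m \<phi>) + norm (?n \<phi>) + norm (?m \<phi> + ?n \<phi>) \<le> 1" if "\<phi> \<in> {0..2 * pi}" for \<phi>
  proof -
    have "cstar \<phi> \<le> c"
    \<comment> \<open>the hypothesis leaves out the right end of the period\<close>
    proof (cases "\<phi> = 2 * pi")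
      case True
      have "cstar (2 * pi) = cstar 0"
        unfolding cstar s by (simp add: sin_add cos_add)
      then show ?thesis using fits True by simp
    qed (use that fits in auto)
    then show ?thesis unfolding norms cstar_eq using tri(3) by simp
  qed
  define S1 S2 S3 where "S1 = (a + b + c) * u / Q" and "S2 = (a\<^sup>2 + b\<^sup>2 + c\<^sup>2) * I 0 / (2 * Q\<^sup>2)"
    and "S3 = (b * c * I \<alpha> + c * a * I \<beta> + a * b * I \<gamma>) / (2 * Q\<^sup>2)"
  note sq = support_integrals[OF w_def]
  have I_eq: "I x = g\<^sup>2 * integral {0..pi} (\<lambda>\<phi>. w \<phi> * w (\<phi> + x))" for x
    unfolding I w_def by (simp add: real_sqrt_mult)
  \<comment> \<open>\<open>\<alpha> + \<beta>\<close> and \<open>-\<gamma>\<close> differ by half a turn, and \<open>I\<close> is even\<close>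
  have I\<gamma>: "I (\<alpha> + \<beta>) = I \<gamma>"
  proof -
    have "sin (\<phi> + (\<alpha> + \<beta>)) = - sin (\<phi> - \<gamma>)" for \<phi>
      unfolding sin_add[of \<phi> "\<alpha> + \<beta>"] tri(11,12) by (simp add: sin_diff)
    then have "w (\<phi> + (\<alpha> + \<beta>)) = w (\<phi> - \<gamma>)" for \<phi> by (simp add: w_def)
    then show ?thesis unfolding I_eq by (simp add: sq(3))
  qed
  have linear: "((\<lambda>\<phi>. k * w (\<phi> + x)) has_integral k * (2 * u / g)) {0..2 * pi}" for k x
  proof -
    have "4 * integral {0..pi / 2} w = 2 * u / g" using g by (simp add: u w_def)
    then show ?thesis using has_integral_mult_right[OF sq(1)[of x], of k] by simp
  qed
  have quadratic: "((\<lambda>\<phi>. k * (w (\<phi> + x) * w (\<phi> + y))) has_integral k * (2 * I (y - x) / g\<^sup>2)) {0..2 * pi}" for k x y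
    using has_integral_mult_right[OF sq(2)[of x y], of k] g by (simp add: I_eq)
  have H1: "((\<lambda>\<phi>. A \<phi> + B \<phi> + C \<phi>) has_integral S1) {0..2 * pi}"
  proof -
    have "((\<lambda>\<phi>. b * g / (2 * Q) * w (\<phi> + 0) + c * g / (2 * Q) * w (\<phi> + \<alpha>) + a * g / (2 * Q) * w (\<phi> + (\<alpha> + \<beta>)))
      has_integral b * g / (2 * Q) * (2 * u / g) + c * g / (2 * Q) * (2 * u / g) + a * g / (2 * Q) * (2 * u / g)) {0..2 * pi}"
      by (intro has_integral_add linear)
    moreover have "b * g / (2 * Q) * (2 * u / g) + c * g / (2 * Q) * (2 * u / g) + a * g / (2 * Q) * (2 * u / g) = S1"
      using g Q_pos by (simp add: S1_def field_simps)
    ultimately show ?thesis by (simp add: A_def B_def C_def add.assoc)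
  qed
  have H2: "((\<lambda>\<phi>. (A \<phi>)\<^sup>2 + (B \<phi>)\<^sup>2 + (C \<phi>)\<^sup>2) has_integral S2) {0..2 * pi}"
  proof -
    let ?k = "\<lambda>t. t\<^sup>2 * g\<^sup>2 / (4 * Q\<^sup>2)"
    have "((\<lambda>\<phi>. ?k b * (w (\<phi> + 0) * w (\<phi> + 0)) + ?k c * (w (\<phi> + \<alpha>) * w (\<phi> + \<alpha>)) + ?k a * (w (\<phi> + (\<alpha> + \<beta>)) * w (\<phi> + (\<alpha> + \<beta>))))
      has_integral ?k b * (2 * I (0 - 0) / g\<^sup>2) + ?k c * (2 * I (\<alpha> - \<alpha>) / g\<^sup>2) + ?k a * (2 * I ((\<alpha> + \<beta>) - (\<alpha> + \<beta>)) / g\<^sup>2)) {0..2 * pi}"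
      by (intro has_integral_add quadratic)
    moreover have "?k b * (2 * I (0 - 0) / g\<^sup>2) + ?k c * (2 * I (\<alpha> - \<alpha>) / g\<^sup>2) + ?k a * (2 * I ((\<alpha> + \<beta>) - (\<alpha> + \<beta>)) / g\<^sup>2) = S2"
      using g Q_pos by (simp add: S2_def field_simps)
    moreover have "(A \<phi>)\<^sup>2 + (B \<phi>)\<^sup>2 + (C \<phi>)\<^sup>2 = ?k b * (w (\<phi> + 0) * w (\<phi> + 0)) + ?k c * (w (\<phi> + \<alpha>) * w (\<phi> + \<alpha>)) + ?k a * (w (\<phi> + (\<alpha> + \<beta>)) * w (\<phi> + (\<alpha> + \<beta>)))" for \<phi>
      by (simp add: A_def B_def C_def power2_eq_square add.assoc mult_ac)
    ultimately show ?thesis by simp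
  qed
  have H3: "((\<lambda>\<phi>. A \<phi> * B \<phi> + B \<phi> * C \<phi> + C \<phi> * A \<phi>) has_integral S3) {0..2 * pi}"
  proof -
    let ?k = "\<lambda>t. t * g\<^sup>2 / (4 * Q\<^sup>2)"
    have "((\<lambda>\<phi>. ?k (b * c) * (w (\<phi> + 0) * w (\<phi> + \<alpha>)) + ?k (c * a) * (w (\<phi> + \<alpha>) * w (\<phi> + (\<alpha> + \<beta>))) + ?k (a * b) * (w (\<phi> + 0) * w (\<phi> + (\<alpha> + \<beta>))))
      has_integral ?k (b * c) * (2 * I (\<alpha> - 0) / g\<^sup>2) + ?k (c * a) * (2 * I ((\<alpha> + \<beta>) - \<alpha>) / g\<^sup>2) + ?k (a * b) * (2 * I ((\<alpha> + \<beta>) - 0) / g\<^sup>2)) {0..2 * pi}"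
      by (intro has_integral_add quadratic)
    moreover have "?k (b * c) * (2 * I (\<alpha> - 0) / g\<^sup>2) + ?k (c * a) * (2 * I ((\<alpha> + \<beta>) - \<alpha>) / g\<^sup>2) + ?k (a * b) * (2 * I ((\<alpha> + \<beta>) - 0) / g\<^sup>2) = S3"
      using g Q_pos by (simp add: S3_def I\<gamma> field_simps)
    moreover have "A \<phi> * B \<phi> + B \<phi> * C \<phi> + C \<phi> * A \<phi> = ?k (b * c) * (w (\<phi> + 0) * w (\<phi> + \<alpha>)) + ?k (c * a) * (w (\<phi> + \<alpha>) * w (\<phi> + (\<alpha> + \<beta>))) + ?k (a * b) * (w (\<phi> + 0) * w (\<phi> + (\<alpha> + \<beta>)))" for \<phi>
      by (simp add: A_def B_def C_def power2_eq_square add.assoc mult_ac)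
    ultimately show ?thesis by simp
  qed
  define V where "V = F / Q"
  have HK: "((\<lambda>\<phi>. k) has_integral k * (2 * pi)) {0..2 * pi}" for k :: real
    using has_integral_const_real[of k 0 "2 * pi"] by (simp add: mult.commute)
  have hits: "p i = J / (2 * pi)"
    if "1 \<le> i" "((\<lambda>\<phi>. cell_count_prob (A \<phi>) (B \<phi>) (C \<phi>) V i) has_integral J) {0..2 * pi}" for i J
  proof -
    have J: "((\<lambda>\<phi>. cell_count_prob (norm (?m \<phi>)) (norm (?n \<phi>)) (norm (?m \<phi> + ?n \<phi>)) (pi * g * h / 4 / Q) i)
        has_integral J) {0..2 * pi}"
      using that(2) unfolding norms V_def F .
    show ?thesis
      unfolding p by (rule hit_prob_eq_integral[OF triangle Q g axes(1) that(1) _ J]) (rule fit)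
  qed
  have coeffs: "(a + b + c) * u / (pi * Q) = 2 * S1 / (2 * pi)"
    "(a\<^sup>2 + b\<^sup>2 + c\<^sup>2) * I 0 / (4 * pi * Q\<^sup>2) = S2 / (2 * pi)"
    "3 * (a\<^sup>2 + b\<^sup>2 + c\<^sup>2) * I 0 / (4 * pi * Q\<^sup>2) = 3 * S2 / (2 * pi)"
    "(b * c * I \<alpha> + c * a * I \<beta> + a * b * I \<gamma>) / (2 * pi * Q\<^sup>2) = 2 * S3 / (2 * pi)"
  proof -
    have scale: "x / (pi * y) = 2 * (x / y) / (2 * pi)" "x / (4 * pi * y) = x / (2 * y) / (2 * pi)"
      "3 * x * z / (4 * pi * y) = 3 * (x * z / (2 * y)) / (2 * pi)"
      "x / (2 * pi * y) = 2 * (x / (2 * y)) / (2 * pi)" for x y z :: real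
      by (simp_all add: mult_ac)
    show "(a + b + c) * u / (pi * Q) = 2 * S1 / (2 * pi)"
      "(a\<^sup>2 + b\<^sup>2 + c\<^sup>2) * I 0 / (4 * pi * Q\<^sup>2) = S2 / (2 * pi)"
      "3 * (a\<^sup>2 + b\<^sup>2 + c\<^sup>2) * I 0 / (4 * pi * Q\<^sup>2) = 3 * S2 / (2 * pi)"
      "(b * c * I \<alpha> + c * a * I \<beta> + a * b * I \<gamma>) / (2 * pi * Q\<^sup>2) = 2 * S3 / (2 * pi)"
      unfolding S1_def S2_def S3_def by (rule scale)+
  qed
  have count_prob:
    "cell_count_prob x y z v 2 = 2 * (x + y + z) - 2 * (x * y + y * z + z * x) - 3 * (x\<^sup>2 + y\<^sup>2 + z\<^sup>2)"
    "cell_count_prob x y z v 3 = 3 * (x\<^sup>2 + y\<^sup>2 + z\<^sup>2) - 2 * (x * y + y * z + z * x)"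
    "cell_count_prob x y z v 4 = 2 * (x * y + y * z + z * x) - (x\<^sup>2 + y\<^sup>2 + z\<^sup>2) - v" for x y z v
    by (simp_all add: cell_count_prob_def)
  have "p 1 = (1 * (2 * pi) - 2 * S1 + S2 + 2 * S3) / (2 * pi)"
  proof (rule hits)
    have "((\<lambda>\<phi>. 1 - 2 * (A \<phi> + B \<phi> + C \<phi>) + ((A \<phi>)\<^sup>2 + (B \<phi>)\<^sup>2 + (C \<phi>)\<^sup>2) + 2 * (A \<phi> * B \<phi> + B \<phi> * C \<phi> + C \<phi> * A \<phi>))
       has_integral 1 * (2 * pi) - 2 * S1 + S2 + 2 * S3) {0..2 * pi}"
      by (intro has_integral_add has_integral_diff has_integral_mult_right H1 H2 H3 HK)
    then show "((\<lambda>\<phi>. cell_count_prob (A \<phi>) (B \<phi>) (C \<phi>) V 1) has_integral 1 * (2 * pi) - 2 * S1 + S2 + 2 * S3) {0..2 * pi}"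
      by (rule has_integral_eq[rotated]) (simp add: cell_count_prob_def power2_eq_square algebra_simps)
  qed simp
  moreover have "p 2 = (2 * S1 - 2 * S3 - 3 * S2) / (2 * pi)"
  proof (rule hits)
    show "((\<lambda>\<phi>. cell_count_prob (A \<phi>) (B \<phi>) (C \<phi>) V 2) has_integral 2 * S1 - 2 * S3 - 3 * S2) {0..2 * pi}"
      unfolding count_prob by (intro has_integral_diff has_integral_mult_right H1 H2 H3)
  qed simp
  moreover have "p 3 = (3 * S2 - 2 * S3) / (2 * pi)"
  proof (rule hits)
    show "((\<lambda>\<phi>. cell_count_prob (A \<phi>) (B \<phi>) (C \<phi>) V 3) has_integral 3 * S2 - 2 * S3) {0..2 * pi}"
      unfolding count_prob by (intro has_integral_diff has_integral_mult_right H1 H2 H3)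
  qed simp
  moreover have "p 4 = (2 * S3 - S2 - V * (2 * pi)) / (2 * pi)"
  proof (rule hits)
    show "((\<lambda>\<phi>. cell_count_prob (A \<phi>) (B \<phi>) (C \<phi>) V 4) has_integral 2 * S3 - S2 - V * (2 * pi)) {0..2 * pi}"
      unfolding count_prob by (intro has_integral_diff has_integral_mult_right H1 H2 H3 HK)
  qed simp
  moreover have "p 5 = 0 * (2 * pi) / (2 * pi)"
  proof (rule hits)
    show "((\<lambda>\<phi>. cell_count_prob (A \<phi>) (B \<phi>) (C \<phi>) V 5) has_integral 0 * (2 * pi)) {0..2 * pi}"
      using HK[of 0] by (simp add: cell_count_prob_def)
  qed simp
  moreover have "p 6 = V * (2 * pi) / (2 * pi)"
  proof (rule hits)
    show "((\<lambda>\<phi>. cell_count_prob (A \<phi>) (B \<phi>) (C \<phi>) V 6) has_integral V * (2 * pi)) {0..2 * pi}"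
      using HK[of V] by (simp add: cell_count_prob_def)
  qed simp
  ultimately show ?thesis
    unfolding coeffs V_def by (simp add: add_divide_distrib diff_divide_distrib)
qed

end
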